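(* Let $X>0$, $n\ge1$, let $A_0,A_1,A_2$ be $X$-periodic $\mathbb{C}^{n\times n}$-valued functions in $L^2_{\rm per}([0,X])$, with $A_2$ symmetric positive definite and $A_2(x)\ge CI$ for all $x$, for some $C>0$. Let $LU=\partial_x^2(A_2U)+\partial_x(A_1U)+A_0U$ on $L^2_{\rm per}([0,X];\mathbb{C}^n)$, and for $J\in\mathbb{N}$ let $L_J=P_JLP_J|_{\mathcal{H}_J}$ be the Hill's method truncation, where $P_J$ is the orthogonal projection onto $\mathcal{H}_J=\operatorname{span}\{e^{2\pi ikx/X}v:|k|\le J, v\in\mathbb{C}^n\}$. Then Hill's method converges in location and multiplicity: for any $R>0$ such that $L$ has no eigenvalue on $\{|\lambda|=R\}$ and every sufficiently small $\varepsilon>0$, there is $J_0$ such that for all $J\ge J_0$ every eigenvalue of $L_J$ in $\{|\lambda|<R\}$ lies within $\varepsilon$ of an eigenvalue of $L$, and for each eigenvalue $\lambda_*$ of $L$ with $|\lambda_*|<R$ the number of eigenvalues of $L_J$ (counted with algebraic multiplicity) in $\{|\lambda-\lambda_*|<\varepsilon\}$ equals the algebraic multiplicity of $\lambda_*$.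
   Context: In Fourier coordinates $L_J=\mathcal{D}_J^2\mathcal{A}_{2,J}+\mathcal{D}_J\mathcal{A}_{1,J}+\mathcal{A}_{0,J}$, where $\mathcal{D}_J$ is diagonal with entries $2\pi ik/X$ ($|k|\le J$) and $\mathcal{A}_{m,J}=(\hat A_m(j-k))_{|j|,|k|\le J}$ is the truncated block Toeplitz matrix of Fourier coefficients of $A_m$. Eigenvalues of $L$ are taken in $L^2_{\rm per}([0,X];\mathbb{C}^n)$. *)

theory Defs
  imports "HOL-Analysis.Analysis" "HOL-Library.Extended_Nat"
begin

text \<open>Everything is expressed in Fourier coordinates: a function
  U in L2_per([0,X]; C^n) is identified (Parseval) with its sequence of Fourier
  coefficients U-hat :: int => C^n, which lies in l2(Z; C^n).
  The index type 'n (finite, nonempty) plays the role of {1..n}.\<close>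

type_synonym 'n fseq = "int \<Rightarrow> complex^'n"

definition L2_per :: "real \<Rightarrow> (real \<Rightarrow> complex^'n^'m) \<Rightarrow> bool" where
  "L2_per X A \<longleftrightarrow> (\<forall>x. A (x + X) = A x) \<and> A \<in> borel_measurable lebesgue \<and>
     set_integrable lebesgue {0..X} (\<lambda>x. (norm (A x))^2)"

definition fourier_coeff :: "real \<Rightarrow> (real \<Rightarrow> complex^'n^'m) \<Rightarrow> int \<Rightarrow> complex^'n^'m" where
  "fourier_coeff X A k = (\<chi> i j. complex_of_real (1 / X) *
      (LINT x:{0..X}|lebesgue. A x $ i $ j * exp (- (2 * complex_of_real pi * \<i> * of_int k * of_real x / of_real X))))"

definition l2seq :: "'n::finite fseq \<Rightarrow> bool" where
  "l2seq U \<longleftrightarrow> (\<lambda>k. (norm (U k))^2) summable_on UNIV"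

text \<open>Fourier coefficients of the product A U: convolution.\<close>
definition conv :: "(int \<Rightarrow> complex^'n^'n) \<Rightarrow> 'n::finite fseq \<Rightarrow> 'n fseq" where
  "conv Ah U j = infsum (\<lambda>k. Ah (j - k) *v U k) UNIV"

text \<open>L U = (A2 U)'' + (A1 U)' + A0 U in Fourier coordinates.\<close>
definition hill_op :: "real \<Rightarrow> (real \<Rightarrow> complex^'n^'n) \<Rightarrow> (real \<Rightarrow> complex^'n^'n) \<Rightarrow>
    (real \<Rightarrow> complex^'n^'n) \<Rightarrow> 'n::finite fseq \<Rightarrow> 'n fseq" where
  "hill_op X A0 A1 A2 U j =
     (let d = 2 * complex_of_real pi * \<i> * of_int j / of_real X in
        (d^2) *s conv (fourier_coeff X A2) U j + d *s conv (fourier_coeff X A1) U j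
        + conv (fourier_coeff X A0) U j)"

definition trunc :: "nat \<Rightarrow> 'n::finite fseq \<Rightarrow> 'n fseq" where
  "trunc J U k = (if \<bar>k\<bar> \<le> int J then U k else 0)"

definition in_H :: "nat \<Rightarrow> 'n::finite fseq \<Rightarrow> bool" where
  "in_H J U \<longleftrightarrow> (\<forall>k. int J < \<bar>k\<bar> \<longrightarrow> U k = 0)"

definition hill_trunc :: "real \<Rightarrow> (real \<Rightarrow> complex^'n^'n) \<Rightarrow> (real \<Rightarrow> complex^'n^'n) \<Rightarrow>
    (real \<Rightarrow> complex^'n^'n) \<Rightarrow> nat \<Rightarrow> 'n::finite fseq \<Rightarrow> 'n fseq" where
  "hill_trunc X A0 A1 A2 J U = trunc J (hill_op X A0 A1 A2 (trunc J U))"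

definition shift_op :: "('n::finite fseq \<Rightarrow> 'n fseq) \<Rightarrow> complex \<Rightarrow> 'n fseq \<Rightarrow> 'n fseq" where
  "shift_op T \<mu> U = (\<lambda>k. T U k - \<mu> *s U k)"

definition is_eigenvalue :: "('n::finite fseq \<Rightarrow> bool) \<Rightarrow> ('n fseq \<Rightarrow> 'n fseq) \<Rightarrow> complex \<Rightarrow> bool" where
  "is_eigenvalue D T \<mu> \<longleftrightarrow> (\<exists>U. D U \<and> U \<noteq> (\<lambda>k. 0) \<and> T U = (\<lambda>k. \<mu> *s U k))"

text \<open>Generalized eigenspace: union of ker (T - mu)^m, all iterates staying in the space
  (hence every non-final iterate lies in the domain of T).\<close>
definition gen_eigenspace :: "('n::finite fseq \<Rightarrow> bool) \<Rightarrow> ('n fseq \<Rightarrow> 'n fseq) \<Rightarrow> complex \<Rightarrow> 'n fseq set" where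
  "gen_eigenspace D T \<mu> = {U. \<exists>m. (\<forall>i\<le>m. D ((shift_op T \<mu> ^^ i) U)) \<and> (shift_op T \<mu> ^^ m) U = (\<lambda>k. 0)}"

definition lin_indep_seq :: "'n::finite fseq set \<Rightarrow> bool" where
  "lin_indep_seq S \<longleftrightarrow> (\<forall>c. (\<forall>j. (\<Sum>V\<in>S. c V *s V j) = 0) \<longrightarrow> (\<forall>V\<in>S. c V = 0))"

definition alg_mult :: "('n::finite fseq \<Rightarrow> bool) \<Rightarrow> ('n fseq \<Rightarrow> 'n fseq) \<Rightarrow> complex \<Rightarrow> enat" where
  "alg_mult D T \<mu> = Sup {enat (card S) | S. finite S \<and> S \<subseteq> gen_eigenspace D T \<mu> \<and> lin_indep_seq S}"

end

theory Submission
  imports Defs "HOL-Complex_Analysis.Complex_Analysis" "HOL-Library.Function_Algebras"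
    "HOL-Computational_Algebra.Fundamental_Theorem_Algebra"
begin

text \<open>
  The truncated Toeplitz matrices of \<open>A2\<close> are uniformly coercive, and the sequences
  \<open>conv A2 p\<close> with \<open>p\<close> finitely supported are dense in \<open>l2\<close>. Hence, if \<open>U s\<close> is a bounded sequence in
  \<open>H (J s)\<close>, \<open>J s\<close> tending to infinity, for which \<open>(L_J - z) U s\<close> stays bounded, then \<open>conv A2 (U s)\<close>, cut off
  at \<open>J s\<close>, is \<open>O(1 / k)\<close> in the frequency \<open>k\<close> and \<open>U s\<close> subconverges in \<open>l2\<close>: the truncations are
  collectively compact. Consequently resolvents converge strongly, uniformly on compact sets that contain
  no eigenvalue of \<open>L\<close>.

  For the multiplicities no determinant is needed. A generalized eigenspace of \<open>L_J\<close> carries an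
  orthonormal flag, and flags of a fixed length subconverge to a flag of \<open>L\<close>, so the multiplicity
  in a small disc can only drop in passing to finite \<open>J\<close>. Conversely, the contour integral of
  \<open>(z - L_J)\<^sup>-\<^sup>1 P_J u\<close> around the disc converges to \<open>u\<close> for each generalized eigenvector \<open>u\<close> of \<open>L\<close>,
  so linearly independent \<open>u\<close> yield linearly independent elements of the spectral subspace of \<open>L_J\<close>.
  An infinite flag of \<open>L\<close> with bounded eigenvalues would contradict compactness (Riesz), whence eigenvalues of \<open>L\<close>
  are isolated and have finite multiplicity.
\<close>

section \<open>Generalized eigenspaces of operators on sequences\<close>

text \<open>The obstacle is that \<open>A2\<close> is merely in \<open>L2\<close>: convolution with
  \<open>Ah2\<close> is unbounded on \<open>l2\<close>, and coercivity gives only a lower bound. Two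
  facts replace boundedness. A single frequency of a convolution is a pairing with a fixed
  \<open>l2\<close> sequence, so equations survive weak limits. And \<open>A2\<close> has a bounded
  inverse, so a finitely supported \<open>p\<close> can bring \<open>conv Ah2 p\<close> close to any
  target; coercivity applied to \<open>U s - p\<close>, which lies in the truncated space once the
  cutoff exceeds that of \<open>p\<close>, then upgrades weak convergence to strong. The decay rate
  is dictated by the first-order term: its convolution is bounded frequency by frequency, and
  division by the squared frequency leaves a first power, just enough for square summability. The
  resolvent of \<open>L\<close> is applied only to vectors whose preimage can be written down
  algebraically: a finite Neumann sum on a generalized eigenspace, or back substitution along a
  flag. Resolvent convergence therefore takes the limiting solution as given. The regular point on
  which the compactness arguments rest is \<open>z0 = R\<close>, supplied by the hypothesis on the
  circle.\<close>

definition scl :: "complex \<Rightarrow> 'n::finite fseq \<Rightarrow> 'n fseq" where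
  "scl c U = (\<lambda>k. c *s U k)"

lemma scl_apply: "scl c U k = c *s U k"
  by (simp add: scl_def)

lemma fseq_sum_apply: "(\<Sum>x\<in>S. f x) k = (\<Sum>x\<in>S. f x k)" for f :: "'a \<Rightarrow> 'n::finite fseq"
  by (induction S rule: infinite_finite_induct) (auto simp: plus_fun_apply)

lemmas fseq_apply = plus_fun_apply zero_fun_apply minus_apply uminus_apply scl_apply fseq_sum_apply

text \<open>As simp rules these would also rewrite the eta-expanded sequences produced by induction.\<close>

declare plus_fun_apply [simp del] zero_fun_apply [simp del] minus_apply [simp del] uminus_apply [simp del]

global_interpretation fs: vector_space "scl :: complex \<Rightarrow> 'n::finite fseq \<Rightarrow> 'n fseq"
  by unfold_locales (auto simp: fun_eq_iff fseq_apply vector_add_ldistrib vector_sadd_rdistrib)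

lemma shift_op_eq: "shift_op T \<mu> U = T U - scl \<mu> U"
  by (simp add: shift_op_def fun_eq_iff fseq_apply)

lemma lin_indep_seq_iff_independent:
  assumes "finite S"
  shows "lin_indep_seq S \<longleftrightarrow> fs.independent S"
proof -
  have "(\<Sum>V\<in>S. scl (c V) V) = 0 \<longleftrightarrow> (\<forall>j. (\<Sum>V\<in>S. c V *s V j) = 0)" for c
    by (simp only: fun_eq_iff fseq_sum_apply scl_apply zero_fun_apply)
  then show ?thesis
    unfolding lin_indep_seq_def fs.dependent_finite[OF assms] by (simp only:) blast
qed

text \<open>Indexed families are used instead of sets because the vectors may coincide: Krylov
  iterates and projected vectors can repeat, and a repetition is itself a dependence.\<close>

lemma family_dependent:
  assumes "finite F" "finite I" "card F < card I" "\<And>i. i \<in> I \<Longrightarrow> v i \<in> fs.span F"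
  shows "\<exists>c. (\<exists>i\<in>I. c i \<noteq> 0) \<and> (\<Sum>i\<in>I. scl (c i) (v i)) = 0"
proof (cases "inj_on v I")
  case True
  have "fs.dependent (v ` I)"
  proof (rule ccontr)
    assume "\<not> fs.dependent (v ` I)"
    then have "card (v ` I) \<le> card F"
      using fs.independent_span_bound[of F "v ` I"] assms by auto
    then show False using assms card_image[OF True] by simp
  qed
  then obtain u where u: "\<exists>w\<in>v ` I. u w \<noteq> 0" "(\<Sum>w\<in>v ` I. scl (u w) w) = 0"
    using fs.dependent_finite[of "v ` I"] assms by auto
  then have "(\<Sum>i\<in>I. scl (u (v i)) (v i)) = 0"
    using True by (simp add: sum.reindex)
  with u show ?thesis by (intro exI[of _ "u \<circ> v"]) auto
next
  case False
  then obtain a b where ab: "a \<in> I" "b \<in> I" "a \<noteq> b" "v a = v b"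
    unfolding inj_on_def by auto
  define c where "c = (\<lambda>i. if i = a then 1 else if i = b then -1 else (0::complex))"
  have "(\<Sum>i\<in>I. scl (c i) (v i)) = (\<Sum>i\<in>{a,b}. scl (c i) (v i))"
    using ab assms(2) by (intro sum.mono_neutral_right) (auto simp: c_def)
  also have "\<dots> = 0"
    using ab by (simp add: c_def)
  finally show ?thesis using ab by (intro exI[of _ c]) (auto simp: c_def)
qed

locale fseq_linear_on =
  fixes D :: "'n::finite fseq \<Rightarrow> bool" and T :: "'n fseq \<Rightarrow> 'n fseq"
  assumes D_zero: "D 0"
    and D_add: "\<And>U V. D U \<Longrightarrow> D V \<Longrightarrow> D (U + V)"
    and D_scl: "\<And>c U. D U \<Longrightarrow> D (scl c U)"
    and T_add: "\<And>U V. D U \<Longrightarrow> D V \<Longrightarrow> T (U + V) = T U + T V"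
    and T_scl: "\<And>c U. D U \<Longrightarrow> T (scl c U) = scl c (T U)"
begin

abbreviation G where "G \<mu> \<equiv> gen_eigenspace D T \<mu>"
abbreviation N where "N \<mu> \<equiv> shift_op T \<mu>"

lemma subspace_D: "fs.subspace {U. D U}"
  by (auto simp: fs.subspace_def D_zero D_add D_scl)

lemma D_span: "S \<subseteq> {U. D U} \<Longrightarrow> U \<in> fs.span S \<Longrightarrow> D U"
  using fs.span_minimal[OF _ subspace_D, of S] by auto

lemma D_diff: "D U \<Longrightarrow> D V \<Longrightarrow> D (U - V)"
  using fs.subspace_diff[OF subspace_D] by auto

lemma D_sum: "(\<And>i. i \<in> I \<Longrightarrow> D (f i)) \<Longrightarrow> D (\<Sum>i\<in>I. f i)"
  using fs.subspace_sum[OF subspace_D, of I f] by auto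

lemma T_diff: "D U \<Longrightarrow> D V \<Longrightarrow> T (U - V) = T U - T V"
  using T_add[of "U - V" V] D_diff[of U V] by (auto simp: algebra_simps)

lemma T_zero: "T 0 = 0"
  using T_scl[of 0 0] D_zero by simp

lemma T_sum: "(\<And>i. i \<in> I \<Longrightarrow> D (f i)) \<Longrightarrow> T (\<Sum>i\<in>I. f i) = (\<Sum>i\<in>I. T (f i))"
  by (induction I rule: infinite_finite_induct) (auto simp: T_zero T_add D_sum)

lemma N_zero: "N \<mu> 0 = 0"
  by (simp add: shift_op_eq T_zero)

lemma N_add: "D U \<Longrightarrow> D V \<Longrightarrow> N \<mu> (U + V) = N \<mu> U + N \<mu> V"
  by (simp add: shift_op_eq T_add fs.scale_right_distrib)

lemma N_diff: "D U \<Longrightarrow> D V \<Longrightarrow> N \<mu> (U - V) = N \<mu> U - N \<mu> V"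
  by (simp add: shift_op_eq T_diff fs.scale_right_diff_distrib)

lemma N_scl: "D U \<Longrightarrow> N \<mu> (scl c U) = scl c (N \<mu> U)"
  by (simp add: shift_op_eq T_scl fs.scale_right_diff_distrib mult.commute)

lemma N_iter_zero: "(N \<mu> ^^ m) 0 = 0"
  by (induction m) (auto simp: N_zero)

lemma N_iter_zero_mono:
  assumes "(N \<mu> ^^ m) U = 0" "m \<le> i"
  shows "(N \<mu> ^^ i) U = 0"
proof -
  have "(N \<mu> ^^ i) U = (N \<mu> ^^ (i - m)) ((N \<mu> ^^ m) U)"
    using assms(2) by (metis comp_apply funpow_add le_add_diff_inverse2)
  then show ?thesis using assms(1) N_iter_zero by simp
qed

lemma G_iff: "U \<in> G \<mu> \<longleftrightarrow> (\<forall>i. D ((N \<mu> ^^ i) U)) \<and> (\<exists>m. (N \<mu> ^^ m) U = 0)"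
proof
  assume "U \<in> G \<mu>"
  then obtain m where m: "\<forall>i\<le>m. D ((N \<mu> ^^ i) U)" "(N \<mu> ^^ m) U = 0"
    unfolding gen_eigenspace_def zero_fun_def by auto
  have "D ((N \<mu> ^^ i) U)" for i
    using m N_iter_zero_mono[OF m(2), of i] D_zero by (cases "i \<le> m") auto
  with m show "(\<forall>i. D ((N \<mu> ^^ i) U)) \<and> (\<exists>m. (N \<mu> ^^ m) U = 0)" by auto
qed (auto simp: gen_eigenspace_def zero_fun_def)

lemma G_D: "U \<in> G \<mu> \<Longrightarrow> D U"
  unfolding G_iff by (metis funpow_0)

lemma N_iter_add:
  assumes "\<forall>i. D ((N \<mu> ^^ i) U)" "\<forall>i. D ((N \<mu> ^^ i) V)"
  shows "(N \<mu> ^^ i) (U + V) = (N \<mu> ^^ i) U + (N \<mu> ^^ i) V"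
  by (induction i) (use assms in \<open>auto simp: N_add\<close>)

lemma N_iter_scl:
  assumes "\<forall>i. D ((N \<mu> ^^ i) U)"
  shows "(N \<mu> ^^ i) (scl c U) = scl c ((N \<mu> ^^ i) U)"
  by (induction i) (use assms in \<open>auto simp: N_scl\<close>)

lemma subspace_G: "fs.subspace (G \<mu>)"
  unfolding fs.subspace_def
proof (intro conjI ballI allI)
  show "0 \<in> G \<mu>" by (auto simp: G_iff N_iter_zero D_zero)
next
  fix U V assume UV: "U \<in> G \<mu>" "V \<in> G \<mu>"
  then obtain a b where ab: "(N \<mu> ^^ a) U = 0" "(N \<mu> ^^ b) V = 0" unfolding G_iff by auto
  have eq: "(N \<mu> ^^ i) (U + V) = (N \<mu> ^^ i) U + (N \<mu> ^^ i) V" for i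
    using UV by (intro N_iter_add) (auto simp: G_iff)
  show "U + V \<in> G \<mu>" unfolding G_iff eq
    using UV N_iter_zero_mono[OF ab(1), of "max a b"] N_iter_zero_mono[OF ab(2), of "max a b"]
    by (auto simp: G_iff intro!: D_add exI[of _ "max a b"])
next
  fix c U assume U: "U \<in> G \<mu>"
  have eq: "(N \<mu> ^^ i) (scl c U) = scl c ((N \<mu> ^^ i) U)" for i
    using U by (intro N_iter_scl) (auto simp: G_iff)
  show "scl c U \<in> G \<mu>" unfolding G_iff eq
    using U by (auto simp: G_iff intro!: D_scl)
qed

lemma G_N: "U \<in> G \<mu> \<Longrightarrow> N \<mu> U \<in> G \<mu>"
proof -
  assume U: "U \<in> G \<mu>"
  then obtain m where "(N \<mu> ^^ m) U = 0" by (auto simp: G_iff)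
  then have "(N \<mu> ^^ m) (N \<mu> U) = 0"
    using N_iter_zero_mono[of m \<mu> U "Suc m"] by (simp only: funpow_Suc_right o_apply le_Suc_eq) simp
  moreover have "D ((N \<mu> ^^ i) (N \<mu> U))" for i
    using U by (simp only: G_iff funpow_Suc_right[unfolded fun_eq_iff o_apply, rule_format, symmetric])
  ultimately show ?thesis by (auto simp: G_iff)
qed

lemma G_N_converse: "D U \<Longrightarrow> N \<mu> U \<in> G \<mu> \<Longrightarrow> U \<in> G \<mu>"
proof -
  assume U: "D U" "N \<mu> U \<in> G \<mu>"
  have "D ((N \<mu> ^^ i) U)" for i
    using U by (cases i) (auto simp: G_iff funpow_Suc_right simp del: funpow.simps)
  moreover from U obtain m where "(N \<mu> ^^ m) (N \<mu> U) = 0" by (auto simp: G_iff)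
  then have "(N \<mu> ^^ Suc m) U = 0" by (simp add: funpow_Suc_right del: funpow.simps)
  ultimately show ?thesis by (auto simp: G_iff simp del: funpow.simps)
qed

section \<open>Resolvent on generalized eigenspaces and their independence\<close>

lemma N_change: "N z U = N \<mu> U + scl (\<mu> - z) U"
  by (simp add: shift_op_eq fs.scale_left_diff_distrib)

lemma G_N_other: "U \<in> G \<mu> \<Longrightarrow> N z U \<in> G \<mu>"
  unfolding N_change[of z U \<mu>]
  by (intro fs.subspace_add[OF subspace_G] fs.subspace_scale[OF subspace_G] G_N)

lemma G_N_iter: "U \<in> G \<mu> \<Longrightarrow> (N z ^^ i) U \<in> G \<mu>"
  by (induction i) (auto intro: G_N_other)

text \<open>On a vector killed by \<open>N \<mu> ^^ m\<close> the Neumann series for the inverse of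
  \<open>z - T\<close> stops; this is that finite sum. Its coefficient at
  \<open>1 / (z - \<mu>)\<close> is \<open>w\<close> itself, which a contour integral picks
  out.\<close>

definition res :: "complex \<Rightarrow> nat \<Rightarrow> complex \<Rightarrow> 'n fseq \<Rightarrow> 'n fseq" where
  "res \<mu> m z w = (\<Sum>k<m. scl (1 / (z - \<mu>) ^ Suc k) ((N \<mu> ^^ k) w))"

lemma res_in_G: "w \<in> G \<mu> \<Longrightarrow> res \<mu> m z w \<in> G \<mu>"
  unfolding res_def
  by (intro fs.subspace_sum[OF subspace_G] fs.subspace_scale[OF subspace_G] G_N_iter)

text \<open>As \<open>N z = N \<mu> - (z - \<mu>)\<close>, the sum telescopes and only the top power
  remains. The minus sign in front of \<open>w\<close> reflects \<open>N z = T - z\<close> against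
  \<open>z - T\<close>.\<close>

lemma N_res:
  assumes "w \<in> G \<mu>" "z \<noteq> \<mu>"
  shows "N z (res \<mu> m z w) = scl (1 / (z - \<mu>) ^ m) ((N \<mu> ^^ m) w) - w"
proof (induction m)
  case 0
  then show ?case by (simp add: res_def N_zero)
next
  case (Suc m)
  have D: "D (res \<mu> m z w)" "D ((N \<mu> ^^ m) w)"
    using G_D[OF res_in_G[OF assms(1)]] G_D[OF G_N_iter[OF assms(1)]] by auto
  have "res \<mu> (Suc m) z w = res \<mu> m z w + scl (1 / (z - \<mu>) ^ Suc m) ((N \<mu> ^^ m) w)"
    by (simp add: res_def)
  then have "N z (res \<mu> (Suc m) z w) = scl (1 / (z - \<mu>) ^ m) ((N \<mu> ^^ m) w) - w
      + scl (1 / (z - \<mu>) ^ Suc m) ((N \<mu> ^^ Suc m) w + scl (\<mu> - z) ((N \<mu> ^^ m) w))"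
    using D by (simp only: N_add N_scl D_scl Suc N_change[of z "(N \<mu> ^^ m) w" \<mu>] funpow.simps o_apply)
  also have "scl (1 / (z - \<mu>) ^ Suc m) (scl (\<mu> - z) ((N \<mu> ^^ m) w))
     = - scl (1 / (z - \<mu>) ^ m) ((N \<mu> ^^ m) w)"
  proof -
    have "1 / (z - \<mu>) ^ Suc m * (\<mu> - z) = - (1 / (z - \<mu>) ^ m)"
      using assms(2) by (simp add: field_simps)
    then show ?thesis by (simp only: fs.scale_scale fs.scale_minus_left)
  qed
  ultimately show ?case
    by (simp only: fs.scale_right_distrib) simp
qed

lemma N_res_eq:
  assumes "w \<in> G \<mu>" "z \<noteq> \<mu>" "(N \<mu> ^^ m) w = 0"
  shows "N z (res \<mu> m z w) = - w"
  using N_res[OF assms(1,2), of m] assms(3) by simp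

lemma G_solve:
  assumes "w \<in> G \<mu>" "z \<noteq> \<mu>"
  shows "\<exists>y\<in>G \<mu>. N z y = w"
proof -
  obtain m where m: "(N \<mu> ^^ m) w = 0" using assms(1) by (auto simp: G_iff)
  have "N z (scl (-1) (res \<mu> m z w)) = w"
    using N_scl[OF G_D[OF res_in_G[OF assms(1)]], of z "-1" m z] N_res_eq[OF assms m]
    by simp
  then show ?thesis
    using fs.subspace_scale[OF subspace_G res_in_G[OF assms(1)]] by blast
qed

text \<open>Here \<open>N \<mu>\<close> acts on \<open>w\<close> as multiplication by the nonzero
  number \<open>z - \<mu>\<close>, which is incompatible with nilpotency unless
  \<open>w = 0\<close>.\<close>

lemma G_eigenvector_zero:
  assumes "w \<in> G \<mu>" "z \<noteq> \<mu>" "N z w = 0"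
  shows "w = 0"
proof -
  have N: "N \<mu> w = scl (z - \<mu>) w"
    using assms(3) N_change[of z w \<mu>] by (simp add: fs.scale_left_diff_distrib algebra_simps)
  have "(N \<mu> ^^ i) w = scl ((z - \<mu>) ^ i) w" for i
    by (induction i) (simp_all add: N N_scl G_D[OF assms(1)] mult.commute)
  moreover obtain m where "(N \<mu> ^^ m) w = 0" using assms(1) by (auto simp: G_iff)
  ultimately show ?thesis using assms(2) by simp
qed

lemma G_iter_zero:
  assumes "w \<in> G \<mu>" "z \<noteq> \<mu>" "(N z ^^ i) w = 0"
  shows "w = 0"
  using assms
proof (induction i)
  case (Suc i)
  then have "N z ((N z ^^ i) w) = 0" by simp
  then have "(N z ^^ i) w = 0"
    using G_eigenvector_zero[OF G_N_iter[OF Suc.prems(1)] Suc.prems(2)] by blast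
  with Suc show ?case by blast
qed simp

lemma N_sum: "(\<And>i. i \<in> I \<Longrightarrow> D (f i)) \<Longrightarrow> N z (\<Sum>i\<in>I. f i) = (\<Sum>i\<in>I. N z (f i))"
  by (simp add: shift_op_eq T_sum fs.scale_sum_right sum_subtractf)

lemma N_iter_sum:
  assumes "\<And>i k. i \<in> I \<Longrightarrow> D ((N z ^^ k) (f i))"
  shows "(N z ^^ k) (\<Sum>i\<in>I. f i) = (\<Sum>i\<in>I. (N z ^^ k) (f i))"
  by (induction k) (simp_all add: N_sum assms)

text \<open>A power of \<open>N \<nu>\<close> kills the component at \<open>\<nu>\<close> and keeps
  every other component in its own space. By induction the images vanish, and \<open>N \<nu>\<close>
  is injective on the other generalized eigenspaces.\<close>

lemma G_direct_sum:
  assumes "finite \<Lambda>" "\<And>\<mu>. \<mu> \<in> \<Lambda> \<Longrightarrow> w \<mu> \<in> G \<mu>" "(\<Sum>\<mu>\<in>\<Lambda>. w \<mu>) = 0" "\<mu> \<in> \<Lambda>"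
  shows "w \<mu> = 0"
  using assms
proof (induction \<Lambda> arbitrary: w \<mu> rule: finite_induct)
  case (insert \<nu> \<Lambda>)
  obtain m where m: "(N \<nu> ^^ m) (w \<nu>) = 0"
    using insert.prems(1)[of \<nu>] by (auto simp: G_iff)
  have "(N \<nu> ^^ m) (\<Sum>\<mu>\<in>insert \<nu> \<Lambda>. w \<mu>) = (\<Sum>\<mu>\<in>insert \<nu> \<Lambda>. (N \<nu> ^^ m) (w \<mu>))"
    by (rule N_iter_sum) (rule G_D[OF G_N_iter[OF insert.prems(1)]])
  then have s: "(\<Sum>\<mu>\<in>\<Lambda>. (N \<nu> ^^ m) (w \<mu>)) = 0"
    using insert.hyps insert.prems(2) m by (simp add: N_iter_zero)
  have z: "w \<mu> = 0" if "\<mu> \<in> \<Lambda>" for \<mu>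
  proof (rule G_iter_zero)
    show "w \<mu> \<in> G \<mu>" using insert.prems(1) that by simp
    show "\<nu> \<noteq> \<mu>" using insert.hyps that by auto
    show "(N \<nu> ^^ m) (w \<mu>) = 0"
      by (rule insert.IH[OF _ s that]) (rule G_N_iter[OF insert.prems(1)], simp)
  qed
  then have "w \<nu> = 0" using insert.prems(2) insert.hyps by simp
  with z insert.prems(3) show ?case by auto
qed simp

section \<open>Algebraic multiplicities as dimensions\<close>

lemma is_eigenvalue_iff: "is_eigenvalue D T \<mu> \<longleftrightarrow> (\<exists>U. D U \<and> U \<noteq> 0 \<and> N \<mu> U = 0)"
  by (auto simp: is_eigenvalue_def shift_op_def zero_fun_def fun_eq_iff)

lemma G_nonzero_eigenvalue:
  assumes "w \<in> G \<mu>" "w \<noteq> 0"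
  shows "is_eigenvalue D T \<mu>"
proof -
  obtain m where m: "(N \<mu> ^^ m) w = 0" using assms(1) by (auto simp: G_iff)
  define k where "k = (LEAST m. (N \<mu> ^^ m) w = 0)"
  have k: "(N \<mu> ^^ k) w = 0" unfolding k_def using m by (rule LeastI)
  with assms(2) obtain l where l: "k = Suc l" by (cases k) auto
  have "(N \<mu> ^^ l) w \<noteq> 0" using not_less_Least[of l "\<lambda>m. (N \<mu> ^^ m) w = 0"] l k_def by auto
  moreover have "N \<mu> ((N \<mu> ^^ l) w) = 0" using k l by simp
  moreover have "D ((N \<mu> ^^ l) w)" using assms(1) by (auto simp: G_iff)
  ultimately show ?thesis unfolding is_eigenvalue_iff by blast
qed

lemma eigenvector_in_G: "D U \<Longrightarrow> N \<mu> U = 0 \<Longrightarrow> U \<in> G \<mu>"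
  using G_N_converse fs.subspace_0[OF subspace_G] by auto

text \<open>\<open>alg_mult\<close> is a supremum in \<open>enat\<close>. A finite spanning set
  bounds the size of independent sets, so a maximal independent subset attains it.\<close>

lemma alg_mult_eq_card:
  assumes "finite F" "G \<mu> \<subseteq> fs.span F"
  shows "\<exists>B\<subseteq>G \<mu>. finite B \<and> fs.independent B \<and> G \<mu> \<subseteq> fs.span B \<and> alg_mult D T \<mu> = enat (card B)"
proof -
  obtain B where B: "B \<subseteq> G \<mu>" "fs.independent B" "G \<mu> \<subseteq> fs.span B"
    using fs.maximal_independent_subset[of "G \<mu>"] by blast
  have fin: "finite B"
    using fs.independent_span_bound[OF assms(1) B(2)] B assms by blast
  have "alg_mult D T \<mu> = enat (card B)"
    unfolding alg_mult_def
  proof (rule antisym)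
    show "Sup {enat (card S) |S. finite S \<and> S \<subseteq> G \<mu> \<and> lin_indep_seq S} \<le> enat (card B)"
    proof (rule Sup_least, clarify)
      fix S assume S: "finite S" "S \<subseteq> G \<mu>" "lin_indep_seq S"
      then have "card S \<le> card B"
        using fs.independent_span_bound[OF fin, of S] B(3) lin_indep_seq_iff_independent[OF S(1)] by auto
      then show "enat (card S) \<le> enat (card B)" by simp
    qed
    show "enat (card B) \<le> Sup {enat (card S) |S. finite S \<and> S \<subseteq> G \<mu> \<and> lin_indep_seq S}"
      using B fin lin_indep_seq_iff_independent[OF fin] by (intro Sup_upper) auto
  qed
  with B fin show ?thesis by blast
qed

text \<open>Bases of different generalized eigenspaces are disjoint and jointly independent, so a
  sum of multiplicities becomes the size of one independent set and can be compared by linear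
  algebra alone.\<close>

lemma sum_alg_mult_eq_card:
  assumes "finite F" "finite \<Lambda>" "\<And>\<mu>. \<mu> \<in> \<Lambda> \<Longrightarrow> G \<mu> \<subseteq> fs.span F"
  shows "\<exists>B. finite B \<and> fs.independent B \<and> B \<subseteq> (\<Union>\<mu>\<in>\<Lambda>. G \<mu>) \<and> (\<Union>\<mu>\<in>\<Lambda>. G \<mu>) \<subseteq> fs.span B
     \<and> (\<Sum>\<mu>\<in>\<Lambda>. alg_mult D T \<mu>) = enat (card B)"
proof -
  have "\<forall>\<mu>\<in>\<Lambda>. \<exists>B\<subseteq>G \<mu>. finite B \<and> fs.independent B \<and> G \<mu> \<subseteq> fs.span B \<and> alg_mult D T \<mu> = enat (card B)"
    using alg_mult_eq_card[OF assms(1)] assms(3) by blast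
  then obtain B where B: "\<And>\<mu>. \<mu> \<in> \<Lambda> \<Longrightarrow> B \<mu> \<subseteq> G \<mu> \<and> finite (B \<mu>) \<and> fs.independent (B \<mu>)
     \<and> G \<mu> \<subseteq> fs.span (B \<mu>) \<and> alg_mult D T \<mu> = enat (card (B \<mu>))"
    by metis
  have disj: "B \<mu> \<inter> B \<nu> = {}" if "\<mu> \<in> \<Lambda>" "\<nu> \<in> \<Lambda>" "\<mu> \<noteq> \<nu>" for \<mu> \<nu>
  proof (rule ccontr)
    assume "B \<mu> \<inter> B \<nu> \<noteq> {}"
    then obtain w where w: "w \<in> B \<mu>" "w \<in> B \<nu>" by auto
    have "w \<in> G \<mu>" "w \<in> G \<nu>" using w B that by auto
    then obtain i where "(N \<nu> ^^ i) w = 0" by (auto simp: G_iff)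
    then have "w = 0" using G_iter_zero[OF \<open>w \<in> G \<mu>\<close>, of \<nu>] that by auto
    with w B[OF that(1)] fs.dependent_zero show False by blast
  qed
  let ?B = "\<Union>\<mu>\<in>\<Lambda>. B \<mu>"
  have fin: "finite ?B" using B assms(2) by auto
  have sumB: "(\<Sum>v\<in>?B. f v) = (\<Sum>\<mu>\<in>\<Lambda>. \<Sum>v\<in>B \<mu>. f v)" for f :: "_ \<Rightarrow> 'n fseq"
    using B disj assms(2) by (intro sum.UNION_disjoint) auto
  have "fs.independent ?B"
    unfolding fs.dependent_finite[OF fin]
  proof (clarify)
    fix u \<mu> v assume u: "(\<Sum>v\<in>?B. scl (u v) v) = 0" and \<mu>: "\<mu> \<in> \<Lambda>" "v \<in> B \<mu>" "u v \<noteq> 0"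
    have "(\<Sum>v\<in>B \<mu>. scl (u v) v) = 0"
    proof (rule G_direct_sum[OF assms(2) _ _ \<mu>(1), of "\<lambda>\<mu>. \<Sum>v\<in>B \<mu>. scl (u v) v"])
      show "(\<Sum>v\<in>B \<mu>. scl (u v) v) \<in> G \<mu>" if "\<mu> \<in> \<Lambda>" for \<mu>
        using B[OF that] by (intro fs.subspace_sum[OF subspace_G] fs.subspace_scale[OF subspace_G]) auto
    qed (use u sumB in simp)
    then show False using B[OF \<mu>(1)] \<mu> fs.dependent_finite[of "B \<mu>"] by blast
  qed
  moreover have "card ?B = (\<Sum>\<mu>\<in>\<Lambda>. card (B \<mu>))"
    using B disj assms(2) by (intro card_UN_disjoint) auto
  moreover have "(\<Sum>\<mu>\<in>\<Lambda>. alg_mult D T \<mu>) = (\<Sum>\<mu>\<in>\<Lambda>. enat (card (B \<mu>)))"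
    using B by (intro sum.cong) auto
  moreover have "(\<Sum>\<mu>\<in>\<Lambda>. enat (card (B \<mu>))) = enat (\<Sum>\<mu>\<in>\<Lambda>. card (B \<mu>))"
    by (induction \<Lambda> rule: infinite_finite_induct) (auto simp: zero_enat_def)
  moreover have "?B \<subseteq> (\<Union>\<mu>\<in>\<Lambda>. G \<mu>)" using B by blast
  moreover have "G \<mu> \<subseteq> fs.span ?B" if "\<mu> \<in> \<Lambda>" for \<mu>
    using B[OF that] fs.span_mono[of "B \<mu>" ?B] that by blast
  ultimately show ?thesis using fin by (intro exI[of _ ?B]) auto
qed

lemma finite_eigenvalues:
  assumes "finite F" "\<And>\<mu>. \<mu> \<in> S \<Longrightarrow> G \<mu> \<subseteq> fs.span F"
  shows "finite {\<mu>\<in>S. is_eigenvalue D T \<mu>}"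
proof (rule finite_if_finite_subsets_card_bdd[THEN conjunct1])
  fix \<Lambda> assume \<Lambda>: "\<Lambda> \<subseteq> {\<mu>\<in>S. is_eigenvalue D T \<mu>}" "finite \<Lambda>"
  then have "\<forall>\<mu>\<in>\<Lambda>. \<exists>U. D U \<and> U \<noteq> 0 \<and> N \<mu> U = 0" by (auto simp: is_eigenvalue_iff)
  then obtain U where U: "\<And>\<mu>. \<mu> \<in> \<Lambda> \<Longrightarrow> U \<mu> \<in> G \<mu> \<and> U \<mu> \<noteq> 0"
    by (metis eigenvector_in_G)
  show "card \<Lambda> \<le> card F"
  proof (rule ccontr)
    assume "\<not> card \<Lambda> \<le> card F"
    then obtain c where c: "\<exists>i\<in>\<Lambda>. c i \<noteq> 0" "(\<Sum>i\<in>\<Lambda>. scl (c i) (U i)) = 0"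
      using family_dependent[OF assms(1) \<Lambda>(2), of U] assms(2) \<Lambda> U by fastforce
    then obtain i where i: "i \<in> \<Lambda>" "c i \<noteq> 0" by auto
    have "scl (c i) (U i) = 0"
      using G_direct_sum[OF \<Lambda>(2) _ c(2) i(1)] U fs.subspace_scale[OF subspace_G] by blast
    with i U show False by auto
  qed
qed

text \<open>For \<open>\<nu> \<noteq> a\<close> the space \<open>G \<nu>\<close> is contained in its
  own image under \<open>N a\<close>. So any \<open>v\<close> in the span is
  \<open>x + N a y\<close> with \<open>x\<close> in \<open>G a\<close>; applied to
  \<open>N a u\<close>, this puts \<open>u - y\<close> into \<open>G a\<close>.\<close>

lemma span_G_step:
  assumes "D u" "N a u \<in> fs.span (\<Union>\<mu>. G \<mu>)"
  shows "u \<in> fs.span (\<Union>\<mu>. G \<mu>)"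
proof -
  let ?S = "fs.span (\<Union>\<mu>. G \<mu>)"
  have DS: "D y" if "y \<in> ?S" for y
    by (rule D_span[OF _ that]) (auto dest: G_D)
  have "\<exists>x\<in>G a. \<exists>y\<in>?S. v = x + N a y" if "v \<in> ?S" for v
    using that
  proof (induction v rule: fs.span_induct_alt)
    case base
    show ?case
      using fs.subspace_0[OF subspace_G] fs.span_zero
      by (intro bexI[of _ 0]) (auto simp: N_zero)
  next
    case (step c v w)
    then obtain x y where xy: "x \<in> G a" "y \<in> ?S" "w = x + N a y" by blast
    from step obtain \<nu> where \<nu>: "v \<in> G \<nu>" by blast
    have "\<exists>x'\<in>G a. \<exists>y'\<in>?S. v = x' + N a y'"
    proof (cases "\<nu> = a")
      case True
      then show ?thesis using \<nu> fs.span_zero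
        by (intro bexI[of _ v] bexI[of _ 0]) (auto simp: N_zero)
    next
      case False
      then obtain y' where "y' \<in> G \<nu>" "N a y' = v" using G_solve[OF \<nu>, of a] by auto
      then show ?thesis using fs.subspace_0[OF subspace_G] fs.span_base[of y' "\<Union>\<mu>. G \<mu>"]
        by (intro bexI[of _ 0] bexI[of _ y']) auto
    qed
    then obtain x' y' where xy': "x' \<in> G a" "y' \<in> ?S" "v = x' + N a y'" by blast
    have "scl c v + w = (scl c x' + x) + N a (scl c y' + y)"
      using xy xy' DS by (simp add: N_add N_scl D_scl fs.scale_right_distrib)
    moreover have "scl c x' + x \<in> G a"
      by (intro fs.subspace_add[OF subspace_G] fs.subspace_scale[OF subspace_G] xy xy')
    moreover have "scl c y' + y \<in> ?S" by (intro fs.span_add fs.span_scale xy xy')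
    ultimately show ?case by (intro bexI[of _ "scl c x' + x"] bexI[of _ "scl c y' + y"])
  qed
  from this[OF assms(2)] obtain x y where xy: "x \<in> G a" "y \<in> ?S" "N a u = x + N a y" by blast
  then have "N a (u - y) = x" using N_diff[OF assms(1) DS[OF xy(2)]] by simp
  then have "u - y \<in> G a" using G_N_converse[OF D_diff[OF assms(1) DS[OF xy(2)]]] xy(1) by simp
  then have "u - y \<in> ?S" by (intro fs.span_base) auto
  from fs.span_add[OF this xy(2)] show ?thesis by simp
qed

text \<open>A root \<open>a\<close> of the annihilating polynomial is split off: the quotient
  annihilates \<open>N a u\<close>, and \<open>span_G_step\<close> returns from \<open>N a u\<close>
  to \<open>u\<close>. The bound \<open>n\<close> on the degree fixes the summation range throughout
  the induction.\<close>

lemma span_G_polynomial: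
  assumes TD: "\<And>U. D U \<Longrightarrow> D (T U)"
  shows "p \<noteq> 0 \<Longrightarrow> degree p \<le> n \<Longrightarrow> D u \<Longrightarrow> (\<Sum>i\<le>n. scl (coeff p i) ((T ^^ i) u)) = 0
    \<Longrightarrow> u \<in> fs.span (\<Union>\<mu>. G \<mu>)"
proof (induction "degree p" arbitrary: p u)
  case 0
  then obtain c where c: "p = [:c:]" "c \<noteq> 0" by (metis degree_eq_zeroE pCons_0_0)
  have "(\<Sum>i\<le>n. scl (coeff p i) ((T ^^ i) u)) = (\<Sum>i\<in>{0}. scl (coeff p i) ((T ^^ i) u))"
    by (rule sum.mono_neutral_right) (auto simp: c coeff_pCons split: nat.splits)
  with 0 c have "u = 0" by simp
  then show ?case by (simp add: fs.span_zero)
next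
  case (Suc d)
  have "\<not> constant (poly p)" using Suc.hyps(2) constant_degree[of p] by simp
  then obtain a where "poly p a = 0" using fundamental_theorem_of_algebra by blast
  then obtain q where q: "p = [:-a, 1:] * q" using poly_eq_0_iff_dvd by (metis dvdE)
  have q0: "q \<noteq> 0" using q Suc by auto
  have "degree p = degree [:-a, 1:] + degree q"
    unfolding q using q0 by (intro degree_mult_eq) auto
  then have dq: "degree q = d" "degree q < n" using Suc by auto
  obtain n' where n': "n = Suc n'" using dq by (cases n) auto
  have DT: "D ((T ^^ i) u)" for i by (induction i) (auto simp: TD Suc.prems)
  have TN: "(T ^^ i) (N a u) = (T ^^ Suc i) u - scl a ((T ^^ i) u)" for i
  proof (induction i)
    case (Suc i)
    have "T ((T ^^ Suc i) u - scl a ((T ^^ i) u)) = T ((T ^^ Suc i) u) - scl a (T ((T ^^ i) u))"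
      by (subst T_diff) (simp_all add: D_scl T_scl DT TD)
    then show ?case using Suc by simp
  qed (simp add: shift_op_eq)
  have "(\<Sum>i\<le>n. scl (coeff q i) ((T ^^ i) (N a u)))
      = (\<Sum>i\<le>n. scl (coeff q i) ((T ^^ Suc i) u)) - (\<Sum>i\<le>n. scl (a * coeff q i) ((T ^^ i) u))"
    unfolding TN fs.scale_right_diff_distrib sum_subtractf by (simp add: mult.commute)
  also have "(\<Sum>i\<le>n. scl (coeff q i) ((T ^^ Suc i) u)) = (\<Sum>i\<le>n'. scl (coeff q i) ((T ^^ Suc i) u))"
    using coeff_eq_0[OF dq(2)] by (simp add: n')
  also have "\<dots> = (\<Sum>i\<le>n. scl (coeff (pCons 0 q) i) ((T ^^ i) u))"
    unfolding n' sum.atMost_Suc_shift[of _ n'] by simp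
  also have "\<dots> - (\<Sum>i\<le>n. scl (a * coeff q i) ((T ^^ i) u)) = (\<Sum>i\<le>n. scl (coeff p i) ((T ^^ i) u))"
  proof -
    have "coeff p i = coeff (pCons 0 q) i - a * coeff q i" for i
      unfolding q by (simp add: coeff_pCons split: nat.splits)
    then show ?thesis by (simp only: sum_subtractf[symmetric] fs.scale_left_diff_distrib)
  qed
  finally have "(\<Sum>i\<le>n. scl (coeff q i) ((T ^^ i) (N a u))) = 0" using Suc.prems by simp
  moreover have "D (N a u)" using Suc.prems by (simp add: shift_op_eq D_diff D_scl TD)
  ultimately have "N a u \<in> fs.span (\<Union>\<mu>. G \<mu>)"
    using Suc.hyps(1)[of q "N a u"] q0 dq by simp
  then show ?case by (rule span_G_step[OF Suc.prems(3)])
qed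

text \<open>The primary decomposition over the complex numbers: the \<open>card F + 1\<close> Krylov
  vectors of \<open>u\<close> are dependent, and the coefficients of a relation form an annihilating
  polynomial.\<close>

lemma D_subset_span_G:
  assumes TD: "\<And>U. D U \<Longrightarrow> D (T U)" and F: "finite F" "{U. D U} \<subseteq> fs.span F" and u: "D u"
  shows "u \<in> fs.span (\<Union>\<mu>. G \<mu>)"
proof -
  have DT: "D ((T ^^ i) u)" for i by (induction i) (auto simp: TD u)
  obtain c where c: "\<exists>i\<le>card F. c i \<noteq> 0" "(\<Sum>i\<le>card F. scl (c i) ((T ^^ i) u)) = 0"
    using family_dependent[OF F(1), of "{..card F}" "\<lambda>i. (T ^^ i) u"] F(2) DT by auto
  define p where "p = Abs_poly (\<lambda>i. if i \<le> card F then c i else 0)"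
  have cp: "coeff p = (\<lambda>i. if i \<le> card F then c i else 0)"
    unfolding p_def by (rule coeff_Abs_poly[of "card F"]) auto
  show ?thesis
  proof (rule span_G_polynomial[OF TD])
    show "p \<noteq> 0" using c(1) cp by (metis coeff_0)
    show "degree p \<le> card F" by (rule degree_le) (simp add: cp)
    show "(\<Sum>i\<le>card F. scl (coeff p i) ((T ^^ i) u)) = 0" using c(2) by (simp add: cp)
  qed (use u in auto)
qed

end

section \<open>Square-summable sequences\<close>

no_notation fps_nth (infixl "$" 75)

text \<open>Values in any normed space are allowed, so one theory serves vector sequences,
  matrix-valued Fourier coefficients and scalar majorants.\<close>

definition sqs :: "(int \<Rightarrow> 'a::real_normed_vector) \<Rightarrow> bool" where
  "sqs U \<longleftrightarrow> (\<lambda>k. (norm (U k))\<^sup>2) summable_on UNIV"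

definition l2n :: "(int \<Rightarrow> 'a::real_normed_vector) \<Rightarrow> real" where
  "l2n U = sqrt (\<Sum>\<^sub>\<infinity>k. (norm (U k))\<^sup>2)"

abbreviation L2F :: "(int \<Rightarrow> 'a::real_normed_vector) \<Rightarrow> int set \<Rightarrow> real" where
  "L2F U F \<equiv> L2_set (\<lambda>k. norm (U k)) F"

lemma l2seq_eq_sqs: "l2seq = sqs"
  by (auto simp: l2seq_def sqs_def fun_eq_iff)

text \<open>Reduces infinite sums to finite \<open>L2_set\<close> norms, where the triangle and
  Cauchy-Schwarz inequalities apply directly.\<close>

lemma sqs_bound:
  assumes "0 \<le> B" "\<And>F. finite F \<Longrightarrow> L2F U F \<le> B"
  shows "sqs U" "l2n U \<le> B"
proof -
  have le: "(\<Sum>k\<in>F. (norm (U k))\<^sup>2) \<le> B\<^sup>2" if "finite F" for F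
    using assms(2)[OF that] assms(1) by (simp add: L2_set_def sqrt_le_D)
  show s: "sqs U" unfolding sqs_def
    by (rule nonneg_bdd_above_summable_on) (auto intro!: bdd_aboveI2 le)
  have "(\<Sum>\<^sub>\<infinity>k. (norm (U k))\<^sup>2) \<le> B\<^sup>2"
    using s unfolding sqs_def by (rule infsum_le_finite_sums) (auto intro: le)
  then show "l2n U \<le> B" unfolding l2n_def
    using assms(1) by (simp add: real_le_lsqrt infsum_nonneg)
qed

lemma L2F_le_l2n:
  assumes "sqs U" "finite F"
  shows "L2F U F \<le> l2n U"
  unfolding l2n_def L2_set_def
  using assms unfolding sqs_def by (intro real_sqrt_le_mono finite_sum_le_infsum) auto

lemma l2n_nonneg [simp]: "0 \<le> l2n U"
  by (simp add: l2n_def infsum_nonneg)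

lemma l2n_power2: "(l2n U)\<^sup>2 = (\<Sum>\<^sub>\<infinity>k. (norm (U k))\<^sup>2)"
  by (simp add: l2n_def infsum_nonneg)

lemma norm_le_l2n: "sqs U \<Longrightarrow> norm (U k) \<le> l2n U"
  using L2F_le_l2n[of U "{k}"] by simp

lemma l2n_eq_0:
  assumes "sqs U" "l2n U = 0"
  shows "U = 0"
proof
  show "U k = 0 k" for k using norm_le_l2n[OF assms(1), of k] assms(2) by (simp add: zero_fun_apply)
qed

lemma sqs_mono:
  assumes "sqs U" "\<And>k. norm (V k) \<le> norm (U k)"
  shows "sqs V" "l2n V \<le> l2n U"
proof -
  have "L2F V F \<le> l2n U" if "finite F" for F
    using L2F_le_l2n[OF assms(1) that] L2_set_mono[of F "\<lambda>k. norm (V k)" "\<lambda>k. norm (U k)"] assms(2)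
    by fastforce
  then show "sqs V" "l2n V \<le> l2n U" using sqs_bound[of "l2n U" V] by auto
qed

lemma sqs_add_bound:
  assumes "sqs U" "sqs V" "\<And>k. norm (W k) \<le> norm (U k) + norm (V k)"
  shows "sqs W" "l2n W \<le> l2n U + l2n V"
proof -
  have "L2F W F \<le> l2n U + l2n V" if "finite F" for F
  proof -
    have "L2F W F \<le> L2_set (\<lambda>k. norm (U k) + norm (V k)) F"
      by (rule L2_set_mono) (auto simp: assms(3))
    also have "\<dots> \<le> L2F U F + L2F V F" by (rule L2_set_triangle_ineq)
    finally show ?thesis using L2F_le_l2n[OF assms(1) that] L2F_le_l2n[OF assms(2) that] by linarith
  qed
  then show "sqs W" "l2n W \<le> l2n U + l2n V" using sqs_bound[of "l2n U + l2n V" W] by auto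
qed

lemma sqs_add: "sqs U \<Longrightarrow> sqs V \<Longrightarrow> sqs (U + V)"
  by (rule sqs_add_bound(1)[of U V]) (auto simp: fseq_apply norm_triangle_ineq)

lemma sqs_diff: "sqs U \<Longrightarrow> sqs V \<Longrightarrow> sqs (U - V)"
  by (rule sqs_add_bound(1)[of U V]) (auto simp: fseq_apply norm_triangle_ineq4)

lemma l2n_add: "sqs U \<Longrightarrow> sqs V \<Longrightarrow> l2n (U + V) \<le> l2n U + l2n V"
  by (rule sqs_add_bound(2)) (auto simp: fseq_apply norm_triangle_ineq)

lemma l2n_diff: "sqs U \<Longrightarrow> sqs V \<Longrightarrow> l2n (U - V) \<le> l2n U + l2n V"
  by (rule sqs_add_bound(2)) (auto simp: fseq_apply norm_triangle_ineq4)

lemma l2n_diff_triangle: "sqs U \<Longrightarrow> sqs V \<Longrightarrow> sqs W \<Longrightarrow> l2n (U - W) \<le> l2n (U - V) + l2n (V - W)"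
  using l2n_add[of "U - V" "V - W"] sqs_diff by auto

lemma l2n_commute: "l2n (U - V) = l2n (V - U)"
  by (simp add: l2n_def fseq_apply norm_minus_commute)

lemma l2n_le_diff: "sqs U \<Longrightarrow> sqs V \<Longrightarrow> l2n U \<le> l2n V + l2n (U - V)"
  using l2n_add[of V "U - V"] sqs_diff by auto

lemma sqs_vec:
  fixes U :: "int \<Rightarrow> 'a::real_normed_vector ^ 'm::finite"
  assumes "\<And>a. sqs (\<lambda>k. U k $ a)"
  shows "sqs U" "l2n U \<le> (\<Sum>a\<in>UNIV. l2n (\<lambda>k. U k $ a))"
proof -
  have "L2F U F \<le> (\<Sum>a\<in>UNIV. l2n (\<lambda>k. U k $ a))" if "finite F" for F
  proof -
    have "L2F U F \<le> L2_set (\<lambda>k. \<Sum>a\<in>UNIV. norm (U k $ a)) F"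
      by (rule L2_set_mono) (auto simp: norm_vec_def intro!: L2_set_le_sum)
    also have "\<dots> \<le> (\<Sum>a\<in>UNIV. L2F (\<lambda>k. U k $ a) F)"
    proof -
      have "L2_set (\<lambda>k. \<Sum>a\<in>I. norm (U k $ a)) F \<le> (\<Sum>a\<in>I. L2F (\<lambda>k. U k $ a) F)" for I
      proof (induction I rule: infinite_finite_induct)
        case (insert x I)
        then show ?case
          using L2_set_triangle_ineq[of "\<lambda>k. norm (U k $ x)" "\<lambda>k. \<Sum>a\<in>I. norm (U k $ a)" F] by simp
      qed (simp_all add: L2_set_def)
      then show ?thesis .
    qed
    also have "\<dots> \<le> (\<Sum>a\<in>UNIV. l2n (\<lambda>k. U k $ a))"
      by (intro sum_mono L2F_le_l2n assms that)
    finally show ?thesis .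
  qed
  moreover have "0 \<le> (\<Sum>a\<in>UNIV. l2n (\<lambda>k. U k $ a))" by (intro sum_nonneg) simp
  ultimately show "sqs U" "l2n U \<le> (\<Sum>a\<in>UNIV. l2n (\<lambda>k. U k $ a))" using sqs_bound[of _ U] by auto
qed

lemma norm_cmult_vec: "norm (c *s x) = norm c * norm (x :: complex^'n)"
  by (simp add: norm_vec_def L2_set_def norm_mult power_mult_distrib sum_distrib_left[symmetric] real_sqrt_mult)

lemma sqs_scl: "sqs U \<Longrightarrow> sqs (scl c U)"
  unfolding sqs_def by (simp add: fseq_apply norm_cmult_vec power_mult_distrib summable_on_cmult_right)

lemma l2n_scl: "l2n (scl c U) = norm c * l2n U"
  by (simp add: l2n_def fseq_apply norm_cmult_vec power_mult_distrib infsum_cmult_right' real_sqrt_mult)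

lemma sqs_zero: "sqs 0"
  by (simp add: sqs_def fseq_apply)

lemma l2n_zero: "l2n 0 = 0"
  by (simp add: l2n_def fseq_apply)

lemma sqs_sum: "(\<And>i. i \<in> I \<Longrightarrow> sqs (f i)) \<Longrightarrow> sqs (\<Sum>i\<in>I. f i)"
  by (induction I rule: infinite_finite_induct) (auto intro: sqs_zero sqs_add)

text \<open>Lower semicontinuity of the norm: each finite partial norm passes to the limit. This is
  what places frequencywise limits back in \<open>l2\<close>.\<close>

lemma sqs_fatou:
  assumes "\<And>k. (\<lambda>s. Us s k) \<longlonglongrightarrow> U k" "\<forall>\<^sub>F s in sequentially. sqs (Us s) \<and> l2n (Us s) \<le> B"
  shows "sqs U" "l2n U \<le> B"
proof -
  obtain s0 where "sqs (Us s0)" "l2n (Us s0) \<le> B"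
    using assms(2) eventually_happens'[OF sequentially_bot] by blast
  then have B: "0 \<le> B" using l2n_nonneg[of "Us s0"] by linarith
  have "L2F U F \<le> B" if "finite F" for F
  proof (rule tendsto_upperbound)
    show "(\<lambda>s. L2F (Us s) F) \<longlonglongrightarrow> L2F U F"
      unfolding L2_set_def by (intro tendsto_intros assms)
    show "\<forall>\<^sub>F s in sequentially. L2F (Us s) F \<le> B"
      using assms(2) by eventually_elim (use L2F_le_l2n that in \<open>force intro: order_trans\<close>)
  qed simp
  then show "sqs U" "l2n U \<le> B" using sqs_bound[OF B] by auto
qed

lemma sqs_tail:
  assumes "sqs U" "0 < e"
  shows "\<exists>F. finite F \<and> (\<forall>F'. finite F' \<longrightarrow> F' \<inter> F = {} \<longrightarrow> L2F U F' \<le> e)"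
proof -
  let ?f = "\<lambda>k. (norm (U k))\<^sup>2"
  have sm: "?f summable_on UNIV" using assms(1) by (simp add: sqs_def)
  have "(sum ?f \<longlongrightarrow> infsum ?f UNIV) (finite_subsets_at_top UNIV)"
    using has_sum_infsum[OF sm] by (simp add: has_sum_def)
  then have "\<forall>\<^sub>F F in finite_subsets_at_top UNIV. dist (sum ?f F) (infsum ?f UNIV) < e\<^sup>2"
    using assms(2) by (simp add: tendsto_iff)
  then obtain F where F: "finite F" "dist (sum ?f F) (infsum ?f UNIV) < e\<^sup>2"
    unfolding eventually_finite_subsets_at_top by blast
  have "L2F U F' \<le> e" if F': "finite F'" "F' \<inter> F = {}" for F'
  proof -
    have "sum ?f F + sum ?f F' = sum ?f (F \<union> F')"
      using F F' by (intro sum.union_disjoint[symmetric]) auto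
    also have "\<dots> \<le> infsum ?f UNIV"
      using F F' sm by (intro finite_sum_le_infsum) auto
    finally have "sum ?f F' \<le> e\<^sup>2" using F(2) by (simp add: dist_real_def)
    then show ?thesis unfolding L2_set_def using assms(2) by (simp add: real_le_lsqrt sum_nonneg)
  qed
  with F show ?thesis by blast
qed

lemma l2n_split:
  assumes "0 \<le> e" "finite F" "\<And>F'. finite F' \<Longrightarrow> F' \<inter> F = {} \<Longrightarrow> L2F U F' \<le> e"
  shows "sqs U" "l2n U \<le> L2F U F + e"
proof -
  have "L2F U G \<le> L2F U F + e" if "finite G" for G
  proof -
    have "(\<Sum>k\<in>G. (norm (U k))\<^sup>2) = (\<Sum>k\<in>G \<inter> F. (norm (U k))\<^sup>2) + (\<Sum>k\<in>G - F. (norm (U k))\<^sup>2)"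
      using sum.Int_Diff[OF that, of _ F] by (simp add: add.commute)
    also have "\<dots> \<le> (\<Sum>k\<in>F. (norm (U k))\<^sup>2) + (\<Sum>k\<in>G - F. (norm (U k))\<^sup>2)"
      using assms(2) by (intro add_right_mono sum_mono2) auto
    finally have "L2F U G \<le> sqrt ((\<Sum>k\<in>F. (norm (U k))\<^sup>2) + (\<Sum>k\<in>G - F. (norm (U k))\<^sup>2))"
      unfolding L2_set_def by (rule real_sqrt_le_mono)
    also have "\<dots> \<le> L2F U F + L2F U (G - F)"
      unfolding L2_set_def by (intro sqrt_add_le_add_sqrt sum_nonneg) auto
    finally show ?thesis using assms(3)[of "G - F"] that by (auto simp: Int_Diff Diff_Int_distrib2)
  qed
  then show "sqs U" "l2n U \<le> L2F U F + e"
    using sqs_bound[of "L2F U F + e" U] assms(1) L2_set_nonneg[of "\<lambda>k. norm (U k)" F] by auto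
qed

text \<open>The tail of the majorant controls all tails at once, so only finitely many frequencies
  remain, and there pointwise convergence suffices.\<close>

lemma l2n_dominated:
  assumes "\<And>k. (\<lambda>s. Us s k) \<longlonglongrightarrow> U k" "sqs g" "\<And>s k. norm (Us s k) \<le> norm (g k)"
  shows "(\<lambda>s. l2n (Us s - U)) \<longlonglongrightarrow> 0"
proof (rule LIMSEQ_I)
  fix e :: real assume e: "0 < e"
  have U: "norm (U k) \<le> norm (g k)" for k
    by (rule tendsto_upperbound[OF tendsto_norm[OF assms(1)]]) (auto simp: assms(3))
  \<comment> \<open>Both \<open>Us s\<close> and \<open>U\<close> are dominated by \<open>g\<close>,
    so the tail of their difference is at most twice \<open>e / 8\<close>; the head will contribute
    less than \<open>e / 2\<close>.\<close>
  obtain F where F: "finite F" "\<And>F'. finite F' \<Longrightarrow> F' \<inter> F = {} \<Longrightarrow> L2F g F' \<le> e / 8"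
    using sqs_tail[OF assms(2), of "e / 8"] e by auto
  have tail: "L2F (Us s - U) F' \<le> e / 4" if "finite F'" "F' \<inter> F = {}" for F' s
  proof -
    have "L2F (Us s - U) F' \<le> L2_set (\<lambda>k. norm (Us s k) + norm (U k)) F'"
      by (rule L2_set_mono) (simp_all add: fseq_apply norm_triangle_ineq4)
    also have "\<dots> \<le> L2_set (\<lambda>k. norm (g k) + norm (g k)) F'"
    proof (rule L2_set_mono)
      show "norm (Us s k) + norm (U k) \<le> norm (g k) + norm (g k)" for k
        by (rule add_mono[OF assms(3) U])
    qed simp
    also have "\<dots> \<le> L2F g F' + L2F g F'" by (rule L2_set_triangle_ineq)
    finally show ?thesis using F(2)[OF that] by linarith
  qed
  have "(\<lambda>s. L2F (Us s - U) F) \<longlonglongrightarrow> L2_set (\<lambda>k. norm (U k - U k)) F"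
    unfolding L2_set_def fseq_apply by (intro tendsto_intros assms(1))
  then have lim: "(\<lambda>s. L2F (Us s - U) F) \<longlonglongrightarrow> 0" by (simp add: L2_set_def)
  then obtain n where n: "\<And>s. s \<ge> n \<Longrightarrow> norm (L2F (Us s - U) F - 0) < e / 2"
    using LIMSEQ_D[OF lim half_gt_zero[OF e]] by auto
  have "norm (l2n (Us s - U) - 0) < e" if "s \<ge> n" for s
  proof -
    have "l2n (Us s - U) \<le> L2F (Us s - U) F + e / 4"
      by (rule l2n_split(2)[OF _ F(1)]) (use e tail in auto)
    then show ?thesis using n[OF that] e by simp
  qed
  then show "\<exists>n. \<forall>s\<ge>n. norm (l2n (Us s - U) - 0) < e" by blast
qed

lemma l2n_tendsto_imp_pointwise:
  assumes "\<And>s. sqs (Us s - U)" "(\<lambda>s. l2n (Us s - U)) \<longlonglongrightarrow> 0"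
  shows "(\<lambda>s. Us s k) \<longlonglongrightarrow> U k"
proof -
  have "(\<lambda>s. (Us s - U) k) \<longlonglongrightarrow> 0"
    using assms(2) by (rule Lim_null_comparison[rotated]) (auto simp: norm_le_l2n assms(1))
  then show ?thesis by (simp add: fseq_apply Lim_null[of _ "U k"])
qed

lemma l2n_tendsto_norm:
  assumes "\<And>s. sqs (Us s)" "sqs U" "(\<lambda>s. l2n (Us s - U)) \<longlonglongrightarrow> 0"
  shows "(\<lambda>s. l2n (Us s)) \<longlonglongrightarrow> l2n U"
proof -
  have "norm (l2n (Us s) - l2n U) \<le> l2n (Us s - U)" for s
    using l2n_le_diff[OF assms(1)[of s] assms(2)] l2n_le_diff[OF assms(2) assms(1)[of s]]
    by (simp add: l2n_commute[of U] abs_le_iff)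
  then have "(\<lambda>s. l2n (Us s) - l2n U) \<longlonglongrightarrow> 0"
    by (intro Lim_null_comparison[OF _ assms(3)]) auto
  then show ?thesis by (simp add: Lim_null[of _ "l2n U"])
qed

section \<open>Convolution by square-summable matrix sequences\<close>

lemma sqs_mult_bound:
  fixes f :: "int \<Rightarrow> 'c::banach"
  assumes "sqs A" "sqs B" "\<And>k. norm (f k) \<le> norm (A k) * norm (B k)"
  shows "f abs_summable_on UNIV" "f summable_on UNIV" "norm (infsum f UNIV) \<le> l2n A * l2n B"
proof -
  have le: "(\<Sum>k\<in>F. norm (f k)) \<le> l2n A * l2n B" if "finite F" for F
  proof -
    have "(\<Sum>k\<in>F. norm (f k)) \<le> (\<Sum>k\<in>F. \<bar>norm (A k)\<bar> * \<bar>norm (B k)\<bar>)"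
      by (intro sum_mono) (simp add: assms(3))
    also have "\<dots> \<le> L2F A F * L2F B F" by (rule L2_set_mult_ineq)
    also have "\<dots> \<le> l2n A * l2n B"
      by (intro mult_mono L2F_le_l2n assms that) (auto simp: L2_set_nonneg)
    finally show ?thesis .
  qed
  show s: "f abs_summable_on UNIV"
    by (rule nonneg_bdd_above_summable_on) (auto intro!: bdd_aboveI2 le)
  then show "f summable_on UNIV" by (rule abs_summable_summable)
  have "norm (infsum f UNIV) \<le> (\<Sum>\<^sub>\<infinity>k. norm (f k))" using s by (rule norm_infsum_bound)
  also have "\<dots> \<le> l2n A * l2n B" using s by (rule infsum_le_finite_sums) (auto intro: le)
  finally show "norm (infsum f UNIV) \<le> l2n A * l2n B" .
qed

lemma bij_reflect: "bij_betw (\<lambda>k. j - k) UNIV (UNIV :: int set)"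
  by (rule bij_betw_byWitness[where f' = "\<lambda>k. j - k"]) auto

lemma sqs_reflect: "sqs A \<Longrightarrow> sqs (\<lambda>k. A (j - k))"
  unfolding sqs_def using summable_on_reindex_bij_betw[OF bij_reflect, of "\<lambda>k. (norm (A k))\<^sup>2" j] by simp

lemma l2n_reflect: "l2n (\<lambda>k. A (j - k)) = l2n A"
  unfolding l2n_def using infsum_reindex_bij_betw[OF bij_reflect, of "\<lambda>k. (norm (A k))\<^sup>2" j] by simp

lemma norm_dot_le: "norm (\<Sum>a\<in>UNIV. x $ a * y $ a) \<le> norm x * norm (y :: complex^'n)"
proof -
  have "norm (\<Sum>a\<in>UNIV. x $ a * y $ a) \<le> (\<Sum>a\<in>UNIV. norm (x $ a * y $ a))" by (rule norm_sum)
  also have "\<dots> = (\<Sum>a\<in>UNIV. \<bar>norm (x $ a)\<bar> * \<bar>norm (y $ a)\<bar>)" by (simp add: norm_mult)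
  also have "\<dots> \<le> norm x * norm y" unfolding norm_vec_def by (rule L2_set_mult_ineq)
  finally show ?thesis .
qed

lemma norm_matrix_vector_le: "norm (A *v x) \<le> norm A * norm (x :: complex^'n)"
proof -
  have "norm (A *v x) \<le> L2_set (\<lambda>i. norm (A $ i) * norm x) UNIV"
    unfolding norm_vec_def[of "A *v x"]
    by (rule L2_set_mono) (auto simp: matrix_vector_mult_def norm_dot_le)
  also have "\<dots> = norm A * norm x"
    by (simp add: norm_vec_def[of A] L2_set_def power_mult_distrib sum_distrib_right[symmetric] real_sqrt_mult)
  finally show ?thesis .
qed

lemma conv_summable:
  fixes Ah :: "int \<Rightarrow> complex^'n::finite^'n"
  assumes "sqs Ah" "sqs U"
  shows "(\<lambda>k. Ah (j - k) *v U k) summable_on UNIV"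
  by (rule sqs_mult_bound(2)[OF sqs_reflect[OF assms(1)] assms(2)]) (rule norm_matrix_vector_le)

lemma conv_bound:
  assumes "sqs Ah" "sqs U"
  shows "norm (conv Ah U j) \<le> l2n Ah * l2n U"
  unfolding conv_def l2n_reflect[of Ah j, symmetric]
  by (rule sqs_mult_bound(3)[OF sqs_reflect[OF assms(1)] assms(2)]) (rule norm_matrix_vector_le)

lemma conv_add:
  assumes "sqs Ah" "sqs U" "sqs V"
  shows "conv Ah (U + V) j = conv Ah U j + conv Ah V j"
  unfolding conv_def fseq_apply matrix_vector_right_distrib
  by (intro infsum_add conv_summable assms)

text \<open>Summability is not assumed: for \<open>c \<noteq> 0\<close> both series are summable or
  neither is, and \<open>infsum\<close> is \<open>0\<close> for a series that is not.\<close>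

lemma conv_scl: "conv Ah (scl c U) j = c *s conv Ah U j"
proof -
  have bl: "bounded_linear (\<lambda>x::complex^'a. d *s x)" for d
    by (rule bounded_linear_intro[where K="norm d"])
      (auto simp: vector_add_ldistrib norm_cmult_vec mult.commute vec_eq_iff)
  have "Ah (j - k) *v (scl c U k) = c *s (Ah (j - k) *v U k)" for k
    by (auto simp: fseq_apply vec_eq_iff matrix_vector_mult_def sum_distrib_left mult_ac)
  then have "conv Ah (scl c U) j = (\<Sum>\<^sub>\<infinity>k. c *s (Ah (j - k) *v U k))" by (simp add: conv_def)
  also have "\<dots> = c *s conv Ah U j" unfolding conv_def
  proof (rule infsum_bounded_linear_strong'[OF _ bl])
    assume "c \<noteq> 0"
    then show "(\<lambda>k. c *s (Ah (j - k) *v U k)) summable_on UNIV \<longleftrightarrow> (\<lambda>k. Ah (j - k) *v U k) summable_on UNIV"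
      by (intro summable_on_bounded_linear_iff[OF bl bl[of "1 / c"]]) (simp add: vector_smult_assoc)
  qed simp
  finally show ?thesis .
qed

lemma conv_diff:
  assumes "sqs Ah" "sqs U" "sqs V"
  shows "conv Ah (U - V) j = conv Ah U j - conv Ah V j"
  using conv_add[OF assms(1) sqs_diff[OF assms(2,3)] assms(3), of j] by simp

lemma conv_finite:
  assumes "finite F" "\<And>k. k \<notin> F \<Longrightarrow> U k = 0"
  shows "conv Ah U j = (\<Sum>k\<in>F. Ah (j - k) *v U k)"
proof -
  have "conv Ah U j = (\<Sum>\<^sub>\<infinity>k\<in>F. Ah (j - k) *v U k)"
    unfolding conv_def by (rule infsum_cong_neutral) (auto simp: assms(2))
  then show ?thesis using assms(1) by simp
qed

text \<open>Convolution with \<open>Ah\<close> is unbounded on \<open>l2\<close>, but one frequency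
  of it is a pairing with a fixed \<open>l2\<close> sequence. \<open>Ah\<close> is cut into a finite
  head, where pointwise convergence acts, and a tail of small norm.\<close>

lemma conv_weak_continuous:
  fixes Us :: "nat \<Rightarrow> 'n::finite fseq"
  assumes "sqs Ah" "\<And>k. (\<lambda>s. Us s k) \<longlonglongrightarrow> U k" "\<And>s. sqs (Us s)" "\<And>s. l2n (Us s) \<le> B"
  shows "(\<lambda>s. conv Ah (Us s) j) \<longlonglongrightarrow> conv Ah U j"
proof -
  have U: "sqs U" "l2n U \<le> B" using sqs_fatou[of Us U B, OF assms(2)] assms(3,4) by auto
  have B: "0 \<le> B" using U(2) l2n_nonneg[of U] by linarith
  define V where "V = (\<lambda>s. Us s - U)"
  have V: "sqs (V s)" "l2n (V s) \<le> 2 * B" for s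
    using sqs_diff[OF assms(3) U(1)] l2n_diff[OF assms(3) U(1), of s] assms(4)[of s] U(2) by (auto simp: V_def)
  have "(\<lambda>s. conv Ah (V s) j) \<longlonglongrightarrow> 0"
  proof (rule LIMSEQ_I)
    fix e :: real assume e: "0 < e"
    \<comment> \<open>Chosen so that the tail, paired with a sequence of norm at most
      \<open>2 * B\<close>, stays below \<open>e / 2\<close>; the summand \<open>1\<close> admits
      \<open>B = 0\<close>.\<close>
    define d where "d = e / (4 * (B + 1))"
    have d: "0 < d" "d * (2 * B) < e / 2" using e B by (auto simp: d_def field_simps)
    obtain F where F: "finite F" "\<And>F'. finite F' \<Longrightarrow> F' \<inter> F = {} \<Longrightarrow> L2F Ah F' \<le> d"
      using sqs_tail[OF assms(1) d(1)] by blast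
    define Ar where "Ar = (\<lambda>k. if k \<in> F then 0 else Ah k)"
    have "L2F Ar F' \<le> d" if "finite F'" for F'
    proof -
      have "(\<Sum>k\<in>F'. (norm (Ar k))\<^sup>2) = (\<Sum>k\<in>F' - F. (norm (Ah k))\<^sup>2)"
        using that by (intro sum.mono_neutral_cong_right) (auto simp: Ar_def)
      then show ?thesis using F(2)[of "F' - F"] that by (auto simp: L2_set_def)
    qed
    then have Ar: "sqs Ar" "l2n Ar \<le> d" using sqs_bound[of d Ar] d by auto
    have dec: "conv Ah W j = conv Ar W j + (\<Sum>k\<in>(\<lambda>i. j - i) ` F. Ah (j - k) *v W k)" if W: "sqs W" for W :: "'n fseq"
    proof -
      let ?I = "(\<lambda>i. j - i) ` F"
      have I: "k \<in> ?I \<longleftrightarrow> j - k \<in> F" for k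
        by (metis (no_types) add_diff_cancel_left' diff_add_cancel diff_diff_eq2 imageE image_eqI)
      have "(\<Sum>\<^sub>\<infinity>k. (Ah (j - k) - Ar (j - k)) *v W k) = (\<Sum>\<^sub>\<infinity>k\<in>?I. Ah (j - k) *v W k)"
        using I by (intro infsum_cong_neutral) (auto simp: Ar_def)
      moreover have "conv Ah W j = conv Ar W j + (\<Sum>\<^sub>\<infinity>k. (Ah (j - k) - Ar (j - k)) *v W k)"
      proof -
        have sq: "sqs (\<lambda>k. Ah k - Ar k)"
          by (rule sqs_mono(1)[OF assms(1)]) (simp add: Ar_def)
        have "Ah (j - k) *v W k = Ar (j - k) *v W k + (Ah (j - k) - Ar (j - k)) *v W k" for k
          by (simp add: matrix_vector_mult_diff_rdistrib)
        then show ?thesis unfolding conv_def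
          using infsum_add[OF conv_summable[OF Ar(1) W, of j] conv_summable[OF sq W, of j]] by simp
      qed
      ultimately show ?thesis using F(1) by simp
    qed
    have "(\<lambda>s. \<Sum>k\<in>(\<lambda>i. j - i) ` F. Ah (j - k) *v V s k) \<longlonglongrightarrow> (\<Sum>k\<in>(\<lambda>i. j - i) ` F. Ah (j - k) *v (U k - U k))"
      unfolding V_def fseq_apply
      by (intro tendsto_sum bounded_linear.tendsto[OF matrix_vector_mul_bounded_linear] tendsto_diff assms(2) tendsto_const)
    then have lim: "(\<lambda>s. \<Sum>k\<in>(\<lambda>i. j - i) ` F. Ah (j - k) *v V s k) \<longlonglongrightarrow> 0" by simp
    then obtain n where n: "\<And>s. s \<ge> n \<Longrightarrow> norm ((\<Sum>k\<in>(\<lambda>i. j - i) ` F. Ah (j - k) *v V s k) - 0) < e / 2"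
      using LIMSEQ_D[OF lim half_gt_zero[OF e]] by auto
    have "norm (conv Ah (V s) j - 0) < e" if "s \<ge> n" for s
    proof -
      have "norm (conv Ar (V s) j) \<le> d * (2 * B)"
        using conv_bound[OF Ar(1) V(1)[of s], of j] mult_mono[OF Ar(2) V(2)[of s]] d by simp
      then have "norm (conv Ar (V s) j) < e / 2" using d(2) by linarith
      then show ?thesis using n[OF that]
        norm_triangle_ineq[of "conv Ar (V s) j" "\<Sum>k\<in>(\<lambda>i. j - i) ` F. Ah (j - k) *v V s k"]
        unfolding dec[OF V(1)] by simp
    qed
    then show "\<exists>n. \<forall>s\<ge>n. norm (conv Ah (V s) j - 0) < e" by blast
  qed
  then have "(\<lambda>s. conv Ah (Us s) j - conv Ah U j) \<longlonglongrightarrow> 0"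
    by (simp add: V_def conv_diff[OF assms(1,3) U(1)])
  then show ?thesis by (simp add: Lim_null[of _ "conv Ah U j"])
qed

section \<open>The inner product of square-summable sequences\<close>

definition ip :: "'n::finite fseq \<Rightarrow> 'n fseq \<Rightarrow> complex" where
  "ip U V = (\<Sum>\<^sub>\<infinity>k. \<Sum>a\<in>UNIV. cnj (U k $ a) * V k $ a)"

lemma norm_cdot_le: "norm (\<Sum>a\<in>UNIV. cnj (x $ a) * y $ a) \<le> norm x * norm (y :: complex^'n)"
  using norm_dot_le[of "\<chi> a. cnj (x $ a)" y] by (simp add: norm_vec_def)

lemma ip_summable:
  assumes "sqs U" "sqs V"
  shows "(\<lambda>k. \<Sum>a\<in>UNIV. cnj (U k $ a) * V k $ a) summable_on UNIV"
  using assms by (rule sqs_mult_bound) (rule norm_cdot_le)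

lemma ip_bound: "sqs U \<Longrightarrow> sqs V \<Longrightarrow> norm (ip U V) \<le> l2n U * l2n V"
  unfolding ip_def by (rule sqs_mult_bound(3)) (auto simp: norm_cdot_le)

lemma ip_add_right:
  assumes "sqs U" "sqs V" "sqs W"
  shows "ip U (V + W) = ip U V + ip U W"
proof -
  have "(\<Sum>a\<in>UNIV. cnj (U k $ a) * (V + W) k $ a)
     = (\<Sum>a\<in>UNIV. cnj (U k $ a) * V k $ a) + (\<Sum>a\<in>UNIV. cnj (U k $ a) * W k $ a)" for k
    by (simp add: fseq_apply distrib_left sum.distrib)
  then show ?thesis unfolding ip_def
    by (simp only: infsum_add[OF ip_summable[OF assms(1,2)] ip_summable[OF assms(1,3)]])
qed

lemma ip_scl_right: "ip U (scl c V) = c * ip U V"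
proof -
  have "(\<Sum>a\<in>UNIV. cnj (U k $ a) * (c *s V k) $ a) = c * (\<Sum>a\<in>UNIV. cnj (U k $ a) * V k $ a)" for k
    by (simp add: sum_distrib_left mult_ac)
  then show ?thesis unfolding ip_def fseq_apply by (simp add: infsum_cmult_right')
qed

lemma ip_cnj: "ip V U = cnj (ip U V)"
  unfolding ip_def infsum_cnj[symmetric] by (simp add: mult.commute)

lemma ip_diff_right: "sqs U \<Longrightarrow> sqs V \<Longrightarrow> sqs W \<Longrightarrow> ip U (V - W) = ip U V - ip U W"
  using ip_add_right[of U "V - W" W, OF _ sqs_diff] by simp

lemma ip_diff_left: "sqs U \<Longrightarrow> sqs V \<Longrightarrow> sqs W \<Longrightarrow> ip (V - W) U = ip V U - ip W U"
  using ip_diff_right[of U V W] by (simp add: ip_cnj[of _ U])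

lemma ip_zero_right: "ip U 0 = 0"
  by (simp add: ip_def fseq_apply)

lemma ip_sum_right: "sqs U \<Longrightarrow> (\<And>i. i \<in> I \<Longrightarrow> sqs (f i)) \<Longrightarrow> ip U (\<Sum>i\<in>I. f i) = (\<Sum>i\<in>I. ip U (f i))"
  by (induction I rule: infinite_finite_induct) (simp_all add: ip_zero_right ip_add_right sqs_sum)

lemma ip_self:
  fixes U :: "'n::finite fseq"
  assumes "sqs U"
  shows "ip U U = of_real ((l2n U)\<^sup>2)"
proof -
  have "(\<Sum>a\<in>UNIV. cnj (x $ a) * x $ a) = of_real ((norm x)\<^sup>2)" for x :: "complex^'n"
    by (simp add: norm_vec_def L2_set_def sum_nonneg complex_norm_square mult.commute del: of_real_power)
  then have "ip U U = (\<Sum>\<^sub>\<infinity>k. complex_of_real ((norm (U k))\<^sup>2))" by (simp only: ip_def)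
  also have "\<dots> = complex_of_real (\<Sum>\<^sub>\<infinity>k. (norm (U k))\<^sup>2)"
    using assms summable_on_bounded_linear[OF bounded_linear_of_real, of "\<lambda>k. (norm (U k))\<^sup>2" UNIV]
    unfolding sqs_def by (intro infsum_bounded_linear_strong bounded_linear_of_real) blast
  finally show ?thesis by (simp only: l2n_power2)
qed

lemma ip_tendsto:
  assumes "\<And>s. sqs (Us s)" "sqs U" "(\<lambda>s. l2n (Us s - U)) \<longlonglongrightarrow> 0"
    and "\<And>s. sqs (Vs s)" "sqs V" "(\<lambda>s. l2n (Vs s - V)) \<longlonglongrightarrow> 0"
  shows "(\<lambda>s. ip (Us s) (Vs s)) \<longlonglongrightarrow> ip U V"
proof -
  have "norm (ip (Us s) (Vs s) - ip U V) \<le> l2n (Us s) * l2n (Vs s - V) + l2n (Us s - U) * l2n V" for s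
  proof -
    have "ip (Us s) (Vs s) - ip U V = ip (Us s) (Vs s - V) + ip (Us s - U) V"
      by (simp only: ip_diff_right[OF assms(1) assms(4,5)] ip_diff_left[OF assms(5) assms(1,2)]) simp
    then show ?thesis
      using norm_triangle_ineq[of "ip (Us s) (Vs s - V)" "ip (Us s - U) V"]
        ip_bound[OF assms(1)[of s] sqs_diff[OF assms(4)[of s] assms(5)]]
        ip_bound[OF sqs_diff[OF assms(1)[of s] assms(2)] assms(5)] by simp
  qed
  note bound = this
  have lim: "(\<lambda>s. l2n (Us s) * l2n (Vs s - V) + l2n (Us s - U) * l2n V) \<longlonglongrightarrow> l2n U * 0 + 0 * l2n V"
    by (intro tendsto_intros assms l2n_tendsto_norm)
  have "(\<lambda>s. ip (Us s) (Vs s) - ip U V) \<longlonglongrightarrow> 0"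
    by (rule Lim_null_comparison[OF always_eventually[OF allI[OF bound]]]) (use lim in simp)
  then show ?thesis by (simp add: Lim_null[of _ "ip U V"])
qed

section \<open>Truncation to finitely many frequencies\<close>

lemma in_H_sqs: "in_H J U \<Longrightarrow> sqs U"
  unfolding in_H_def sqs_def
  by (rule summable_on_cong_neutral[THEN iffD1, OF _ _ _ summable_on_finite[of "{-int J..int J}"]]) auto

lemma trunc_in_H: "in_H J (trunc J U)"
  by (simp add: in_H_def trunc_def)

lemma trunc_id: "in_H J U \<Longrightarrow> trunc J U = U"
  by (auto simp: in_H_def trunc_def fun_eq_iff not_le)

lemma norm_trunc_le: "norm (trunc J U k) \<le> norm (U k)"
  by (simp add: trunc_def)

lemma l2n_trunc_le: "sqs U \<Longrightarrow> l2n (trunc J U) \<le> l2n U"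
  by (rule sqs_mono) (auto simp: norm_trunc_le)

lemma trunc_tendsto: "filterlim r at_top sequentially \<Longrightarrow> (\<lambda>s. trunc (r s) U k) \<longlonglongrightarrow> U k"
proof -
  assume "filterlim r at_top sequentially"
  then have "\<forall>\<^sub>F s in sequentially. nat \<bar>k\<bar> \<le> r s" by (simp add: filterlim_at_top)
  then have "\<forall>\<^sub>F s in sequentially. trunc (r s) U k = U k"
    by eventually_elim (simp add: trunc_def)
  then show ?thesis by (rule tendsto_eventually)
qed

lemma trunc_l2n_tendsto:
  assumes "sqs U" "filterlim r at_top sequentially"
  shows "(\<lambda>s. l2n (trunc (r s) U - U)) \<longlonglongrightarrow> 0"
  by (rule l2n_dominated[OF trunc_tendsto[OF assms(2)] assms(1)]) (rule norm_trunc_le)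

lemma trunc_add: "trunc J (U + V) = trunc J U + trunc J V"
  by (auto simp: trunc_def fun_eq_iff fseq_apply)

lemma trunc_diff: "trunc J (U - V) = trunc J U - trunc J V"
  by (auto simp: trunc_def fun_eq_iff fseq_apply)

lemma trunc_scl: "trunc J (scl c U) = scl c (trunc J U)"
  by (auto simp: trunc_def fun_eq_iff fseq_apply)

lemma in_H_zero: "in_H J 0" and in_H_add: "in_H J U \<Longrightarrow> in_H J V \<Longrightarrow> in_H J (U + V)"
  and in_H_scl: "in_H J U \<Longrightarrow> in_H J (scl c U)" and in_H_diff: "in_H J U \<Longrightarrow> in_H J V \<Longrightarrow> in_H J (U - V)"
  by (auto simp: in_H_def fseq_apply)

lemma in_H_mono: "in_H J U \<Longrightarrow> J \<le> J' \<Longrightarrow> in_H J' U"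
  by (auto simp: in_H_def)

section \<open>Fourier coefficients of square-integrable functions\<close>

locale period =
  fixes X :: real
  assumes X_pos: "X > 0"
begin

abbreviation M where "M \<equiv> lebesgue_on {0..X}"

definition ex :: "int \<Rightarrow> real \<Rightarrow> complex" where
  "ex k x = exp (2 * complex_of_real pi * \<i> * of_int k * of_real x / of_real X)"

definition fc :: "(real \<Rightarrow> complex) \<Rightarrow> int \<Rightarrow> complex" where
  "fc f k = complex_of_real (1 / X) * (LINT x|M. f x * ex (-k) x)"

definition sqi :: "(real \<Rightarrow> complex) \<Rightarrow> bool" where
  "sqi f \<longleftrightarrow> f \<in> borel_measurable M \<and> integrable M (\<lambda>x. (norm (f x))\<^sup>2)"

definition hip :: "(real \<Rightarrow> complex) \<Rightarrow> (real \<Rightarrow> complex) \<Rightarrow> complex" where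
  "hip f g = (LINT x|M. cnj (f x) * g x)"

sublocale finite_measure M
  using X_pos by (intro finite_measureI) (simp add: emeasure_restrict_space space_restrict_space)

lemma fourier_coeff_eq_fc: "fourier_coeff X A k $ i $ j = fc (\<lambda>x. A x $ i $ j) k"
  unfolding fourier_coeff_def fc_def set_lebesgue_integral_def ex_def
  by (subst integral_restrict_space) (auto simp: algebra_simps)

lemma ex_add: "ex (k + l) x = ex k x * ex l x"
  by (simp add: ex_def exp_add[symmetric] ring_distribs add_divide_distrib)

lemma ex_0 [simp]: "ex 0 x = 1"
  by (simp add: ex_def)

lemma norm_ex [simp]: "norm (ex k x) = 1"
  by (simp add: ex_def)

lemma cnj_ex: "cnj (ex k x) = ex (-k) x"
  by (simp add: ex_def exp_cnj)

lemma continuous_ex: "continuous_on S (ex k)"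
  unfolding ex_def using X_pos by (intro continuous_intros) auto

lemma measurable_ex [measurable]: "ex k \<in> borel_measurable M"
  by (rule continuous_imp_measurable_on_sets_lebesgue[OF continuous_ex]) simp

lemma sqi_measurable: "sqi f \<Longrightarrow> f \<in> borel_measurable M"
  by (simp add: sqi_def)

lemma sqi_mult_integrable:
  assumes "sqi f" "sqi g"
  shows "integrable M (\<lambda>x. f x * g x)"
proof (rule Bochner_Integration.integrable_bound)
  show "integrable M (\<lambda>x. (norm (f x))\<^sup>2 + (norm (g x))\<^sup>2)" using assms by (simp add: sqi_def)
  show "(\<lambda>x. f x * g x) \<in> borel_measurable M" using assms by (auto simp: sqi_def)
  have "norm (a * b) \<le> norm ((norm a)\<^sup>2 + (norm b)\<^sup>2)" for a b :: complex
  proof -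
    have "2 * (norm a * norm b) \<le> (norm a)\<^sup>2 + (norm b)\<^sup>2"
      using sum_squares_bound[of "norm a" "norm b"] by (simp add: mult.assoc)
    moreover have "0 \<le> norm a * norm b" by simp
    ultimately have "norm a * norm b \<le> (norm a)\<^sup>2 + (norm b)\<^sup>2" by linarith
    then show ?thesis by (simp add: norm_mult)
  qed
  then show "AE x in M. norm (f x * g x) \<le> norm ((norm (f x))\<^sup>2 + (norm (g x))\<^sup>2)" by blast
qed

lemma sqi_bound:
  assumes "f \<in> borel_measurable M" "sqi g" "\<And>x. x \<in> {0..X} \<Longrightarrow> norm (f x) \<le> norm (g x)"
  shows "sqi f"
  unfolding sqi_def
proof (intro conjI assms)
  show "integrable M (\<lambda>x. (norm (f x))\<^sup>2)"
  proof (rule Bochner_Integration.integrable_bound)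
    show "integrable M (\<lambda>x. (norm (g x))\<^sup>2)" using assms by (simp add: sqi_def)
    show "(\<lambda>x. (norm (f x))\<^sup>2) \<in> borel_measurable M" using assms(1) by simp
    show "AE x in M. norm ((norm (f x))\<^sup>2) \<le> norm ((norm (g x))\<^sup>2)"
      by (rule AE_I2) (simp add: assms(3) space_restrict_space power_mono)
  qed
qed

lemma sqi_const: "sqi (\<lambda>x. c)"
  by (simp add: sqi_def)

lemma sqi_bounded:
  assumes "f \<in> borel_measurable M" "\<And>x. x \<in> {0..X} \<Longrightarrow> norm (f x) \<le> B"
  shows "sqi f"
proof (rule sqi_bound[OF assms(1) sqi_const[of "of_real B"]])
  show "norm (f x) \<le> norm (complex_of_real B)" if "x \<in> {0..X}" for x
    using assms(2)[OF that] by simp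
qed

lemma sqi_mult_bounded:
  assumes "sqi f" "g \<in> borel_measurable M" "\<And>x. x \<in> {0..X} \<Longrightarrow> norm (g x) \<le> B"
  shows "sqi (\<lambda>x. f x * g x)"
proof -
  have "sqi (\<lambda>x. f x * of_real B)"
    using assms(1) by (auto simp: sqi_def norm_mult power_mult_distrib)
  moreover have "norm (f x * g x) \<le> norm (f x * complex_of_real B)" if "x \<in> {0..X}" for x
    using assms(3)[OF that] by (simp add: norm_mult mult_left_mono)
  moreover have "(\<lambda>x. f x * g x) \<in> borel_measurable M"
    using sqi_measurable[OF assms(1)] assms(2) by simp
  ultimately show ?thesis by (intro sqi_bound[of "\<lambda>x. f x * g x"])
qed

lemma sqi_add:
  assumes "sqi f" "sqi g"
  shows "sqi (\<lambda>x. f x + g x)"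
  unfolding sqi_def
proof
  show m: "(\<lambda>x. f x + g x) \<in> borel_measurable M" using assms by (auto simp: sqi_def)
  show "integrable M (\<lambda>x. (norm (f x + g x))\<^sup>2)"
  proof (rule Bochner_Integration.integrable_bound)
    show "integrable M (\<lambda>x. 2 * (norm (f x))\<^sup>2 + 2 * (norm (g x))\<^sup>2)" using assms by (simp add: sqi_def)
    show "(\<lambda>x. (norm (f x + g x))\<^sup>2) \<in> borel_measurable M" using m by simp
    have "(norm (a + b))\<^sup>2 \<le> 2 * (norm a)\<^sup>2 + 2 * (norm b)\<^sup>2" for a b :: complex
    proof -
      have "(norm (a + b))\<^sup>2 \<le> (norm a + norm b)\<^sup>2" by (rule power_mono) (auto simp: norm_triangle_ineq)
      also have "\<dots> = (norm a)\<^sup>2 + (norm b)\<^sup>2 + 2 * norm a * norm b" by (simp add: power2_sum)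
      finally show ?thesis using sum_squares_bound[of "norm a" "norm b"] by simp
    qed
    then show "AE x in M. norm ((norm (f x + g x))\<^sup>2) \<le> norm (2 * (norm (f x))\<^sup>2 + 2 * (norm (g x))\<^sup>2)"
      by (intro AE_I2) simp
  qed
qed

lemma sqi_cmult: "sqi f \<Longrightarrow> sqi (\<lambda>x. c * f x)"
  by (auto simp: sqi_def norm_mult power_mult_distrib)

lemma sqi_diff: "sqi f \<Longrightarrow> sqi g \<Longrightarrow> sqi (\<lambda>x. f x - g x)"
  using sqi_add[of f "\<lambda>x. (-1) * g x"] sqi_cmult[of g "-1"] by simp

lemma sqi_sum: "(\<And>i. i \<in> I \<Longrightarrow> sqi (f i)) \<Longrightarrow> sqi (\<lambda>x. \<Sum>i\<in>I. f i x)"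
  by (induction I rule: infinite_finite_induct) (simp_all add: sqi_const sqi_add)

lemma sqi_ex: "sqi (ex k)"
  by (rule sqi_bounded[of _ 1]) auto

lemma sqi_cnj: "sqi f \<Longrightarrow> sqi (\<lambda>x. cnj (f x))"
  unfolding sqi_def using borel_measurable_continuous_on[of cnj f M]
  by (auto intro: continuous_intros)

lemma hip_integrable: "sqi f \<Longrightarrow> sqi g \<Longrightarrow> integrable M (\<lambda>x. cnj (f x) * g x)"
  by (rule sqi_mult_integrable[OF sqi_cnj])

lemma hip_cnj: "hip g f = cnj (hip f g)"
  unfolding hip_def Bochner_Integration.integral_cnj[symmetric] by (simp add: mult.commute)

lemma hip_cmult_right: "hip f (\<lambda>x. c * g x) = c * hip f g"
  unfolding hip_def integral_mult_right_zero[symmetric] by (simp add: mult_ac)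

lemma hip_diff_right: "sqi f \<Longrightarrow> sqi g \<Longrightarrow> sqi h \<Longrightarrow> hip f (\<lambda>x. g x - h x) = hip f g - hip f h"
  unfolding hip_def right_diff_distrib by (intro Bochner_Integration.integral_diff hip_integrable)

lemma hip_sum_right:
  assumes "sqi f" "\<And>i. i \<in> I \<Longrightarrow> sqi (g i)"
  shows "hip f (\<lambda>x. \<Sum>i\<in>I. g i x) = (\<Sum>i\<in>I. hip f (g i))"
  unfolding hip_def sum_distrib_left
  by (intro Bochner_Integration.integral_sum hip_integrable assms)

lemma hip_sum_left:
  assumes "sqi f" "\<And>i. i \<in> I \<Longrightarrow> sqi (g i)"
  shows "hip (\<lambda>x. \<Sum>i\<in>I. g i x) f = (\<Sum>i\<in>I. hip (g i) f)"
  using hip_sum_right[OF assms, of I "\<lambda>x. x"] assms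
  by (subst hip_cnj, subst hip_sum_right) (auto simp: hip_cnj[of _ f])

lemma hip_cmult_left: "hip (\<lambda>x. c * g x) f = cnj c * hip g f"
  by (subst hip_cnj, subst hip_cmult_right) (simp add: hip_cnj[of f g])

lemma hip_self: "hip f f = of_real (LINT x|M. (norm (f x))\<^sup>2)"
proof -
  have "cnj (f x) * f x = of_real ((norm (f x))\<^sup>2)" for x
    by (simp only: complex_norm_square mult.commute)
  then have "hip f f = (LINT x|M. complex_of_real ((norm (f x))\<^sup>2))" by (simp only: hip_def)
  then show ?thesis by (simp only: integral_complex_of_real)
qed

lemma fc_eq_hip: "of_real X * fc f k = hip (ex k) f"
  using X_pos unfolding fc_def hip_def cnj_ex by (simp add: mult.commute)

lemma hip_ex_0:
  assumes "m \<noteq> 0"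
  shows "(LINT x|M. ex m x) = 0"
proof -
  define c where "c = 2 * complex_of_real pi * \<i> * of_int m / of_real X"
  have c: "c \<noteq> 0" using assms X_pos by (simp add: c_def)
  have e: "ex m x = exp (c * of_real x)" for x by (simp add: ex_def c_def)
  have "((\<lambda>x. exp (c * of_real x) / c) has_vector_derivative exp (c * of_real x)) (at x within {0..X})" for x
  proof -
    have "((\<lambda>z. exp (c * z) / c) has_field_derivative exp (c * of_real x)) (at (of_real x))"
      using c by (auto intro!: derivative_eq_intros)
    from has_vector_derivative_real_field[OF this] show ?thesis by simp
  qed
  then have "((\<lambda>x. exp (c * of_real x)) has_integral exp (c * of_real X) / c - exp (c * of_real 0) / c) {0..X}"
    using X_pos by (intro fundamental_theorem_of_calculus) auto
  moreover have "exp (c * of_real X) = 1"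
  proof -
    have "c * of_real X = (2 * of_int m * of_real pi) * \<i>" using X_pos by (simp add: c_def)
    then show ?thesis
      using exp_integer_2pi[OF Ints_of_int[of m, where ?'a=real]] by (simp add: mult_ac)
  qed
  ultimately have "integral {0..X} (ex m) = 0" unfolding e by (simp add: integral_unique e)
  moreover have "integrable M (ex m)"
    using sqi_mult_integrable[OF sqi_ex sqi_const, of m 1] by simp
  ultimately show ?thesis using lebesgue_integral_eq_integral[of "{0..X}" "ex m"] by simp
qed

lemma hip_ex: "hip (ex k) (ex l) = (if k = l then of_real X else 0)"
proof -
  have "cnj (ex k x) * ex l x = ex (l - k) x" for x
    unfolding cnj_ex ex_add[symmetric] by simp
  then have "hip (ex k) (ex l) = (LINT x|M. ex (l - k) x)" by (simp add: hip_def)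
  moreover have "(LINT x|M. (1::complex)) = of_real X"
    using X_pos by (simp add: measure_restrict_space scaleR_conv_of_real)
  ultimately show ?thesis using hip_ex_0[of "l - k"] by auto
qed

section \<open>Trigonometric sums and the Bessel inequality\<close>

definition tsum :: "int set \<Rightarrow> (int \<Rightarrow> complex) \<Rightarrow> real \<Rightarrow> complex" where
  "tsum F c x = (\<Sum>k\<in>F. c k * ex k x)"

lemma sqi_tsum: "sqi (tsum F c)"
  unfolding tsum_def by (intro sqi_sum sqi_cmult sqi_ex)

lemma hip_tsum_left: "sqi f \<Longrightarrow> hip (tsum F c) f = of_real X * (\<Sum>k\<in>F. cnj (c k) * fc f k)"
  unfolding tsum_def
  by (subst hip_sum_left) (auto intro: sqi_cmult sqi_ex simp: hip_cmult_left fc_eq_hip[symmetric] sum_distrib_left mult_ac)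

lemma fc_tsum: "finite F \<Longrightarrow> fc (tsum F c) k = (if k \<in> F then c k else 0)"
proof -
  assume F: "finite F"
  have "of_real X * fc (tsum F c) k = (\<Sum>l\<in>F. c l * (if k = l then of_real X else 0))"
    unfolding fc_eq_hip tsum_def
    by (subst hip_sum_right) (auto intro: sqi_ex sqi_cmult simp: hip_cmult_right hip_ex)
  also have "\<dots> = of_real X * (if k \<in> F then c k else 0)"
    using F by (simp add: if_distrib sum.delta cong: if_cong)
  finally show ?thesis using X_pos by (simp split: if_splits)
qed

lemma integral_norm_tsum: "finite F \<Longrightarrow> (LINT x|M. (norm (tsum F c x))\<^sup>2) = X * (\<Sum>k\<in>F. (norm (c k))\<^sup>2)"
proof -
  assume F: "finite F"
  have "complex_of_real (LINT x|M. (norm (tsum F c x))\<^sup>2) = of_real X * (\<Sum>k\<in>F. cnj (c k) * c k)"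
    unfolding hip_self[symmetric] by (subst hip_tsum_left[OF sqi_tsum]) (simp add: fc_tsum[OF F])
  also have "(\<Sum>k\<in>F. cnj (c k) * c k) = of_real (\<Sum>k\<in>F. (norm (c k))\<^sup>2)"
    unfolding of_real_sum by (rule sum.cong) (simp_all only: complex_norm_square mult.commute)
  finally show ?thesis by (simp only: of_real_mult[symmetric] of_real_eq_iff)
qed

text \<open>Pythagoras: the remainder \<open>g\<close> after projection is orthogonal to
  \<open>?s\<close>, so its squared norm is the difference of the two sides and is
  nonnegative.\<close>

lemma bessel_finite:
  assumes "sqi f" "finite F"
  shows "X * (\<Sum>k\<in>F. (norm (fc f k))\<^sup>2) \<le> (LINT x|M. (norm (f x))\<^sup>2)"
proof -
  let ?s = "tsum F (fc f)"
  let ?S = "X * (\<Sum>k\<in>F. (norm (fc f k))\<^sup>2)"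
  have sf: "hip ?s f = of_real ?S"
  proof -
    have "hip ?s f = of_real X * (\<Sum>k\<in>F. cnj (fc f k) * fc f k)" by (rule hip_tsum_left[OF assms(1)])
    also have "(\<Sum>k\<in>F. cnj (fc f k) * fc f k) = of_real (\<Sum>k\<in>F. (norm (fc f k))\<^sup>2)"
      unfolding of_real_sum by (rule sum.cong) (simp_all only: complex_norm_square mult.commute)
    finally show ?thesis by (simp only: of_real_mult)
  qed
  have ss: "hip ?s ?s = of_real ?S" using hip_self[of ?s] integral_norm_tsum[OF assms(2)] by simp
  have fs: "hip f ?s = of_real ?S" using hip_cnj[of f ?s] sf by simp
  define g where "g = (\<lambda>x. f x - ?s x)"
  have g: "sqi g" unfolding g_def by (intro sqi_diff assms sqi_tsum)
  have gf: "hip g f = hip f f - of_real ?S"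
    using hip_cnj[of g f] hip_diff_right[OF assms(1) assms(1) sqi_tsum, of F "fc f"] fs
    by (simp add: g_def hip_self)
  have gs: "hip g ?s = 0"
    using hip_cnj[of g ?s] hip_diff_right[OF sqi_tsum assms(1) sqi_tsum, of F "fc f" F "fc f"] sf ss
    by (simp add: g_def)
  have "hip g g = hip g f - hip g ?s"
    using hip_diff_right[OF g assms(1) sqi_tsum, of F "fc f"] by (simp add: g_def)
  then have "complex_of_real (LINT x|M. (norm (g x))\<^sup>2) = of_real ((LINT x|M. (norm (f x))\<^sup>2) - ?S)"
    using gf gs by (simp only: hip_self) simp
  then have "(LINT x|M. (norm (g x))\<^sup>2) = (LINT x|M. (norm (f x))\<^sup>2) - ?S"
    by (simp only: of_real_eq_iff)
  moreover have "0 \<le> (LINT x|M. (norm (g x))\<^sup>2)" by simp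
  ultimately show ?thesis by linarith
qed

lemma bessel:
  assumes "sqi f"
  shows "sqs (fc f)" "l2n (fc f) \<le> sqrt ((LINT x|M. (norm (f x))\<^sup>2) / X)"
proof -
  have "L2F (fc f) F \<le> sqrt ((LINT x|M. (norm (f x))\<^sup>2) / X)" if "finite F" for F
    unfolding L2_set_def using bessel_finite[OF assms that] X_pos
    by (intro real_sqrt_le_mono) (simp add: field_simps)
  then show "sqs (fc f)" "l2n (fc f) \<le> sqrt ((LINT x|M. (norm (f x))\<^sup>2) / X)"
    using sqs_bound[of "sqrt ((LINT x|M. (norm (f x))\<^sup>2) / X)" "fc f"] X_pos by auto
qed

section \<open>Coercivity of truncated Toeplitz matrices and trigonometric approximation\<close>

lemma L2_per_component:
  assumes "L2_per X A"
  shows "(\<lambda>x. A x $ i $ j) \<in> borel_measurable lebesgue"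
  using assms unfolding L2_per_def
  by (intro borel_measurable_continuous_on[of "\<lambda>B. B $ i $ j"] continuous_intros) auto

lemma L2_per_norm_integrable: "L2_per X A \<Longrightarrow> integrable M (\<lambda>x. (norm (A x))\<^sup>2)"
  unfolding L2_per_def set_integrable_def by (simp add: integrable_restrict_space)

lemma norm_component_le: "norm (B $ i $ j) \<le> norm (B :: complex^'n^'m)"
  by (rule order_trans[OF Finite_Cartesian_Product.norm_nth_le Finite_Cartesian_Product.norm_nth_le])

lemma L2_per_sqi:
  assumes "L2_per X A"
  shows "sqi (\<lambda>x. A x $ i $ j)"
  unfolding sqi_def
proof
  show m: "(\<lambda>x. A x $ i $ j) \<in> borel_measurable M"
    by (rule measurable_restrict_space1[OF L2_per_component[OF assms]])
  show "integrable M (\<lambda>x. (norm (A x $ i $ j))\<^sup>2)"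
  proof (rule Bochner_Integration.integrable_bound[OF L2_per_norm_integrable[OF assms]])
    show "(\<lambda>x. (norm (A x $ i $ j))\<^sup>2) \<in> borel_measurable M" using m by simp
    show "AE x in M. norm ((norm (A x $ i $ j))\<^sup>2) \<le> norm ((norm (A x))\<^sup>2)"
      by (rule AE_I2) (simp add: power_mono norm_component_le)
  qed
qed

lemma sqs_fourier_coeff:
  assumes "L2_per X A"
  shows "sqs (fourier_coeff X A)"
proof (rule sqs_vec(1), rule sqs_vec(1))
  show "sqs (\<lambda>k. fourier_coeff X A k $ i $ j)" for i j
    unfolding fourier_coeff_eq_fc by (rule bessel(1)[OF L2_per_sqi[OF assms]])
qed

lemma fc_mult_ex: "fc (\<lambda>x. f x * ex k x) j = fc f (j - k)"
proof -
  have "f x * ex k x * ex (-j) x = f x * ex (-(j - k)) x" for x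
    using ex_add[of k "-j" x] by (simp add: mult.assoc)
  then show ?thesis by (simp only: fc_def)
qed

lemma fc_cmult: "fc (\<lambda>x. c * f x) k = c * fc f k"
proof -
  have "of_real X * fc (\<lambda>x. c * f x) k = of_real X * (c * fc f k)"
    unfolding mult.left_commute[of "of_real X" c] fc_eq_hip by (rule hip_cmult_right)
  then show ?thesis using X_pos by simp
qed

lemma fc_sum: "(\<And>i. i \<in> I \<Longrightarrow> sqi (f i)) \<Longrightarrow> fc (\<lambda>x. \<Sum>i\<in>I. f i x) k = (\<Sum>i\<in>I. fc (f i) k)"
proof -
  assume f: "\<And>i. i \<in> I \<Longrightarrow> sqi (f i)"
  have "of_real X * fc (\<lambda>x. \<Sum>i\<in>I. f i x) k = of_real X * (\<Sum>i\<in>I. fc (f i) k)"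
    unfolding fc_eq_hip sum_distrib_left by (rule hip_sum_right[OF sqi_ex f])
  then show ?thesis using X_pos by simp
qed

lemma fc_diff: "sqi f \<Longrightarrow> sqi g \<Longrightarrow> fc (\<lambda>x. f x - g x) k = fc f k - fc g k"
proof -
  assume fg: "sqi f" "sqi g"
  have "of_real X * fc (\<lambda>x. f x - g x) k = of_real X * (fc f k - fc g k)"
    unfolding fc_eq_hip right_diff_distrib by (rule hip_diff_right[OF sqi_ex fg])
  then show ?thesis using X_pos by simp
qed

text \<open>For \<open>p\<close> in \<open>in_H J\<close>, the function whose Fourier coefficients
  are \<open>p\<close>. It turns statements about Toeplitz matrices into statements about
  integrals.\<close>

definition vt :: "nat \<Rightarrow> 'n::finite fseq \<Rightarrow> real \<Rightarrow> complex^'n" where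
  "vt J p x = (\<chi> a. tsum {-int J..int J} (\<lambda>k. p k $ a) x)"

lemma tsum_bounded: "norm (tsum F c x) \<le> (\<Sum>k\<in>F. norm (c k))"
  unfolding tsum_def by (rule order_trans[OF norm_sum]) (simp add: norm_mult)

lemma sqi_mult_tsum: "sqi f \<Longrightarrow> sqi (\<lambda>x. f x * tsum F c x)"
  by (rule sqi_mult_bounded[OF _ sqi_measurable[OF sqi_tsum] tsum_bounded])

lemma sqi_matrix_vt:
  assumes "L2_per X A"
  shows "sqi (\<lambda>x. (A x *v vt J p x) $ a)"
  unfolding matrix_vector_mult_def vt_def vec_lambda_beta
  by (intro sqi_sum sqi_mult_tsum L2_per_sqi assms)

text \<open>The convolution theorem for finitely many frequencies; by linearity it comes down to the
  index shift produced by a factor \<open>ex k\<close>.\<close>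

lemma conv_vt:
  assumes A: "L2_per X A" and p: "in_H J p"
  shows "conv (fourier_coeff X A) p j $ a = fc (\<lambda>x. (A x *v vt J p x) $ a) j"
proof -
  have *: "fc (\<lambda>x. A x $ a $ b * tsum {-int J..int J} (\<lambda>k. p k $ b) x) j
     = (\<Sum>k=-int J..int J. fourier_coeff X A (j - k) $ a $ b * p k $ b)" for b
  proof -
    have "(\<lambda>x. A x $ a $ b * tsum {-int J..int J} (\<lambda>k. p k $ b) x)
       = (\<lambda>x. \<Sum>k=-int J..int J. p k $ b * (A x $ a $ b * ex k x))"
      by (simp add: tsum_def sum_distrib_left mult_ac)
    moreover have "fc (\<lambda>x. \<Sum>k=-int J..int J. p k $ b * (A x $ a $ b * ex k x)) j
       = (\<Sum>k=-int J..int J. fc (\<lambda>x. p k $ b * (A x $ a $ b * ex k x)) j)"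
      by (intro fc_sum sqi_cmult sqi_mult_bounded[of _ _ 1] L2_per_sqi A measurable_ex) simp
    ultimately show ?thesis
      by (simp only: fc_cmult fc_mult_ex[of "\<lambda>x. A x $ a $ b"] fourier_coeff_eq_fc) (simp add: mult.commute)
  qed
  have "conv (fourier_coeff X A) p j = (\<Sum>k=-int J..int J. fourier_coeff X A (j - k) *v p k)"
    using p by (intro conv_finite) (auto simp: in_H_def)
  then have "conv (fourier_coeff X A) p j $ a
     = (\<Sum>k=-int J..int J. \<Sum>b\<in>UNIV. fourier_coeff X A (j - k) $ a $ b * p k $ b)"
    by (simp add: matrix_vector_mult_def)
  also have "\<dots> = (\<Sum>b\<in>UNIV. \<Sum>k=-int J..int J. fourier_coeff X A (j - k) $ a $ b * p k $ b)"
    by (rule sum.swap)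
  also have "\<dots> = (\<Sum>b\<in>UNIV. fc (\<lambda>x. A x $ a $ b * tsum {-int J..int J} (\<lambda>k. p k $ b) x) j)"
    by (simp only: *)
  also have "\<dots> = fc (\<lambda>x. \<Sum>b\<in>UNIV. A x $ a $ b * tsum {-int J..int J} (\<lambda>k. p k $ b) x) j"
    by (intro fc_sum[symmetric] sqi_mult_tsum L2_per_sqi A)
  also have "\<dots> = fc (\<lambda>x. (A x *v vt J p x) $ a) j"
    by (simp add: matrix_vector_mult_def vt_def)
  finally show ?thesis .
qed

lemma fc_vt: "in_H J p \<Longrightarrow> fc (\<lambda>x. vt J p x $ a) j = p j $ a"
  unfolding vt_def vec_lambda_beta using fc_tsum[of "{-int J..int J}" "\<lambda>k. p k $ a" j]
  by (auto simp: in_H_def)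

lemma sqi_vt: "sqi (\<lambda>x. vt J p x $ a)"
  unfolding vt_def vec_lambda_beta by (rule sqi_tsum)

lemma norm_vec_power2: "(norm (x :: complex^'n))\<^sup>2 = (\<Sum>a\<in>UNIV. (norm (x $ a))\<^sup>2)"
  by (simp add: norm_vec_def L2_set_def sum_nonneg)

lemma integral_norm_vt:
  assumes "in_H J p"
  shows "integrable M (\<lambda>x. (norm (vt J p x))\<^sup>2)" "(LINT x|M. (norm (vt J p x))\<^sup>2) = X * (l2n p)\<^sup>2"
proof -
  have i: "integrable M (\<lambda>x. (norm (vt J p x $ a))\<^sup>2)" for a using sqi_vt[of J p a] by (simp add: sqi_def)
  show "integrable M (\<lambda>x. (norm (vt J p x))\<^sup>2)" unfolding norm_vec_power2 using i by simp
  have "(LINT x|M. (norm (vt J p x))\<^sup>2) = (\<Sum>a\<in>UNIV. LINT x|M. (norm (vt J p x $ a))\<^sup>2)"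
    unfolding norm_vec_power2 using i by (intro Bochner_Integration.integral_sum)
  also have "\<dots> = (\<Sum>a\<in>UNIV. X * (\<Sum>k=-int J..int J. (norm (p k $ a))\<^sup>2))"
    unfolding vt_def vec_lambda_beta by (simp add: integral_norm_tsum)
  also have "\<dots> = X * (\<Sum>k=-int J..int J. (norm (p k))\<^sup>2)"
    unfolding norm_vec_power2 sum_distrib_left by (rule sum.swap)
  also have "(\<Sum>k=-int J..int J. (norm (p k))\<^sup>2) = (l2n p)\<^sup>2"
  proof -
    have "(l2n p)\<^sup>2 = (\<Sum>\<^sub>\<infinity>k\<in>{-int J..int J}. (norm (p k))\<^sup>2)"
      unfolding l2n_power2 using assms by (intro infsum_cong_neutral) (auto simp: in_H_def)
    then show ?thesis by simp
  qed
  finally show "(LINT x|M. (norm (vt J p x))\<^sup>2) = X * (l2n p)\<^sup>2" .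
qed

text \<open>Up to the factor \<open>X\<close>, pairing \<open>p\<close> with the truncated
  convolution integrates the quadratic form of \<open>A\<close> along \<open>vt J p\<close>; the
  cutoff is invisible because \<open>p\<close> has no frequencies beyond \<open>J\<close>. The
  pointwise bound therefore survives with the same \<open>C\<close> for every \<open>J\<close>, and
  Cauchy-Schwarz turns it into a norm bound.\<close>

lemma toeplitz_coercive:
  fixes A :: "real \<Rightarrow> complex^'n::finite^'n"
  assumes A: "L2_per X A" and p: "in_H J p"
    and coerc: "\<forall>x (v :: complex^'n). Re (\<Sum>i\<in>UNIV. \<Sum>j\<in>UNIV. cnj (v $ i) * A x $ i $ j * v $ j) \<ge> C * (norm v)\<^sup>2"
  shows "C * l2n p \<le> l2n (trunc J (conv (fourier_coeff X A) p))"
proof -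
  let ?K = "{-int J..int J}"
  let ?w = "trunc J (conv (fourier_coeff X A) p)"
  let ?W = "\<lambda>x a. (A x *v vt J p x) $ a"
  have "ip p ?w = (\<Sum>\<^sub>\<infinity>j\<in>?K. \<Sum>a\<in>UNIV. cnj (p j $ a) * ?w j $ a)"
    unfolding ip_def by (intro infsum_cong_neutral) (auto simp: trunc_def)
  also have "\<dots> = (\<Sum>j\<in>?K. \<Sum>a\<in>UNIV. cnj (p j $ a) * fc (\<lambda>x. ?W x a) j)"
    using conv_vt[OF A p] by (auto simp: trunc_def intro!: sum.cong)
  also have "\<dots> = (\<Sum>a\<in>UNIV. \<Sum>j\<in>?K. cnj (p j $ a) * fc (\<lambda>x. ?W x a) j)"
    by (rule sum.swap)
  finally have "of_real X * ip p ?w = (\<Sum>a\<in>UNIV. hip (\<lambda>x. vt J p x $ a) (\<lambda>x. ?W x a))"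
    by (simp only: vt_def vec_lambda_beta hip_tsum_left[OF sqi_matrix_vt[OF A, unfolded vt_def]] sum_distrib_left)
  also have "\<dots> = (LINT x|M. (\<Sum>a\<in>UNIV. cnj (vt J p x $ a) * ?W x a))"
    unfolding hip_def
    by (intro Bochner_Integration.integral_sum[symmetric] hip_integrable sqi_vt sqi_matrix_vt A)
  finally have eq: "of_real X * ip p ?w = (LINT x|M. (\<Sum>a\<in>UNIV. cnj (vt J p x $ a) * ?W x a))" .
  have int: "integrable M (\<lambda>x. \<Sum>a\<in>UNIV. cnj (vt J p x $ a) * ?W x a)"
    by (intro Bochner_Integration.integrable_sum hip_integrable sqi_vt sqi_matrix_vt A)
  have "X * (C * (l2n p)\<^sup>2) = (LINT x|M. C * (norm (vt J p x))\<^sup>2)"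
    using integral_norm_vt[OF p] by simp
  also have "\<dots> \<le> (LINT x|M. Re (\<Sum>a\<in>UNIV. cnj (vt J p x $ a) * ?W x a))"
  proof (rule integral_mono)
    show "integrable M (\<lambda>x. C * (norm (vt J p x))\<^sup>2)" using integral_norm_vt[OF p] by simp
    show "integrable M (\<lambda>x. Re (\<Sum>a\<in>UNIV. cnj (vt J p x $ a) * ?W x a))" using int by (rule integrable_Re)
    fix x
    have "(\<Sum>a\<in>UNIV. cnj (v $ a) * (A x *v v) $ a) = (\<Sum>i\<in>UNIV. \<Sum>j\<in>UNIV. cnj (v $ i) * A x $ i $ j * v $ j)" for v
      by (simp add: matrix_vector_mult_def sum_distrib_left mult.assoc)
    then show "C * (norm (vt J p x))\<^sup>2 \<le> Re (\<Sum>a\<in>UNIV. cnj (vt J p x $ a) * ?W x a)"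
      using coerc by simp
  qed
  also have "\<dots> = Re (of_real X * ip p ?w)" unfolding eq using int by (rule integral_Re)
  finally have "C * (l2n p)\<^sup>2 \<le> Re (ip p ?w)" using X_pos by simp
  also have "\<dots> \<le> l2n p * l2n ?w"
    using complex_Re_le_cmod ip_bound[OF in_H_sqs[OF p] in_H_sqs[OF trunc_in_H]] order_trans by blast
  finally have le: "l2n p * (C * l2n p) \<le> l2n p * l2n ?w" by (simp add: power2_eq_square algebra_simps)
  show ?thesis
  proof (cases "l2n p = 0")
    case False
    then have "0 < l2n p" using l2n_nonneg[of p] by linarith
    then show ?thesis using le by simp
  qed simp
qed

section \<open>Approximation by bounded trigonometric polynomials\<close>

definition tp :: "(real \<Rightarrow> complex) \<Rightarrow> bool" where
  "tp f \<longleftrightarrow> (\<exists>J c. (\<forall>k. int J < \<bar>k\<bar> \<longrightarrow> c k = 0) \<and> f = tsum {-int J..int J} c)"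

lemma tsum_extend: "(\<forall>k. int J < \<bar>k\<bar> \<longrightarrow> c k = 0) \<Longrightarrow> J \<le> J' \<Longrightarrow> tsum {-int J'..int J'} c = tsum {-int J..int J} c"
  unfolding tsum_def by (intro ext sum.mono_neutral_right) auto

lemma tp_ex: "tp (\<lambda>x. c * ex k x)"
  unfolding tp_def
proof (intro exI conjI)
  show "(\<lambda>x. c * ex k x) = tsum {- int (nat \<bar>k\<bar>)..int (nat \<bar>k\<bar>)} (\<lambda>l. if l = k then c else 0)"
  proof
    fix x
    have "tsum {- int (nat \<bar>k\<bar>)..int (nat \<bar>k\<bar>)} (\<lambda>l. if l = k then c else 0) x = (\<Sum>l\<in>{k}. (if l = k then c else 0) * ex l x)"
      unfolding tsum_def by (intro sum.mono_neutral_right) auto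
    then show "c * ex k x = tsum {- int (nat \<bar>k\<bar>)..int (nat \<bar>k\<bar>)} (\<lambda>l. if l = k then c else 0) x" by simp
  qed
qed auto

lemma tp_add: "tp f \<Longrightarrow> tp g \<Longrightarrow> tp (\<lambda>x. f x + g x)"
proof -
  assume "tp f" "tp g"
  then obtain J c K d where f: "\<forall>k. int J < \<bar>k\<bar> \<longrightarrow> c k = 0" "f = tsum {-int J..int J} c"
    and g: "\<forall>k. int K < \<bar>k\<bar> \<longrightarrow> d k = 0" "g = tsum {-int K..int K} d" unfolding tp_def by blast
  let ?L = "max J K"
  have "f = tsum {-int ?L..int ?L} c" "g = tsum {-int ?L..int ?L} d"
    using tsum_extend[OF f(1), of ?L] tsum_extend[OF g(1), of ?L] f(2) g(2) by auto
  then have "(\<lambda>x. f x + g x) = tsum {-int ?L..int ?L} (\<lambda>k. c k + d k)"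
    by (simp add: tsum_def fun_eq_iff sum.distrib ring_distribs)
  then show ?thesis unfolding tp_def using f(1) g(1) by (intro exI[of _ ?L] exI[of _ "\<lambda>k. c k + d k"]) auto
qed

lemma tp_sum: "(\<And>i. i \<in> I \<Longrightarrow> tp (f i)) \<Longrightarrow> tp (\<lambda>x. \<Sum>i\<in>I. f i x)"
  by (induction I rule: infinite_finite_induct) (use tp_ex[of 0 0] tp_add in simp_all)

lemma tp_mult: "tp f \<Longrightarrow> tp g \<Longrightarrow> tp (\<lambda>x. f x * g x)"
proof -
  assume "tp f" "tp g"
  then obtain J c K d where f: "f = tsum {-int J..int J} c" and g: "g = tsum {-int K..int K} d"
    unfolding tp_def by blast
  have "(\<lambda>x. f x * g x) = (\<lambda>x. \<Sum>k=-int J..int J. \<Sum>l=-int K..int K. (c k * d l) * ex (k + l) x)"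
    by (simp add: f g tsum_def sum_product ex_add mult_ac)
  then show ?thesis by (simp only:) (intro tp_sum tp_ex)
qed

lemma tp_const: "tp (\<lambda>x. c)"
  using tp_ex[of c 0] by simp

text \<open>Links Stone-Weierstrass to Fourier sums: its polynomials are in the real coordinates of
  \<open>z\<close>, and on the unit circle conjugation is \<open>ex (-1)\<close>.\<close>

lemma tp_real_polynomial: "real_polynomial_function q \<Longrightarrow> tp (\<lambda>x. of_real (q (ex 1 x)))"
proof (induction rule: real_polynomial_function.induct)
  case (linear h)
  \<comment> \<open>A real-linear functional of a complex variable is a complex combination of
    \<open>z\<close> and \<open>cnj z\<close>.\<close>
  have "complex_of_real (h z) = of_real (h 1 / 2) * (z + cnj z) + (of_real (h \<i>) / (2 * \<i>)) * (z - cnj z)" for z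
  proof -
    have "h z = h (Re z *\<^sub>R 1 + Im z *\<^sub>R \<i>)"
      by (rule arg_cong[of _ _ h]) (simp add: complex_eq_iff)
    then have h: "h z = Re z * h 1 + Im z * h \<i>"
      using linear by (simp add: linear_simps)
    have e: "z + cnj z = of_real (2 * Re z)" "z - cnj z = of_real (2 * Im z) * \<i>"
      by (simp_all add: complex_eq_iff)
    show ?thesis unfolding h e by (simp add: field_simps)
  qed
  note h = this
  have "complex_of_real (h (ex 1 x)) = (of_real (h 1 / 2) * ex 1 x + of_real (h 1 / 2) * ex (-1) x)
       + ((of_real (h \<i>) / (2 * \<i>)) * ex 1 x + (- of_real (h \<i>) / (2 * \<i>)) * ex (-1) x)" for x
    unfolding h[of "ex 1 x"] cnj_ex by (simp add: algebra_simps)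
  then show ?case by (simp only:) (intro tp_add tp_ex)
next
  case (add f g) then show ?case using tp_add[of "\<lambda>x. of_real (f (ex 1 x))"] by simp
next
  case (mult f g) then show ?case using tp_mult[of "\<lambda>x. of_real (f (ex 1 x))"] by simp
qed (rule tp_const)

lemma tp_polynomial: "polynomial_function (q :: complex \<Rightarrow> complex) \<Longrightarrow> tp (\<lambda>x. q (ex 1 x))"
proof -
  assume q: "polynomial_function q"
  have "real_polynomial_function (Re \<circ> q)" "real_polynomial_function (Im \<circ> q)"
    using q bounded_linear_Re bounded_linear_Im unfolding polynomial_function_def by blast+
  then have "tp (\<lambda>x. of_real ((Re \<circ> q) (ex 1 x)) + \<i> * of_real ((Im \<circ> q) (ex 1 x)))"
    by (intro tp_add tp_mult tp_const tp_real_polynomial)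
  moreover have "(\<lambda>x. of_real ((Re \<circ> q) (ex 1 x)) + \<i> * of_real ((Im \<circ> q) (ex 1 x))) = (\<lambda>x. q (ex 1 x))"
    by (simp add: complex_eq[symmetric])
  ultimately show ?thesis by simp
qed

lemma Arg2pi_ex: "0 \<le> x \<Longrightarrow> x < X \<Longrightarrow> X * Arg2pi (ex 1 x) / (2 * pi) = x"
proof -
  assume x: "0 \<le> x" "x < X"
  have "Arg2pi (ex 1 x) = 2 * pi * x / X"
    using x X_pos by (intro Arg2pi_unique[of 1]) (auto simp: ex_def mult_ac divide_less_eq)
  then show ?thesis using X_pos by simp
qed

lemma ex_neq_1: "0 < x \<Longrightarrow> x < X \<Longrightarrow> ex 1 x \<noteq> 1"
proof
  assume x: "0 < x" "x < X" "ex 1 x = 1"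
  then show False using Arg2pi_ex[of x] by (simp add: Arg2pi_of_real[of 1, simplified])
qed

text \<open>The factor \<open>min 1 (n * norm (z - 1))\<close> repairs the jump of the argument at \<open>z = 1\<close>.\<close>

lemma periodic_approximation:
  fixes g :: "real \<Rightarrow> complex"
  assumes g: "continuous_on UNIV g" and B: "0 \<le> B" and e: "0 < e"
  shows "\<exists>P. tp P \<and> (\<forall>x\<in>{0..X}. norm (P x) \<le> B + e)
    \<and> (\<forall>x. 0 < x \<longrightarrow> x < X \<longrightarrow> norm (P x - min 1 (real n * norm (ex 1 x - 1)) *\<^sub>R closest_point (cball 0 B) (g x)) < e)"
proof -
  let ?cl = "closest_point (cball 0 B) :: complex \<Rightarrow> complex"
  \<comment> \<open>\<open>X * Arg2pi z / (2 * pi)\<close> inverts \<open>ex 1\<close> on the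
    half-open period, so \<open>H\<close> is \<open>g\<close> carried to the unit circle. Projection
    onto the ball of radius \<open>B\<close> is continuous and makes the bound independent of
    \<open>g\<close>.\<close>
  define H where "H = (\<lambda>z. min 1 (real n * norm (z - 1)) *\<^sub>R ?cl (g (X * Arg2pi z / (2 * pi))))"
  have clB: "norm (?cl y) \<le> B" for y
    using closest_point_in_set[of "cball 0 B" y] B by (auto simp: dist_norm)
  have clc: "isCont ?cl y" for y
    using continuous_on_closest_point[of "cball (0::complex) B" UNIV] B by (auto simp: continuous_on_eq_continuous_at)
  have HB: "norm (H z) \<le> B" for z
  proof -
    have "norm (H z) \<le> 1 * B"
      unfolding H_def norm_scaleR by (rule mult_mono[OF _ clB]) (auto simp: B)
    then show ?thesis by simp
  qed
  have "continuous_on (sphere 0 1) H"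
  proof (rule continuous_at_imp_continuous_on, rule ballI)
    fix z :: complex assume z: "z \<in> sphere 0 1"
    show "isCont H z"
    proof (cases "z = 1")
      case True
      have "((\<lambda>z::complex. real n * norm (z - 1) * B) \<longlongrightarrow> real n * norm (1 - 1 :: complex) * B) (at 1)"
        by (intro tendsto_intros)
      then have "((\<lambda>z. real n * norm (z - 1 :: complex) * B) \<longlongrightarrow> 0) (at 1)" by simp
      then have "(H \<longlongrightarrow> 0) (at 1)"
      proof (rule Lim_null_comparison[rotated])
        have "norm (H z) \<le> real n * norm (z - 1) * B" for z
          unfolding H_def norm_scaleR by (rule mult_mono[OF _ clB]) auto
        then show "\<forall>\<^sub>F z in at 1. norm (H z) \<le> real n * norm (z - 1) * B" by simp
      qed
      then show ?thesis using True by (simp add: isCont_def H_def)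
    next
      case False
      then have "z \<notin> \<real>\<^sub>\<ge>\<^sub>0" using z by (auto elim!: nonneg_Reals_cases)
      then have "isCont Arg2pi z" by (rule continuous_at_Arg2pi)
      then have "isCont (\<lambda>z. X * Arg2pi z / (2 * pi)) z" by (intro continuous_intros) auto
      moreover have "isCont g y" for y using g by (simp add: continuous_on_eq_continuous_at)
      ultimately have "isCont (\<lambda>z. g (X * Arg2pi z / (2 * pi))) z" by (rule isCont_o2)
      then have "isCont (\<lambda>z. ?cl (g (X * Arg2pi z / (2 * pi)))) z" by (rule isCont_o2[OF _ clc])
      then show ?thesis unfolding H_def by (intro continuous_intros)
    qed
  qed
  then obtain q where q: "polynomial_function q" "\<And>z. z \<in> sphere 0 1 \<Longrightarrow> norm (H z - q z) < e"
    using Stone_Weierstrass_polynomial_function[of "sphere 0 1" H e] e by auto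
  have "norm (q (ex 1 x)) \<le> B + e" for x
    using q(2)[of "ex 1 x"] HB[of "ex 1 x"] norm_triangle_ineq2[of "q (ex 1 x)" "H (ex 1 x)"]
    by (simp add: norm_minus_commute)
  moreover have "norm (q (ex 1 x) - min 1 (real n * norm (ex 1 x - 1)) *\<^sub>R ?cl (g x)) < e" if "0 < x" "x < X" for x
    using q(2)[of "ex 1 x"] Arg2pi_ex[of x] that by (simp add: H_def norm_minus_commute)
  ultimately show ?thesis
    by (intro exI[of _ "\<lambda>x. q (ex 1 x)"] conjI tp_polynomial[OF q(1)] ballI allI impI) auto
qed

text \<open>A uniform bound together with almost everywhere convergence is the form that dominated
  convergence can use after multiplication by an unbounded \<open>A2\<close>. The continuous
  approximants come from measurability, and clipping at \<open>B\<close> does not disturb their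
  limit \<open>f\<close>, whose values already lie in the ball.\<close>

lemma trig_approximation:
  fixes f :: "real \<Rightarrow> complex"
  assumes f: "f \<in> borel_measurable lebesgue" and B: "\<And>x. x \<in> {0..X} \<Longrightarrow> norm (f x) \<le> B"
  shows "\<exists>P. (\<forall>n. tp (P n)) \<and> (\<forall>n. \<forall>x\<in>{0..X}. norm (P n x) \<le> B + 1) \<and> (AE x in M. (\<lambda>n. P n x) \<longlonglongrightarrow> f x)"
proof -
  have B0: "0 \<le> B" using B[of 0] X_pos order_trans[OF norm_ge_zero[of "f 0"]] by simp
  have "f measurable_on {0..X}" using f by (intro lebesgue_measurable_imp_measurable_on) auto
  then obtain N g where N: "negligible N" and g: "\<And>n. continuous_on UNIV (g n)"
    and lim: "\<And>x. x \<notin> N \<Longrightarrow> (\<lambda>n. g n x) \<longlonglongrightarrow> (if x \<in> {0..X} then f x else 0)"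
    unfolding measurable_on_def by blast
  let ?cl = "closest_point (cball 0 B) :: complex \<Rightarrow> complex"
  have "\<exists>P. tp P \<and> (\<forall>x\<in>{0..X}. norm (P x) \<le> B + 1 / real (Suc n))
    \<and> (\<forall>x. 0 < x \<longrightarrow> x < X \<longrightarrow> norm (P x - min 1 (real n * norm (ex 1 x - 1)) *\<^sub>R ?cl (g n x)) < 1 / real (Suc n))" for n
    by (rule periodic_approximation[OF g B0]) simp
  then obtain P where P: "\<And>n. tp (P n)" "\<And>n x. x \<in> {0..X} \<Longrightarrow> norm (P n x) \<le> B + 1 / real (Suc n)"
    "\<And>n x. 0 < x \<Longrightarrow> x < X \<Longrightarrow> norm (P n x - min 1 (real n * norm (ex 1 x - 1)) *\<^sub>R ?cl (g n x)) < 1 / real (Suc n)"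
    by metis
  have conv: "(\<lambda>n. P n x) \<longlonglongrightarrow> f x" if x: "x \<notin> N" "0 < x" "x < X" for x
  proof -
    have "(\<lambda>n. g n x) \<longlonglongrightarrow> f x" using lim[OF x(1)] x by simp
    moreover have "isCont ?cl (f x)"
      using continuous_on_closest_point[of "cball (0::complex) B" UNIV] B0 by (auto simp: continuous_on_eq_continuous_at)
    ultimately have "(\<lambda>n. ?cl (g n x)) \<longlonglongrightarrow> ?cl (f x)" by (rule isCont_tendsto_compose[rotated])
    moreover have "?cl (f x) = f x" using B[of x] x by (intro closest_point_self) auto
    moreover have "(\<lambda>n. min 1 (real n * norm (ex 1 x - 1))) \<longlonglongrightarrow> 1"
    proof (rule tendsto_eventually)
      have d: "0 < norm (ex 1 x - 1)" using ex_neq_1[OF x(2,3)] by simp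
      obtain n0 :: nat where n0: "1 / norm (ex 1 x - 1) < real n0" using reals_Archimedean2 by blast
      have "min 1 (real n * norm (ex 1 x - 1)) = 1" if "n \<ge> n0" for n
      proof -
        have "1 / norm (ex 1 x - 1) < real n" using n0 that by linarith
        then show ?thesis using d by (simp add: field_simps)
      qed
      then show "\<forall>\<^sub>F n in sequentially. min 1 (real n * norm (ex 1 x - 1)) = 1"
        unfolding eventually_sequentially by blast
    qed
    ultimately have main: "(\<lambda>n. min 1 (real n * norm (ex 1 x - 1)) *\<^sub>R ?cl (g n x)) \<longlonglongrightarrow> f x"
      using tendsto_scaleR[of "\<lambda>n. min 1 (real n * norm (ex 1 x - 1))" 1 sequentially "\<lambda>n. ?cl (g n x)" "f x"] by simp
    have "(\<lambda>n. P n x - min 1 (real n * norm (ex 1 x - 1)) *\<^sub>R ?cl (g n x)) \<longlonglongrightarrow> 0"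
      by (rule Lim_null_comparison[OF always_eventually[OF allI[OF less_imp_le[OF P(3)[OF x(2,3)]]]]])
        (rule LIMSEQ_Suc[OF lim_1_over_n])
    from tendsto_add[OF this main] show ?thesis by simp
  qed
  \<comment> \<open>The endpoints go as well: there \<open>ex 1 x = 1\<close> and the damping factor
    vanishes for every \<open>n\<close>.\<close>
  have "AE x in lebesgue. x \<notin> N \<union> {0, X}"
    using N by (intro AE_not_in) (simp add: negligible_iff_null_sets[symmetric])
  then have "AE x in lebesgue. x \<in> {0..X} \<longrightarrow> (\<lambda>n. P n x) \<longlonglongrightarrow> f x"
    by eventually_elim (auto intro!: conv)
  then have "AE x in M. (\<lambda>n. P n x) \<longlonglongrightarrow> f x"
    by (simp add: AE_restrict_space_iff)
  moreover have "norm (P n x) \<le> B + 1" if "x \<in> {0..X}" for n x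
  proof -
    have "1 / real (Suc n) \<le> 1" by simp
    then show ?thesis using P(2)[OF that, of n] by linarith
  qed
  ultimately show ?thesis using P(1) by blast
qed

end

section \<open>Density of the range of the leading coefficient\<close>

locale hill = period X for X :: real +
  fixes C :: real and A0 A1 A2 :: "real \<Rightarrow> complex^'n::finite^'n"
  assumes C_pos: "C > 0"
    and L2_A0: "L2_per X A0" and L2_A1: "L2_per X A1" and L2_A2: "L2_per X A2"
    and coercive: "\<forall>x (v :: complex^'n). Re (\<Sum>i\<in>UNIV. \<Sum>j\<in>UNIV. cnj (v $ i) * A2 x $ i $ j * v $ j) \<ge> C * (norm v)\<^sup>2"
begin

abbreviation Ah0 where "Ah0 \<equiv> fourier_coeff X A0"
abbreviation Ah1 where "Ah1 \<equiv> fourier_coeff X A1"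
abbreviation Ah2 where "Ah2 \<equiv> fourier_coeff X A2"

lemmas sqs_Ah0 = sqs_fourier_coeff[OF L2_A0]
lemmas sqs_Ah1 = sqs_fourier_coeff[OF L2_A1]
lemmas sqs_Ah2 = sqs_fourier_coeff[OF L2_A2]

lemma A2_lower_bound: "C * norm v \<le> norm (A2 x *v v)"
proof -
  have "(\<Sum>i\<in>UNIV. \<Sum>j\<in>UNIV. cnj (v $ i) * A2 x $ i $ j * v $ j) = (\<Sum>a\<in>UNIV. cnj (v $ a) * (A2 x *v v) $ a)"
    by (simp add: matrix_vector_mult_def sum_distrib_left mult.assoc)
  then have "C * (norm v)\<^sup>2 \<le> Re (\<Sum>a\<in>UNIV. cnj (v $ a) * (A2 x *v v) $ a)"
    using spec[OF spec[OF coercive, of x], of v] by simp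
  also have "\<dots> \<le> norm v * norm (A2 x *v v)"
    by (rule order_trans[OF complex_Re_le_cmod norm_cdot_le])
  finally have "norm v * (C * norm v) \<le> norm v * norm (A2 x *v v)" by (simp add: power2_eq_square algebra_simps)
  then show ?thesis by (cases "norm v = 0") auto
qed

lemma det_A2: "det (A2 x) \<noteq> 0"
proof -
  have "v = 0" if "A2 x *v v = 0" for v
  proof -
    have "C * norm v \<le> 0" using A2_lower_bound[of v x] that by simp
    then show ?thesis using C_pos by (simp add: mult_le_0_iff)
  qed
  then have "\<exists>B. B ** A2 x = mat 1" unfolding matrix_left_invertible_ker by blast
  then show ?thesis by (simp add: invertible_left_inverse invertible_det_nz[symmetric])
qed

text \<open>Cramer's rule, written out so that measurability of the solution follows from
  measurability of determinants.\<close>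

definition solve_A2 :: "(real \<Rightarrow> complex^'n) \<Rightarrow> real \<Rightarrow> complex^'n" where
  "solve_A2 w x = (\<chi> k. det (\<chi> i j. if j = k then w x $ i else A2 x $ i $ j) / det (A2 x))"

lemma A2_solve_A2: "A2 x *v solve_A2 w x = w x"
  using cramer[OF det_A2[of x], of "solve_A2 w x" "w x"] by (simp add: solve_A2_def)

lemma measurable_det:
  assumes "\<And>i j. (\<lambda>x. B x i j) \<in> borel_measurable N"
  shows "(\<lambda>x. det (\<chi> i j. B x i j) :: complex) \<in> borel_measurable N"
  unfolding det_def by (intro borel_measurable_sum borel_measurable_times borel_measurable_prod) (auto simp: assms)

lemma measurable_solve_A2:
  assumes "\<And>i. (\<lambda>x. w x $ i) \<in> borel_measurable lebesgue"
  shows "(\<lambda>x. solve_A2 w x $ k) \<in> borel_measurable lebesgue"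
proof -
  have "(\<lambda>x. det (\<chi> i j. if j = k then w x $ i else A2 x $ i $ j)) \<in> borel_measurable lebesgue"
  proof (rule measurable_det)
    fix i j
    show "(\<lambda>x. if j = k then w x $ i else A2 x $ i $ j) \<in> borel_measurable lebesgue"
      using assms[of i] L2_per_component[OF L2_A2, of i j] by (cases "j = k") simp_all
  qed
  moreover have "(\<lambda>x. det (A2 x)) \<in> borel_measurable lebesgue"
    using measurable_det[of "\<lambda>x i j. A2 x $ i $ j", OF L2_per_component[OF L2_A2]] by simp
  ultimately show ?thesis unfolding solve_A2_def vec_lambda_beta by (rule borel_measurable_divide)
qed

lemma vt_of_tp:
  assumes "\<And>a. tp (P a)"
  shows "\<exists>J p. in_H J p \<and> (\<forall>x. vt J p x = (\<chi> a. P a x))"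
proof -
  have "\<forall>a. \<exists>J c. (\<forall>k. int J < \<bar>k\<bar> \<longrightarrow> c k = 0) \<and> P a = tsum {-int J..int J} c"
    using assms unfolding tp_def by blast
  then obtain J c where Jc: "\<And>a. \<forall>k. int (J a) < \<bar>k\<bar> \<longrightarrow> c a k = 0" "\<And>a. P a = tsum {-int (J a)..int (J a)} (c a)"
    by metis
  define K where "K = Max (range J)"
  have K: "J a \<le> K" for a unfolding K_def by (rule Max_ge) auto
  define p where "p = (\<lambda>k. \<chi> a. c a k)"
  have "c a k = 0" if "int K < \<bar>k\<bar>" for a k
  proof -
    have "int (J a) < \<bar>k\<bar>" using that K[of a] by linarith
    then show ?thesis using Jc(1) by blast
  qed
  then have "in_H K p" by (auto simp: in_H_def p_def vec_eq_iff)
  moreover have "vt K p x = (\<chi> a. P a x)" for x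
    unfolding vt_def p_def vec_lambda_beta Jc(2) using tsum_extend[OF Jc(1) K] by simp
  ultimately show ?thesis by blast
qed

text \<open>Bessel, applied to each component of \<open>A2\<close> times \<open>vt J p\<close> minus
  \<open>vt K W\<close>, bounds a distance of sequences by a distance of functions. Square
  summability of \<open>conv Ah2 p\<close> comes along, by adding \<open>W\<close> back.\<close>

lemma conv_A2_minus_bound:
  assumes p: "in_H J p" and W: "in_H K W"
  shows "sqs (conv Ah2 p)"
    "l2n (conv Ah2 p - W) \<le> (\<Sum>a\<in>UNIV. sqrt ((LINT x|M. (norm ((A2 x *v vt J p x) $ a - vt K W x $ a))\<^sup>2) / X))"
proof -
  let ?f = "\<lambda>a x. (A2 x *v vt J p x) $ a - vt K W x $ a"
  have f: "sqi (?f a)" for a by (intro sqi_diff sqi_matrix_vt sqi_vt L2_A2)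
  have "(conv Ah2 p - W) k $ a = fc (?f a) k" for a k
    by (simp add: fseq_apply conv_vt[OF L2_A2 p] fc_diff[OF sqi_matrix_vt[OF L2_A2] sqi_vt] fc_vt[OF W])
  then have eq: "(\<lambda>k. (conv Ah2 p - W) k $ a) = fc (?f a)" for a by auto
  have s: "sqs (\<lambda>k. (conv Ah2 p - W) k $ a)" for a unfolding eq by (rule bessel(1)[OF f])
  show "sqs (conv Ah2 p)"
    using sqs_add[OF sqs_vec(1)[OF s] in_H_sqs[OF W]] by simp
  have "l2n (conv Ah2 p - W) \<le> (\<Sum>a\<in>UNIV. l2n (\<lambda>k. (conv Ah2 p - W) k $ a))" by (rule sqs_vec(2)[OF s])
  also have "\<dots> \<le> (\<Sum>a\<in>UNIV. sqrt ((LINT x|M. (norm (?f a x))\<^sup>2) / X))"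
    unfolding eq by (intro sum_mono bessel(2) f)
  finally show "l2n (conv Ah2 p - W) \<le> (\<Sum>a\<in>UNIV. sqrt ((LINT x|M. (norm (?f a x))\<^sup>2) / X))" .
qed

text \<open>\<open>A2\<close> need not be bounded, but \<open>A2\<inverse>\<close> is: approximating \<open>u = A2\<inverse> w\<close> by uniformly bounded
  trigonometric polynomials, \<open>A2 P\<close> converges to \<open>w\<close> in \<open>L\<^sup>2\<close> by dominated convergence.\<close>

lemma conv_A2_dense_in_H:
  assumes W: "in_H K W" and e: "0 < e"
  shows "\<exists>J p. in_H J p \<and> sqs (conv Ah2 p) \<and> l2n (conv Ah2 p - W) \<le> e"
proof -
  let ?w = "vt K W" and ?u = "solve_A2 (vt K W)"
  define Bw where "Bw = (\<Sum>a\<in>UNIV. \<Sum>k=-int K..int K. norm (W k $ a))"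
  have comp_le: "norm (v $ a) \<le> norm v" for v :: "complex^'n" and a by (rule Finite_Cartesian_Product.norm_nth_le)
  have wB: "norm (?w x) \<le> Bw" for x
  proof -
    have "norm (?w x) \<le> (\<Sum>a\<in>UNIV. norm (?w x $ a))" unfolding norm_vec_def by (rule L2_set_le_sum) simp
    also have "\<dots> \<le> Bw" unfolding Bw_def vt_def vec_lambda_beta by (intro sum_mono tsum_bounded)
    finally show ?thesis .
  qed
  \<comment> \<open>The pointwise lower bound on \<open>A2\<close> bounds the solution even where
    \<open>A2\<close> itself is large.\<close>
  have uB: "norm (?u x) \<le> Bw / C" for x
    using A2_lower_bound[of "?u x" x] wB[of x] C_pos by (simp add: A2_solve_A2 field_simps)
  have "continuous_on UNIV (\<lambda>x. ?w x $ i)" for i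
    unfolding vt_def vec_lambda_beta tsum_def by (intro continuous_intros continuous_ex)
  then have "(\<lambda>x. ?w x $ i) \<in> borel_measurable lebesgue" for i
    by (intro measurable_completion) (simp add: borel_measurable_continuous_onI)
  then have um: "(\<lambda>x. ?u x $ a) \<in> borel_measurable lebesgue" for a by (rule measurable_solve_A2)
  have "\<forall>a. \<exists>P. (\<forall>n. tp (P n)) \<and> (\<forall>n. \<forall>x\<in>{0..X}. norm (P n x) \<le> Bw / C + 1) \<and> (AE x in M. (\<lambda>n. P n x) \<longlonglongrightarrow> ?u x $ a)"
    using order_trans[OF comp_le uB] by (intro allI trig_approximation um)
  from choice[OF this] obtain P where P0: "\<forall>a. (\<forall>n. tp (P a n)) \<and> (\<forall>n. \<forall>x\<in>{0..X}. norm (P a n x) \<le> Bw / C + 1)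
      \<and> (AE x in M. (\<lambda>n. P a n x) \<longlonglongrightarrow> ?u x $ a)" by (elim exE)
  have P: "tp (P a n)" "x \<in> {0..X} \<Longrightarrow> norm (P a n x) \<le> Bw / C + 1"
    "AE x in M. (\<lambda>n. P a n x) \<longlonglongrightarrow> ?u x $ a" for a n x using P0[rule_format, of a] by simp_all
  have "\<forall>n. \<exists>J p. in_H J p \<and> (\<forall>x. vt J p x = (\<chi> a. P a n x))" by (intro allI vt_of_tp P(1))
  from choice[OF this] obtain J where "\<forall>n. \<exists>p. in_H (J n) p \<and> (\<forall>x. vt (J n) p x = (\<chi> a. P a n x))" by (elim exE)
  from choice[OF this] obtain p where p0: "\<forall>n. in_H (J n) (p n) \<and> (\<forall>x. vt (J n) (p n) x = (\<chi> a. P a n x))" by (elim exE)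
  have p: "in_H (J n) (p n)" "vt (J n) (p n) x = (\<chi> a. P a n x)" for n x using p0[rule_format, of n] by simp_all
  define Q where "Q = real CARD('n) * (Bw / C + 1)"
  have Q: "norm (vt (J n) (p n) x) \<le> Q" if "x \<in> {0..X}" for n x
  proof -
    have "norm (vt (J n) (p n) x) \<le> (\<Sum>a\<in>UNIV. norm (P a n x))"
      unfolding p(2) norm_vec_def vec_lambda_beta by (rule L2_set_le_sum) simp
    also have "\<dots> \<le> (\<Sum>a\<in>(UNIV::'n set). Bw / C + 1)" by (intro sum_mono P(2) that)
    finally show ?thesis by (simp add: Q_def)
  qed
  let ?f = "\<lambda>n a x. (A2 x *v vt (J n) (p n) x) $ a - ?w x $ a"
  have lim: "(\<lambda>n. LINT x|M. (norm (?f n a x))\<^sup>2) \<longlonglongrightarrow> (LINT x|M. 0)" for a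
  proof (rule integral_dominated_convergence)
    \<comment> \<open>The majorant expands the square of \<open>norm (A2 x) * Q + Bw\<close>; it is
      integrable because \<open>A2\<close> is square integrable.\<close>
    let ?g = "\<lambda>x. 2 * (Q\<^sup>2 * (norm (A2 x))\<^sup>2) + 2 * Bw\<^sup>2"
    have fi: "sqi (?f n a)" for n by (intro sqi_diff sqi_matrix_vt sqi_vt L2_A2)
    show "(\<lambda>x. (norm (?f n a x))\<^sup>2) \<in> borel_measurable M" for n using sqi_measurable[OF fi[of n]] by simp
    show "integrable M ?g" using L2_per_norm_integrable[OF L2_A2] by simp
    show "AE x in M. norm ((norm (?f n a x))\<^sup>2) \<le> ?g x" for n
    proof (rule AE_I2)
      fix x assume "x \<in> space M"
      then have x: "x \<in> {0..X}" by (simp add: space_restrict_space)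
      have "norm (?f n a x) \<le> norm ((A2 x *v vt (J n) (p n) x) $ a) + norm (?w x $ a)" by (rule norm_triangle_ineq4)
      also have "\<dots> \<le> norm (A2 x) * Q + Bw"
        using order_trans[OF comp_le wB, of x a] order_trans[OF comp_le norm_matrix_vector_le, of "A2 x" "vt (J n) (p n) x" a]
          mult_left_mono[OF Q[OF x, of n] norm_ge_zero[of "A2 x"]] by linarith
      finally have "(norm (?f n a x))\<^sup>2 \<le> (norm (A2 x) * Q + Bw)\<^sup>2" by (rule power_mono) simp
      also have "\<dots> \<le> ?g x"
        using sum_squares_bound[of "norm (A2 x) * Q" Bw] by (simp add: power2_sum power_mult_distrib mult_ac)
      finally show "norm ((norm (?f n a x))\<^sup>2) \<le> ?g x" by simp
    qed
    have "AE x in M. \<forall>b\<in>UNIV. (\<lambda>n. P b n x) \<longlonglongrightarrow> ?u x $ b"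
      by (rule AE_finite_allI) (auto simp: P(3))
    then show "AE x in M. (\<lambda>n. (norm (?f n a x))\<^sup>2) \<longlonglongrightarrow> 0"
    proof eventually_elim
      fix x assume lim: "\<forall>b\<in>UNIV. (\<lambda>n. P b n x) \<longlonglongrightarrow> ?u x $ b"
      have "(\<lambda>n. \<Sum>b\<in>UNIV. A2 x $ a $ b * P b n x) \<longlonglongrightarrow> (\<Sum>b\<in>UNIV. A2 x $ a $ b * ?u x $ b)"
        by (intro tendsto_intros lim[rule_format]) auto
      moreover have "(\<Sum>b\<in>UNIV. A2 x $ a $ b * ?u x $ b) = ?w x $ a"
        using A2_solve_A2[of x ?w] by (simp add: matrix_vector_mult_def vec_eq_iff)
      ultimately have "(\<lambda>n. (A2 x *v vt (J n) (p n) x) $ a) \<longlonglongrightarrow> ?w x $ a"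
        by (simp add: p(2) matrix_vector_mult_def)
      then have "(\<lambda>n. (norm (?f n a x))\<^sup>2) \<longlonglongrightarrow> (norm (?w x $ a - ?w x $ a))\<^sup>2"
        by (intro tendsto_power tendsto_norm tendsto_diff[OF _ tendsto_const])
      then show "(\<lambda>n. (norm (?f n a x))\<^sup>2) \<longlonglongrightarrow> 0" by simp
    qed
  qed simp
  have "(\<lambda>n. \<Sum>a\<in>UNIV. sqrt ((LINT x|M. (norm (?f n a x))\<^sup>2) / X)) \<longlonglongrightarrow> (\<Sum>a\<in>(UNIV::'n set). sqrt ((LINT x|M. 0) / X))"
    using X_pos by (intro tendsto_intros lim) auto
  then have "(\<lambda>n. \<Sum>a\<in>UNIV. sqrt ((LINT x|M. (norm (?f n a x))\<^sup>2) / X)) \<longlonglongrightarrow> 0" by simp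
  from order_tendstoD(2)[OF this e] obtain n where "(\<Sum>a\<in>UNIV. sqrt ((LINT x|M. (norm (?f n a x))\<^sup>2) / X)) < e"
    using eventually_happens'[OF sequentially_bot] by blast
  then have "l2n (conv Ah2 (p n) - W) \<le> e"
    using conv_A2_minus_bound(2)[OF p(1)[of n] W] by linarith
  then show ?thesis using p(1)[of n] conv_A2_minus_bound(1)[OF p(1)[of n] W] by blast
qed

lemma conv_A2_dense:
  assumes W: "sqs W" and e: "0 < e"
  shows "\<exists>J p. in_H J p \<and> sqs (conv Ah2 p) \<and> l2n (conv Ah2 p - W) \<le> e"
proof -
  have lim: "(\<lambda>K. l2n (trunc K W - W)) \<longlonglongrightarrow> 0" by (rule trunc_l2n_tendsto[OF W filterlim_ident])
  from order_tendstoD(2)[OF lim half_gt_zero[OF e]] obtain K where K: "l2n (trunc K W - W) < e / 2"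
    using eventually_happens'[OF sequentially_bot] by blast
  obtain J p where p: "in_H J p" "sqs (conv Ah2 p)" "l2n (conv Ah2 p - trunc K W) \<le> e / 2"
    using conv_A2_dense_in_H[OF trunc_in_H half_gt_zero[OF e]] by blast
  have "l2n (conv Ah2 p - W) \<le> e"
    using l2n_diff_triangle[OF p(2) in_H_sqs[OF trunc_in_H] W, of K W] K p(3) by linarith
  with p show ?thesis by blast
qed

end

section \<open>Collective compactness of the truncations\<close>

context fseq_linear_on begin

text \<open>Injectivity implies surjectivity in finite dimension, read off from the decomposition:
  \<open>N z\<close> is onto each \<open>G \<nu>\<close> with \<open>\<nu> \<noteq> z\<close>, and
  \<open>G z\<close> is trivial.\<close>

lemma surj_of_not_eigenvalue:
  assumes TD: "\<And>U. D U \<Longrightarrow> D (T U)" and F: "finite F" "{U. D U} \<subseteq> fs.span F"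
    and z: "\<not> is_eigenvalue D T z" and W: "D W"
  shows "\<exists>U. D U \<and> N z U = W"
proof -
  have "W \<in> fs.span (\<Union>\<mu>. G \<mu>)" by (rule D_subset_span_G[OF TD F W])
  then show ?thesis
  proof (induction W rule: fs.span_induct_alt)
    case base
    show ?case by (intro exI[of _ 0] conjI D_zero N_zero)
  next
    case (step c v w)
    then obtain \<nu> where \<nu>: "v \<in> G \<nu>" by auto
    have "\<exists>u. D u \<and> N z u = v"
    proof (cases "\<nu> = z")
      case True
      then have "v = 0" using G_nonzero_eigenvalue \<nu> z by auto
      then show ?thesis by (intro exI[of _ 0] conjI D_zero) (simp add: N_zero)
    next
      case False
      then show ?thesis using G_solve[OF \<nu>, of z] G_D by auto
    qed
    then obtain u where u: "D u" "N z u = v" by auto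
    from step obtain u' where u': "D u'" "N z u' = w" by auto
    have "N z (scl c u + u') = scl c v + w" using u u' by (simp add: N_add N_scl D_scl)
    moreover have "D (scl c u + u')" by (intro D_add D_scl u u')
    ultimately show ?case by auto
  qed
qed

end

lemma in_H_finite_dim: "\<exists>F. finite F \<and> {U. in_H J U} \<subseteq> fs.span (F :: 'n::finite fseq set)"
proof -
  define e where "e = (\<lambda>(k, a). (\<lambda>i. if i = k then axis a 1 else 0) :: 'n fseq)"
  let ?I = "{-int J..int J} \<times> (UNIV :: 'n set)"
  have "U \<in> fs.span (e ` ?I)" if U: "in_H J U" for U
  proof -
    have "U = (\<Sum>i\<in>?I. scl (U (fst i) $ snd i) (e i))"
    proof
      fix j
      have "(\<Sum>i\<in>?I. scl (U (fst i) $ snd i) (e i)) j $ b = U j $ b" for b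
      proof -
        have "(\<Sum>i\<in>?I. scl (U (fst i) $ snd i) (e i)) j $ b = (\<Sum>i\<in>?I. if i = (j, b) then U j $ b else 0)"
          unfolding fseq_apply sum_component by (rule sum.cong) (auto simp: e_def axis_def split: if_splits)
        also have "\<dots> = U j $ b" using U by (auto simp: in_H_def)
        finally show ?thesis .
      qed
      then show "U j = (\<Sum>i\<in>?I. scl (U (fst i) $ snd i) (e i)) j" by (simp add: vec_eq_iff)
    qed
    moreover have "(\<Sum>i\<in>?I. scl (U (fst i) $ snd i) (e i)) \<in> fs.span (e ` ?I)"
      by (intro fs.span_sum fs.span_scale fs.span_base) auto
    ultimately show ?thesis by simp
  qed
  then show ?thesis by (intro exI[of _ "e ` ?I"]) auto
qed

text \<open>The majorant for \<open>collective_compactness\<close>; \<open>max 1\<close> covers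
  frequency zero. The integers are covered by two copies of the naturals.\<close>

lemma sqs_inverse_max: "sqs (\<lambda>j::int. 1 / max 1 (real_of_int \<bar>j\<bar>))"
  unfolding sqs_def
proof (rule nonneg_bdd_above_summable_on)
  let ?f = "\<lambda>j::int. (norm (1 / max 1 (real_of_int \<bar>j\<bar>)))\<^sup>2"
  let ?g = "\<lambda>n::nat. (1 / max 1 (real n))\<^sup>2"
  have "summable (\<lambda>n. inverse ((real n)\<^sup>2))" by (rule inverse_power_summable) simp
  then have sm: "summable ?g"
    by (rule summable_comparison_test_ev[rotated])
      (auto intro!: eventually_sequentiallyI[of 1] simp: power_divide divide_simps max_def)
  have "sum ?f F \<le> 2 * suminf ?g" if F: "finite F" for F
  proof -
    have fin: "finite (nat ` F)" "finite ((\<lambda>j. nat (-j)) ` F)" using F by auto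
    have "F \<subseteq> int ` (nat ` F) \<union> (\<lambda>n. - int n) ` ((\<lambda>j. nat (-j)) ` F)"
    proof
      fix j assume "j \<in> F"
      show "j \<in> int ` (nat ` F) \<union> (\<lambda>n. - int n) ` ((\<lambda>j. nat (-j)) ` F)"
      proof (cases "0 \<le> j")
        case True
        then have "j = int (nat j)" by simp
        then show ?thesis using \<open>j \<in> F\<close> by blast
      next
        case False
        then have "j = - int (nat (- j))" by simp
        then show ?thesis using \<open>j \<in> F\<close> by blast
      qed
    qed
    then have "sum ?f F \<le> sum ?f (int ` (nat ` F) \<union> (\<lambda>n. - int n) ` ((\<lambda>j. nat (-j)) ` F))"
      using F by (intro sum_mono2) auto
    also have "\<dots> \<le> sum ?f (int ` (nat ` F)) + sum ?f ((\<lambda>n. - int n) ` ((\<lambda>j. nat (-j)) ` F))"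
      using F by (subst sum.union_inter[symmetric]) (auto intro!: sum_nonneg)
    also have "sum ?f (int ` (nat ` F)) = sum ?g (nat ` F)"
      by (subst sum.reindex) (auto simp: inj_on_def)
    also have "sum ?f ((\<lambda>n. - int n) ` ((\<lambda>j. nat (-j)) ` F)) = sum ?g ((\<lambda>j. nat (-j)) ` F)"
      by (subst sum.reindex) (auto simp: inj_on_def)
    also have "sum ?g (nat ` F) \<le> suminf ?g" by (intro sum_le_suminf sm fin) simp
    also have "sum ?g ((\<lambda>j. nat (-j)) ` F) \<le> suminf ?g" by (intro sum_le_suminf sm fin) simp
    finally show ?thesis by simp
  qed
  then show "bdd_above (sum ?f ` {F. F \<subseteq> UNIV \<and> finite F})"
    by (intro bdd_aboveI2[of _ _ "2 * suminf ?g"]) simp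
qed simp

lemma frequently_subseq:
  assumes "\<And>n0::nat. \<exists>n\<ge>n0. P n"
  shows "\<exists>r :: nat \<Rightarrow> nat. strict_mono r \<and> (\<forall>n. P (r n))"
proof -
  have "infinite {n. P n}" unfolding infinite_nat_iff_unbounded_le using assms by auto
  from infinite_enumerate[OF this] show ?thesis by auto
qed

text \<open>Bolzano-Weierstrass with a diagonal argument over the countably many frequencies: the
  weak compactness used below.\<close>

lemma pointwise_subseq:
  fixes U :: "nat \<Rightarrow> 'n::finite fseq"
  assumes "\<And>s k. norm (U s k) \<le> B"
  shows "\<exists>r V. strict_mono r \<and> (\<forall>k. (\<lambda>s. U (r s) k) \<longlonglongrightarrow> V k)"
proof -
  obtain r where r: "strict_mono r" "\<And>k. k \<in> (UNIV::int set) \<Longrightarrow> \<exists>l. (\<lambda>s. U (r s) k) \<longlonglongrightarrow> l"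
    using function_convergent_subsequence[of "UNIV :: int set" U B] assms by auto
  then have "\<forall>k. \<exists>l. (\<lambda>s. U (r s) k) \<longlonglongrightarrow> l" by simp
  from choice[OF this] r(1) show ?thesis by blast
qed

context hill begin

abbreviation L where "L \<equiv> hill_op X A0 A1 A2"
abbreviation LJ where "LJ \<equiv> hill_trunc X A0 A1 A2"

definition dd :: "int \<Rightarrow> complex" where
  "dd j = 2 * complex_of_real pi * \<i> * of_int j / of_real X"

lemma norm_dd: "norm (dd j) = 2 * pi / X * real_of_int \<bar>j\<bar>"
  using X_pos by (simp add: dd_def norm_mult norm_divide)

lemma hill_op_eq: "L U j = (dd j)\<^sup>2 *s conv Ah2 U j + dd j *s conv Ah1 U j + conv Ah0 U j"
  by (simp add: hill_op_def dd_def Let_def)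

lemma L_add: "sqs U \<Longrightarrow> sqs V \<Longrightarrow> L (U + V) = L U + L V"
  by (rule ext) (simp add: hill_op_eq fseq_apply conv_add sqs_Ah0 sqs_Ah1 sqs_Ah2 vector_add_ldistrib)

lemma L_scl: "L (scl c U) = scl c (L U)"
  by (rule ext) (simp add: hill_op_eq fseq_apply conv_scl vector_add_ldistrib vector_smult_assoc mult.commute)

text \<open>The domain is all of \<open>l2\<close>: each frequency of \<open>L U\<close> is defined
  there by Cauchy-Schwarz. That \<open>L U\<close> is again in \<open>l2\<close> is enforced only by
  the eigenvector equation or by the conditions on iterates.\<close>

lemma L_linear: "fseq_linear_on sqs L"
  by unfold_locales (auto intro: sqs_zero sqs_add sqs_scl L_add L_scl)

lemma LJ_eq: "in_H J U \<Longrightarrow> LJ J U = trunc J (L U)"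
  by (simp add: hill_trunc_def trunc_id)

lemma LJ_in_H: "in_H J (LJ J U)"
  by (simp add: hill_trunc_def trunc_in_H)

lemma LJ_linear: "fseq_linear_on (in_H J) (LJ J)"
  by unfold_locales
    (simp_all add: in_H_zero in_H_add in_H_scl LJ_eq L_add L_scl in_H_sqs trunc_add trunc_scl)

sublocale L: fseq_linear_on sqs L by (rule L_linear)

text \<open>The limit \<open>U'\<close> cannot be compared with \<open>U s\<close> by coercivity
  directly, as it lies in no truncated space. A finitely supported \<open>p\<close> with
  \<open>conv Ah2 p\<close> near \<open>W\<close> serves as intermediary: coercivity bounds
  \<open>U s - p\<close>, and \<open>p\<close> is then close to the limit as well.\<close>

lemma galerkin_convergence:
  assumes r: "filterlim r at_top sequentially" and U: "\<And>s. in_H (r s) (U s)" "\<And>s. l2n (U s) \<le> B"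
    and lim: "\<And>k. (\<lambda>s. U s k) \<longlonglongrightarrow> U' k"
    and W: "sqs W" "(\<lambda>s. l2n (trunc (r s) (conv Ah2 (U s)) - W)) \<longlonglongrightarrow> 0"
  shows "(\<lambda>s. l2n (U s - U')) \<longlonglongrightarrow> 0"
proof (rule LIMSEQ_I)
  fix e :: real assume e: "0 < e"
  have sU: "sqs (U s)" for s by (rule in_H_sqs[OF U(1)])
  have sU': "sqs U'" by (rule sqs_fatou(1)[OF lim, where B=B]) (simp add: sU U(2))
  \<comment> \<open>Two errors of size \<open>\<delta>\<close>, divided by \<open>C\<close>, give
    \<open>e / 4\<close>; this is spent once for \<open>U s\<close> and once for
    \<open>U'\<close>.\<close>
  define \<delta> where "\<delta> = C * e / 8"
  have \<delta>: "0 < \<delta>" using e C_pos by (simp add: \<delta>_def)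
  obtain J p where p: "in_H J p" "sqs (conv Ah2 p)" "l2n (conv Ah2 p - W) \<le> \<delta>"
    using conv_A2_dense[OF W(1) \<delta>] by auto
  have ev: "\<forall>\<^sub>F s in sequentially. J \<le> r s \<and> l2n (trunc (r s) (conv Ah2 (U s)) - W) < \<delta>"
    by (intro eventually_conj filterlim_at_top[THEN iffD1, OF r, rule_format] order_tendstoD(2)[OF W(2) \<delta>])
  have close: "l2n (U s - p) \<le> e / 4" if s: "J \<le> r s" "l2n (trunc (r s) (conv Ah2 (U s)) - W) < \<delta>" for s
  proof -
    let ?Ws = "trunc (r s) (conv Ah2 (U s))"
    have inp: "in_H (r s) p" by (rule in_H_mono[OF p(1) s(1)])
    have H: "in_H (r s) (U s - p)" by (rule in_H_diff[OF U(1) inp])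
    have sWs: "sqs ?Ws" by (rule in_H_sqs[OF trunc_in_H])
    have "C * l2n (U s - p) \<le> l2n (trunc (r s) (conv Ah2 (U s - p)))"
      by (rule toeplitz_coercive[OF L2_A2 H coercive])
    also have "conv Ah2 (U s - p) = conv Ah2 (U s) - conv Ah2 p"
      by (rule ext) (simp add: fseq_apply conv_diff[OF sqs_Ah2 sU in_H_sqs[OF p(1)]])
    also have "trunc (r s) (conv Ah2 (U s) - conv Ah2 p) = trunc (r s) (?Ws - conv Ah2 p)"
      by (simp add: trunc_diff trunc_id[OF trunc_in_H])
    also have "l2n (trunc (r s) (?Ws - conv Ah2 p)) \<le> l2n (?Ws - conv Ah2 p)"
      by (rule l2n_trunc_le[OF sqs_diff[OF sWs p(2)]])
    also have "\<dots> \<le> l2n (?Ws - W) + l2n (W - conv Ah2 p)" by (rule l2n_diff_triangle[OF sWs W(1) p(2)])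
    also have "\<dots> \<le> 2 * \<delta>" using s(2) p(3) by (simp add: l2n_commute[of W])
    finally show ?thesis using C_pos by (simp add: \<delta>_def field_simps)
  qed
  \<comment> \<open>The bound passes to the weak limit by Fatou.\<close>
  have "l2n (U' - p) \<le> e / 4"
  proof (rule sqs_fatou(2))
    show "(\<lambda>s. (U s - p) k) \<longlonglongrightarrow> (U' - p) k" for k unfolding fseq_apply by (intro tendsto_diff lim tendsto_const)
    show "\<forall>\<^sub>F s in sequentially. sqs (U s - p) \<and> l2n (U s - p) \<le> e / 4"
      by (rule eventually_mono[OF ev]) (simp only: close sqs_diff sU in_H_sqs[OF p(1)] simp_thms)
  qed
  then have fin: "l2n (U s - U') < e" if "J \<le> r s" "l2n (trunc (r s) (conv Ah2 (U s)) - W) < \<delta>" for s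
    using close[OF that] l2n_diff_triangle[OF sU[of s] in_H_sqs[OF p(1)] sU'] e by (simp add: l2n_commute[of U'])
  have "\<forall>\<^sub>F s in sequentially. norm (l2n (U s - U') - 0) < e"
    using ev by eventually_elim (simp add: fin)
  then show "\<exists>n. \<forall>s\<ge>n. norm (l2n (U s - U') - 0) < e" unfolding eventually_sequentially .
qed

text \<open>A weak limit exists and solves the limiting equation, since each frequency of
  \<open>L\<close> is weakly continuous. Solving the equation for the leading convolution bounds it
  by a fixed square-summable sequence, so the truncated convolutions converge in norm and
  \<open>galerkin_convergence\<close> applies.\<close>

lemma collective_compactness:
  assumes r: "filterlim r at_top sequentially" and U: "\<And>s. in_H (r s) (U s)" "\<And>s. l2n (U s) \<le> B"
    and F: "\<And>s. LJ (r s) (U s) - scl (z s) (U s) = F s" "\<And>s. l2n (F s) \<le> B" and z: "z \<longlonglongrightarrow> z'"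
  shows "\<exists>\<phi> U' F'. strict_mono \<phi> \<and> (\<forall>k. (\<lambda>s. F (\<phi> s) k) \<longlonglongrightarrow> F' k) \<and> sqs F' \<and> sqs U'
    \<and> (\<lambda>s. l2n (U (\<phi> s) - U')) \<longlonglongrightarrow> 0 \<and> L U' - scl z' U' = F'"
proof -
  have sU: "sqs (U s)" for s by (rule in_H_sqs[OF U(1)])
  have FH: "in_H (r s) (F s)" for s unfolding F(1)[symmetric] by (intro in_H_diff LJ_in_H in_H_scl U)
  have sF: "sqs (F s)" for s by (rule in_H_sqs[OF FH])
  have B0: "0 \<le> B" using U(2)[of 0] l2n_nonneg[of "U 0"] by linarith
  have Ub: "norm (U s k) \<le> B" and Fb: "norm (F s k) \<le> B" for s k
    using norm_le_l2n[OF sU, of s k] norm_le_l2n[OF sF, of s k] U(2)[of s] F(2)[of s] by linarith+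
  obtain r1 U' where r1: "strict_mono r1" "\<forall>k. (\<lambda>s. U (r1 s) k) \<longlonglongrightarrow> U' k"
    using pointwise_subseq[of U B, OF Ub] by auto
  obtain r2 F' where r2: "strict_mono r2" "\<forall>k. (\<lambda>s. F (r1 (r2 s)) k) \<longlonglongrightarrow> F' k"
    using pointwise_subseq[of "\<lambda>s. F (r1 s)" B, OF Fb] by auto
  define \<phi> where "\<phi> = r1 \<circ> r2"
  have \<phi>: "strict_mono \<phi>" unfolding \<phi>_def by (rule strict_mono_o[OF r1(1) r2(1)])
  have limU: "(\<lambda>s. U (\<phi> s) k) \<longlonglongrightarrow> U' k" for k
    using LIMSEQ_subseq_LIMSEQ[OF r1(2)[rule_format, of k] r2(1)] by (simp add: \<phi>_def o_def)
  have limF: "(\<lambda>s. F (\<phi> s) k) \<longlonglongrightarrow> F' k" for k using r2(2) by (simp add: \<phi>_def)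
  have sU': "sqs U'" by (rule sqs_fatou(1)[OF limU, where B=B]) (simp add: sU U(2))
  have sF': "sqs F'" by (rule sqs_fatou(1)[OF limF, where B=B]) (simp add: sF F(2))
  have rphi: "filterlim (\<lambda>s. r (\<phi> s)) at_top sequentially"
    by (rule filterlim_compose[OF r filterlim_subseq[OF \<phi>]])
  have zphi: "(\<lambda>s. z (\<phi> s)) \<longlonglongrightarrow> z'" using LIMSEQ_subseq_LIMSEQ[OF z \<phi>] by (simp add: o_def)
  have cv: "(\<lambda>s. conv Ah (U (\<phi> s)) j) \<longlonglongrightarrow> conv Ah U' j" if "sqs Ah" for Ah :: "int \<Rightarrow> complex^'n^'n" and j
    by (rule conv_weak_continuous[OF that limU sU U(2)])
  have cs: "(\<lambda>s. a s *s x s) \<longlonglongrightarrow> a' *s (x' :: complex^'n)" if "a \<longlonglongrightarrow> a'" "x \<longlonglongrightarrow> x'" for a a' x x'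
    unfolding vector_scalar_mult_def using that by (auto intro!: tendsto_vec_lambda tendsto_mult tendsto_vec_nth)
  have limL: "(\<lambda>s. L (U (\<phi> s)) j) \<longlonglongrightarrow> L U' j" for j
    unfolding hill_op_eq by (intro tendsto_add cs tendsto_const cv sqs_Ah0 sqs_Ah1 sqs_Ah2)
  \<comment> \<open>The truncation spoils the equation beyond \<open>r s\<close>, but every fixed
    frequency is eventually inside.\<close>
  have eq: "L (U s) j - z s *s U s j = F s j" if "\<bar>j\<bar> \<le> int (r s)" for s j
    using fun_cong[OF F(1)[of s], of j] that by (simp add: LJ_eq[OF U(1)] fseq_apply trunc_def)
  have "L U' j - z' *s U' j = F' j" for j
  proof (rule LIMSEQ_unique[OF _ limF])
    have "(\<lambda>s. L (U (\<phi> s)) j - z (\<phi> s) *s U (\<phi> s) j) \<longlonglongrightarrow> L U' j - z' *s U' j"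
      by (intro tendsto_diff limL cs zphi limU)
    moreover have "\<forall>\<^sub>F s in sequentially. L (U (\<phi> s)) j - z (\<phi> s) *s U (\<phi> s) j = F (\<phi> s) j"
    proof -
      have "\<forall>\<^sub>F s in sequentially. nat \<bar>j\<bar> \<le> r (\<phi> s)" using rphi by (simp add: filterlim_at_top)
      then show ?thesis by eventually_elim (simp add: eq)
    qed
    ultimately show "(\<lambda>s. F (\<phi> s) j) \<longlonglongrightarrow> L U' j - z' *s U' j" by (rule Lim_transform_eventually)
  qed
  then have fin: "L U' - scl z' U' = F'" by (auto simp: fun_eq_iff fseq_apply)
  obtain Z where Z: "\<And>s. norm (z s) \<le> Z" using convergent_imp_Bseq[OF convergentI[OF z]] by (auto simp: Bseq_def)
  have Z0: "0 \<le> Z" using Z[of 0] norm_ge_zero[of "z 0"] by linarith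
  define d where "d = 2 * pi / X"
  have d: "0 < d" using X_pos by (simp add: d_def)
  \<comment> \<open>The first two summands bound the leading convolution after division by the
    squared frequency, using that the frequency is at least one; the last covers
    \<open>j = 0\<close>.\<close>
  define K where "K = (B + Z * B + l2n Ah0 * B) / d\<^sup>2 + l2n Ah1 * B / d + l2n Ah2 * B"
  have parts: "0 \<le> (B + Z * B + l2n Ah0 * B) / d\<^sup>2" "0 \<le> l2n Ah1 * B / d" "0 \<le> l2n Ah2 * B"
    using B0 Z0 d by auto
  have cb: "norm (conv Ah (U s) j) \<le> l2n Ah * B" if "sqs Ah" for Ah :: "int \<Rightarrow> complex^'n^'n" and s j
    using conv_bound[OF that sU, of s j] mult_left_mono[OF U(2)[of s] l2n_nonneg[of Ah]] by linarith
  \<comment> \<open>At \<open>j = 0\<close> the symbol \<open>dd j\<close> vanishes and the equation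
    gives nothing, so the convolution bound is used; beyond the cutoff the left side is
    zero.\<close>
  have dom: "norm (trunc (r s) (conv Ah2 (U s)) j) \<le> norm (K * (1 / max 1 (real_of_int \<bar>j\<bar>)))" for s j
  proof (cases "j = 0 \<or> int (r s) < \<bar>j\<bar>")
    case True
    have "norm (trunc (r s) (conv Ah2 (U s)) j) \<le> (if j = 0 then K else 0)"
      using True cb[OF sqs_Ah2, of s j] parts by (auto simp: trunc_def K_def)
    also have "\<dots> \<le> norm (K * (1 / max 1 (real_of_int \<bar>j\<bar>)))" by (simp add: abs_ge_self)
    finally show ?thesis .
  next
    case False
    define m where "m = real_of_int \<bar>j\<bar>"
    have "1 \<le> \<bar>j\<bar>" using False by linarith
    then have m: "1 \<le> m" unfolding m_def by (simp only: of_int_1_le_iff)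
    have nd: "norm (dd j) = d * m" by (simp add: norm_dd d_def m_def)
    let ?w = "conv Ah2 (U s) j"
    have "(dd j)\<^sup>2 *s ?w = F s j + z s *s U s j - dd j *s conv Ah1 (U s) j - conv Ah0 (U s) j"
      using eq[of j s] False unfolding hill_op_eq by (simp add: algebra_simps)
    then have "norm ((dd j)\<^sup>2 *s ?w) \<le> norm (F s j) + norm (z s *s U s j) + norm (dd j *s conv Ah1 (U s) j) + norm (conv Ah0 (U s) j)"
      using norm_triangle_ineq4[of "F s j + z s *s U s j - dd j *s conv Ah1 (U s) j" "conv Ah0 (U s) j"]
        norm_triangle_ineq4[of "F s j + z s *s U s j" "dd j *s conv Ah1 (U s) j"]
        norm_triangle_ineq[of "F s j" "z s *s U s j"] by simp
    also have "\<dots> \<le> B + Z * B + (d * m) * (l2n Ah1 * B) + l2n Ah0 * B"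
      unfolding norm_cmult_vec nd using d m
      by (intro add_mono Fb mult_mono[OF Z Ub Z0] mult_left_mono cb sqs_Ah1 sqs_Ah0) auto
    finally have main: "(d * m)\<^sup>2 * norm ?w \<le> B + Z * B + (d * m) * (l2n Ah1 * B) + l2n Ah0 * B"
      by (simp add: norm_cmult_vec norm_power nd)
    have "norm ?w \<le> (B + Z * B + l2n Ah0 * B) / (d * m)\<^sup>2 + l2n Ah1 * B / (d * m)"
      using main d m by (simp add: field_simps power2_eq_square)
    also have "\<dots> \<le> (B + Z * B + l2n Ah0 * B) / d\<^sup>2 / m + l2n Ah1 * B / d / m"
    proof -
      have "m \<le> m\<^sup>2" using m by (simp add: power2_eq_square)
      then have "(B + Z * B + l2n Ah0 * B) / d\<^sup>2 / m\<^sup>2 \<le> (B + Z * B + l2n Ah0 * B) / d\<^sup>2 / m"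
        using m parts(1) by (intro divide_left_mono) auto
      then show ?thesis by (simp add: power_mult_distrib)
    qed
    also have "\<dots> \<le> K / m" using m parts(3) by (simp add: K_def add_divide_distrib)
    finally have w: "norm ?w \<le> K / m" .
    have "0 \<le> K" unfolding K_def using parts by linarith
    moreover have "max 1 (real_of_int \<bar>j\<bar>) = m" using m unfolding m_def by (rule max_absorb2)
    moreover have "trunc (r s) (conv Ah2 (U s)) j = ?w" using False by (simp add: trunc_def)
    ultimately show ?thesis using w m by (simp only: norm_mult real_norm_def) simp
  qed
  have g: "sqs (\<lambda>j. K * (1 / max 1 (real_of_int \<bar>j\<bar>)))"
    using sqs_inverse_max unfolding sqs_def norm_mult power_mult_distrib by (rule summable_on_cmult_right)
  have Wlim: "(\<lambda>s. trunc (r (\<phi> s)) (conv Ah2 (U (\<phi> s))) k) \<longlonglongrightarrow> conv Ah2 U' k" for k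
  proof (rule Lim_transform_eventually[OF cv[OF sqs_Ah2]])
    have "\<forall>\<^sub>F s in sequentially. nat \<bar>k\<bar> \<le> r (\<phi> s)" using rphi by (simp add: filterlim_at_top)
    then show "\<forall>\<^sub>F s in sequentially. conv Ah2 (U (\<phi> s)) k = trunc (r (\<phi> s)) (conv Ah2 (U (\<phi> s))) k"
      by eventually_elim (simp add: trunc_def)
  qed
  have "(\<lambda>s. l2n (trunc (r (\<phi> s)) (conv Ah2 (U (\<phi> s))) - conv Ah2 U')) \<longlonglongrightarrow> 0"
    by (rule l2n_dominated[OF Wlim g dom])
  moreover have "sqs (conv Ah2 U')"
    \<comment> \<open>For a general \<open>U'\<close> the convolution with \<open>Ah2\<close> may
      leave \<open>l2\<close>; here the majorant, through Fatou, keeps it inside.\<close>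
    by (rule sqs_fatou(1)[OF Wlim always_eventually[OF allI[OF conjI[OF sqs_mono(1)[OF g dom] sqs_mono(2)[OF g dom]]]]])
  ultimately have "(\<lambda>s. l2n (U (\<phi> s) - U')) \<longlonglongrightarrow> 0"
    by (intro galerkin_convergence[OF rphi U(1) U(2) limU])
  with \<phi> limF sF' sU' fin show ?thesis by blast
qed

end

section \<open>Orthonormal flags of generalized eigenvectors\<close>

definition orthonormal :: "nat \<Rightarrow> (nat \<Rightarrow> 'n::finite fseq) \<Rightarrow> bool" where
  "orthonormal d u \<longleftrightarrow> (\<forall>i<d. sqs (u i) \<and> ip (u i) (u i) = 1 \<and> (\<forall>l<i. ip (u l) (u i) = 0))"

lemma orthonormal_ip:
  assumes "orthonormal d u" "i < d" "l < d"
  shows "ip (u i) (u l) = (if i = l then 1 else 0)"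
proof (cases i l rule: linorder_cases)
  case greater
  then show ?thesis using assms ip_cnj[of "u i" "u l"] by (simp add: orthonormal_def)
qed (use assms in \<open>simp_all add: orthonormal_def\<close>)

lemma orthonormal_l2n:
  assumes "orthonormal d u" "i < d"
  shows "l2n (u i) = 1"
proof -
  have "sqs (u i)" "ip (u i) (u i) = 1" using assms by (simp_all add: orthonormal_def)
  then have "complex_of_real ((l2n (u i))\<^sup>2) = of_real 1" using ip_self[of "u i"] by simp
  then have "(l2n (u i))\<^sup>2 = 1" by (simp only: of_real_eq_iff)
  then show ?thesis using l2n_nonneg[of "u i"] by (simp add: power2_eq_1_iff)
qed

lemma orthonormal_mono: "orthonormal d u \<Longrightarrow> k \<le> d \<Longrightarrow> orthonormal k u"
  by (simp add: orthonormal_def)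

lemma orthonormal_expand:
  assumes u: "orthonormal d u" and v: "v \<in> fs.span (u ` {..<d})"
  shows "v = (\<Sum>l<d. scl (ip (u l) v) (u l))" "sqs v"
proof -
  have su: "sqs (u l)" if "l < d" for l using u that by (simp add: orthonormal_def)
  have "sqs v \<and> v = (\<Sum>l<d. scl (ip (u l) v) (u l))"
    using v
  proof (induction v rule: fs.span_induct_alt)
    case base
    show ?case by (simp add: sqs_zero ip_zero_right)
  next
    case (step c x y)
    then obtain i where i: "x = u i" "i < d" by auto
    have sx: "sqs (scl c x)" unfolding i(1) by (rule sqs_scl[OF su[OF i(2)]])
    have sy: "sqs y" using step by simp
    have "(\<Sum>l<d. scl (ip (u l) (scl c x)) (u l)) = (\<Sum>l\<in>{i}. scl c (u l))"
      using i(2) orthonormal_ip[OF u _ i(2)]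
      by (intro sum.mono_neutral_cong_right) (auto simp: ip_scl_right i(1))
    then have "scl c x = (\<Sum>l<d. scl (ip (u l) (scl c x)) (u l))" by (simp add: i(1))
    moreover have "(\<Sum>l<d. scl (ip (u l) (scl c x + y)) (u l))
       = (\<Sum>l<d. scl (ip (u l) (scl c x)) (u l)) + (\<Sum>l<d. scl (ip (u l) y) (u l))"
      unfolding sum.distrib[symmetric]
      by (rule sum.cong) (simp_all add: ip_add_right[OF su sx sy] fs.scale_left_distrib)
    ultimately show ?case using step sqs_add[OF sx sy] by simp
  qed
  then show "v = (\<Sum>l<d. scl (ip (u l) v) (u l))" "sqs v" by simp_all
qed

lemma orthonormal_independent:
  assumes u: "orthonormal d u" and F: "finite F" "\<And>i. i < d \<Longrightarrow> u i \<in> fs.span F"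
  shows "d \<le> card F"
proof (rule ccontr)
  assume "\<not> d \<le> card F"
  then have "card F < card {..<d}" by simp
  then obtain c where c: "\<exists>i\<in>{..<d}. c i \<noteq> 0" "(\<Sum>i<d. scl (c i) (u i)) = 0"
    using family_dependent[OF F(1) finite_lessThan, of d u] F(2) by auto
  then obtain i where i: "i < d" "c i \<noteq> 0" by auto
  have su: "sqs (u l)" if "l < d" for l using u that by (simp add: orthonormal_def)
  have "ip (u i) (\<Sum>l<d. scl (c l) (u l)) = (\<Sum>l<d. ip (u i) (scl (c l) (u l)))"
    by (intro ip_sum_right su i sqs_scl) simp
  also have "\<dots> = (\<Sum>l\<in>{i}. c l)"
    using i(1) orthonormal_ip[OF u i(1)] by (intro sum.mono_neutral_cong_right) (auto simp: ip_scl_right)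
  finally show False using c(2) i(2) by (simp add: ip_zero_right)
qed

locale fseq_linear_l2 = fseq_linear_on D T for D :: "'n::finite fseq \<Rightarrow> bool" and T +
  assumes D_sqs: "D U \<Longrightarrow> sqs U"
begin

text \<open>A partial Schur form: in the basis \<open>u\<close> the operator is upper triangular
  with diagonal entries in \<open>S\<close>. Generalized eigenvectors could become dependent in a
  limit; orthonormal ones cannot.\<close>

definition flag :: "complex set \<Rightarrow> nat \<Rightarrow> (nat \<Rightarrow> 'n fseq) \<Rightarrow> bool" where
  "flag S d u \<longleftrightarrow> orthonormal d u \<and> (\<forall>i<d. D (u i) \<and> (\<exists>\<mu>\<in>S. N \<mu> (u i) \<in> fs.span (u ` {..<i})))"

lemma flag_mono: "flag S d u \<Longrightarrow> k \<le> d \<Longrightarrow> flag S k u"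
  by (auto simp: flag_def intro: orthonormal_mono)

lemma flag_cong:
  assumes "flag S d u" "\<And>i. i < d \<Longrightarrow> u' i = u i"
  shows "flag S d u'"
proof -
  have "u' ` {..<i} = u ` {..<i}" if "i < d" for i using assms(2) that by (intro image_cong) auto
  then show ?thesis using assms by (simp add: flag_def orthonormal_def)
qed

lemma flag_D_span: "flag S d u \<Longrightarrow> v \<in> fs.span (u ` {..<d}) \<Longrightarrow> D v"
  by (rule D_span[of "u ` {..<d}"]) (auto simp: flag_def)

lemma flag_invariant:
  assumes u: "flag S d u" and v: "v \<in> fs.span (u ` {..<d})"
  shows "N z v \<in> fs.span (u ` {..<d})"
proof -
  have "v \<in> fs.span (u ` {..<d}) \<and> N z v \<in> fs.span (u ` {..<d})"
    using v
  proof (induction v rule: fs.span_induct_alt)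
    case base
    show ?case by (simp add: N_zero fs.span_zero)
  next
    case (step c x y)
    then obtain i where i: "x = u i" "i < d" by auto
    then obtain \<mu> where \<mu>: "N \<mu> (u i) \<in> fs.span (u ` {..<i})" using u by (auto simp: flag_def)
    have "fs.span (u ` {..<i}) \<subseteq> fs.span (u ` {..<d})" using i by (intro fs.span_mono image_mono) auto
    then have "N \<mu> x \<in> fs.span (u ` {..<d})" using \<mu> i by auto
    moreover have x: "x \<in> fs.span (u ` {..<d})" using i by (auto intro: fs.span_base)
    ultimately have "N z x \<in> fs.span (u ` {..<d})"
      unfolding N_change[of z x \<mu>] by (intro fs.span_add fs.span_scale)
    moreover have y: "y \<in> fs.span (u ` {..<d})" "N z y \<in> fs.span (u ` {..<d})" using step by simp_all
    moreover have "N z (scl c x + y) = scl c (N z x) + N z y"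
      by (simp only: N_add[OF D_scl[OF flag_D_span[OF u x]] flag_D_span[OF u y(1)]] N_scl[OF flag_D_span[OF u x]])
    ultimately show ?case using x by (simp add: fs.span_add fs.span_scale)
  qed
  then show ?thesis by simp
qed

text \<open>The last iterate of \<open>w\<close> under \<open>N \<mu>\<close> outside the span is
  mapped into it. Gram-Schmidt preserves this because the span is invariant.\<close>

lemma flag_extend:
  assumes u: "flag S d u" and w: "w \<in> G \<mu>" "w \<notin> fs.span (u ` {..<d})" and \<mu>: "\<mu> \<in> S"
  shows "\<exists>x. flag S (Suc d) (u(d := x))"
proof -
  let ?V = "fs.span (u ` {..<d})"
  obtain m where "(N \<mu> ^^ m) w = 0" using w(1) by (auto simp: G_iff)
  then have ex: "(N \<mu> ^^ m) w \<in> ?V" by (simp add: fs.span_zero)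
  define k where "k = (LEAST k. (N \<mu> ^^ k) w \<in> ?V)"
  have k: "(N \<mu> ^^ k) w \<in> ?V" unfolding k_def by (rule LeastI[of _ m], rule ex)
  have "k \<noteq> 0" using k w(2) by (intro notI) simp
  then obtain l where l: "k = Suc l" by (cases k) auto
  define x0 where "x0 = (N \<mu> ^^ l) w"
  have x0: "x0 \<notin> ?V" unfolding x0_def using not_less_Least[of l "\<lambda>k. (N \<mu> ^^ k) w \<in> ?V"] l k_def by simp
  have Nx0: "N \<mu> x0 \<in> ?V" using k l by (simp add: x0_def)
  have Dx0: "D x0" unfolding x0_def by (rule G_D[OF G_N_iter[OF w(1)]])
  define v where "v = (\<Sum>l<d. scl (ip (u l) x0) (u l))"
  have v: "v \<in> ?V" unfolding v_def by (intro fs.span_sum fs.span_scale fs.span_base) auto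
  have Dv: "D v" by (rule flag_D_span[OF u v])
  define x1 where "x1 = x0 - v"
  have Dx1: "D x1" unfolding x1_def by (rule D_diff[OF Dx0 Dv])
  have on: "orthonormal d u" using u by (simp add: flag_def)
  have su: "sqs (u i)" if "i < d" for i using on that by (simp add: orthonormal_def)
  have "x1 \<noteq> 0" using x0 v by (auto simp: x1_def)
  then have n: "l2n x1 \<noteq> 0" using l2n_eq_0[OF D_sqs[OF Dx1]] by auto
  have ip0: "ip (u i) x1 = 0" if i: "i < d" for i
  proof -
    have "ip (u i) v = (\<Sum>l<d. ip (u i) (scl (ip (u l) x0) (u l)))"
      unfolding v_def by (intro ip_sum_right su i sqs_scl) simp
    also have "\<dots> = (\<Sum>l\<in>{i}. ip (u l) x0)"
      using i orthonormal_ip[OF on i] by (intro sum.mono_neutral_cong_right) (auto simp: ip_scl_right)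
    finally show ?thesis
      using ip_diff_right[OF su[OF i] D_sqs[OF Dx0] D_sqs[OF Dv]] by (simp add: x1_def)
  qed
  define x where "x = scl (of_real (1 / l2n x1)) x1"
  have Dx: "D x" unfolding x_def by (rule D_scl[OF Dx1])
  have "l2n x = 1" unfolding x_def l2n_scl using n by (simp add: norm_divide)
  then have "ip x x = 1" by (simp add: ip_self[OF D_sqs[OF Dx]])
  moreover have "ip (u i) x = 0" if "i < d" for i using ip0[OF that] by (simp add: x_def ip_scl_right)
  ultimately have on': "orthonormal (Suc d) (u(d := x))"
    using on D_sqs[OF Dx] by (auto simp: orthonormal_def less_Suc_eq)
  have "N \<mu> x1 \<in> ?V" using Nx0 flag_invariant[OF u v, of \<mu>] by (simp add: x1_def N_diff[OF Dx0 Dv] fs.span_diff)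
  then have Nx: "N \<mu> x \<in> ?V" unfolding x_def N_scl[OF Dx1] by (rule fs.span_scale)
  have im: "(u(d := x)) ` {..<i} = u ` {..<i}" if "i \<le> d" for i using that by (intro image_cong) auto
  have "\<exists>\<mu>\<in>S. N \<mu> ((u(d := x)) i) \<in> fs.span ((u(d := x)) ` {..<i})" if "i < Suc d" for i
  proof (cases "i = d")
    case True
    then show ?thesis using Nx \<mu> im[of d] by auto
  next
    case False
    then show ?thesis using that u im[of i] by (auto simp: flag_def)
  qed
  moreover have "D ((u(d := x)) i)" if "i < Suc d" for i
    using that u Dx by (auto simp: flag_def less_Suc_eq)
  ultimately show ?thesis using on' by (intro exI[of _ x]) (simp add: flag_def)
qed

text \<open>Back substitution in a triangular system whose diagonal entries \<open>\<mu> - z\<close>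
  are nonzero.\<close>

lemma flag_solve:
  assumes u: "flag S d u" and z: "z \<notin> S"
  shows "v \<in> fs.span (u ` {..<d}) \<Longrightarrow> \<exists>y\<in>fs.span (u ` {..<d}). N z y = v"
  using u
proof (induction d arbitrary: v)
  case 0
  then show ?case by (simp add: N_zero)
next
  case (Suc d)
  have ud: "flag S d u" by (rule flag_mono[OF Suc.prems(2)]) simp
  let ?V = "fs.span (u ` {..<d})" and ?W = "fs.span (u ` {..<Suc d})"
  have sub: "x \<in> ?W" if "x \<in> ?V" for x using that fs.span_mono[OF image_mono[of "{..<d}" "{..<Suc d}" u]] by auto
  have ins: "u ` {..<Suc d} = insert (u d) (u ` {..<d})" by (auto simp: less_Suc_eq)
  obtain \<mu> where \<mu>: "\<mu> \<in> S" "N \<mu> (u d) \<in> ?V" and Du: "D (u d)" using Suc.prems(2) by (auto simp: flag_def)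
  obtain y' where y': "y' \<in> ?V" "N z y' = N \<mu> (u d)" using Suc.IH[OF \<mu>(2) ud] by auto
  from Suc.prems(1) obtain c where c: "v - scl c (u d) \<in> ?V" unfolding ins fs.span_insert by auto
  obtain y where y: "y \<in> ?V" "N z y = v - scl c (u d)" using Suc.IH[OF c ud] by auto
  have ne: "\<mu> - z \<noteq> 0" using \<mu>(1) z by auto
  define q where "q = scl (c / (\<mu> - z)) (u d - y') + y"
  have "N z (u d - y') = scl (\<mu> - z) (u d)"
    using N_diff[OF Du flag_D_span[OF ud y'(1)], of z] y'(2) N_change[of z "u d" \<mu>] by simp
  then have "N z q = v"
    unfolding q_def using ne y(2) Du flag_D_span[OF ud y'(1)] flag_D_span[OF ud y(1)]
    by (simp add: N_add N_scl D_scl D_diff)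
  moreover have "q \<in> ?W"
    unfolding q_def by (intro fs.span_add fs.span_scale fs.span_diff sub y y' fs.span_base) auto
  ultimately show ?case by auto
qed

text \<open>Keeps the leading coefficient of the preimage explicit. It gives separation in the Riesz
  argument, and it allows the flag vector to be recovered from its preimage in
  \<open>limit_flag\<close>.\<close>

lemma flag_preimage:
  assumes u: "flag S d u" and z: "z \<notin> S" and i: "i < d"
  shows "\<exists>\<mu>\<in>S. \<exists>v\<in>fs.span (u ` {..<i}). N z (scl (1 / (\<mu> - z)) (u i) + v) = u i"
proof -
  have ui: "flag S i u" by (rule flag_mono[OF u less_imp_le[OF i]])
  obtain \<mu> where \<mu>: "\<mu> \<in> S" "N \<mu> (u i) \<in> fs.span (u ` {..<i})" and Du: "D (u i)" using u i by (auto simp: flag_def)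
  obtain y where y: "y \<in> fs.span (u ` {..<i})" "N z y = N \<mu> (u i)" using flag_solve[OF ui z \<mu>(2)] by auto
  have ne: "\<mu> - z \<noteq> 0" using \<mu>(1) z by auto
  define v where "v = scl (- 1 / (\<mu> - z)) y"
  have v: "v \<in> fs.span (u ` {..<i})" unfolding v_def by (rule fs.span_scale[OF y(1)])
  have "N z (scl (1 / (\<mu> - z)) (u i) + v) = scl (1 / (\<mu> - z)) (N z (u i)) + scl (- 1 / (\<mu> - z)) (N z y)"
    unfolding v_def using Du flag_D_span[OF ui y(1)] by (simp only: N_add N_scl D_scl)
  also have "\<dots> = scl (1 / (\<mu> - z)) (scl (\<mu> - z) (u i))"
    unfolding y(2) N_change[of z "u i" \<mu>] fs.scale_right_distrib by simp
  also have "\<dots> = u i" using ne by simp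
  finally show ?thesis by (intro bexI[OF _ \<mu>(1)] bexI[OF _ v])
qed

text \<open>The vectors of a finite flag never span everything, so extension never stops; dependent
  choice makes the successive flags agree.\<close>

lemma infinite_flag:
  assumes "\<nexists>F. finite F \<and> (\<forall>\<mu>\<in>S. G \<mu> \<subseteq> fs.span F)"
  shows "\<exists>u. \<forall>d. flag S d u"
proof -
  have "\<exists>f. \<forall>n. flag S n (f n) \<and> (\<forall>i<n. f (Suc n) i = f n i)"
  proof (rule dependent_nat_choice)
    show "\<exists>u. flag S 0 u" by (simp add: flag_def orthonormal_def)
    fix u n assume u: "flag S n u"
    have "\<forall>F. \<not> (finite F \<and> (\<forall>\<mu>\<in>S. G \<mu> \<subseteq> fs.span F))" using assms by (simp only: not_ex simp_thms)
    from spec[OF this, of "u ` {..<n}"]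
    obtain \<mu> w where "\<mu> \<in> S" "w \<in> G \<mu>" "w \<notin> fs.span (u ` {..<n})" by auto
    then obtain x where "flag S (Suc n) (u(n := x))" using flag_extend[OF u] by auto
    then show "\<exists>u'. flag S (Suc n) u' \<and> (\<forall>i<n. u' i = u i)" by (intro exI[of _ "u(n := x)"]) simp
  qed
  then obtain f where f0: "\<forall>n. flag S n (f n) \<and> (\<forall>i<n. f (Suc n) i = f n i)" by (elim exE)
  have f: "flag S n (f n)" "i < n \<Longrightarrow> f (Suc n) i = f n i" for n i using spec[OF f0, of n] by simp_all
  have eq: "i < n \<Longrightarrow> f (Suc i) i = f n i" for n i
  proof (induction n)
    case (Suc n)
    show ?case
    proof (cases "i = n")
      case False
      then have "i < n" using Suc.prems by simp
      then show ?thesis by (simp only: Suc.IH f(2))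
    qed simp
  qed simp
  \<comment> \<open>Entry \<open>i\<close> first exists in the flag of length \<open>Suc i\<close>
    and is stable from there on.\<close>
  have "flag S d (\<lambda>i. f (Suc i) i)" for d by (rule flag_cong[OF f(1) eq])
  then show ?thesis by (intro exI allI)
qed

text \<open>As long as the flag is shorter than the joint basis \<open>B\<close>, some vector of
  \<open>B\<close> lies outside its span and extends it.\<close>

lemma flag_of_alg_mult:
  assumes "finite F" "finite \<Lambda>" "\<And>\<mu>. \<mu> \<in> \<Lambda> \<Longrightarrow> G \<mu> \<subseteq> fs.span F" "\<Lambda> \<subseteq> S"
    and "enat d \<le> (\<Sum>\<mu>\<in>\<Lambda>. alg_mult D T \<mu>)"
  shows "\<exists>u. flag S d u"
proof -
  obtain B where B: "finite B" "fs.independent B" "B \<subseteq> (\<Union>\<mu>\<in>\<Lambda>. G \<mu>)" "(\<Sum>\<mu>\<in>\<Lambda>. alg_mult D T \<mu>) = enat (card B)"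
    using sum_alg_mult_eq_card[OF assms(1,2,3)] by auto
  have "k \<le> card B \<Longrightarrow> \<exists>u. flag S k u" for k
  proof (induction k)
    case 0
    show ?case by (simp add: flag_def orthonormal_def)
  next
    case (Suc k)
    then obtain u where u: "flag S k u" by auto
    have "\<not> B \<subseteq> fs.span (u ` {..<k})"
    proof
      assume "B \<subseteq> fs.span (u ` {..<k})"
      then have "card B \<le> card (u ` {..<k})" using fs.independent_span_bound[OF _ B(2)] by simp
      also have "\<dots> \<le> k" using card_image_le[of "{..<k}" u] by simp
      finally show False using Suc.prems by simp
    qed
    then obtain w where w: "w \<in> B" "w \<notin> fs.span (u ` {..<k})" by auto
    then obtain \<mu> where "\<mu> \<in> \<Lambda>" "w \<in> G \<mu>" using B(3) by auto
    then show ?case using flag_extend[OF u _ w(2), of \<mu>] assms(4) by auto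
  qed
  then show ?thesis using assms(5) B(4) by simp
qed

text \<open>If the label \<open>\<mu>\<close> differs from \<open>z\<close>, the equation is solved
  inside \<open>G z\<close>; the difference from \<open>u i\<close> lies in the kernel of
  \<open>N \<mu>\<close>, which is trivial since \<open>\<mu>\<close> is no eigenvalue.\<close>

lemma flag_in_G:
  assumes u: "flag S d u" and S: "\<And>\<mu>. \<mu> \<in> S \<Longrightarrow> is_eigenvalue D T \<mu> \<Longrightarrow> \<mu> = z"
  shows "i < d \<Longrightarrow> u i \<in> G z"
proof (induction i rule: less_induct)
  case (less i)
  obtain \<mu> where \<mu>: "\<mu> \<in> S" "N \<mu> (u i) \<in> fs.span (u ` {..<i})" and Du: "D (u i)" using u less.prems by (auto simp: flag_def)
  have "fs.span (u ` {..<i}) \<subseteq> G z" using less by (intro fs.span_minimal subspace_G) auto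
  then have NG: "N \<mu> (u i) \<in> G z" using \<mu> by auto
  show ?case
  proof (cases "\<mu> = z")
    case True
    then show ?thesis using G_N_converse[OF Du] NG by simp
  next
    case False
    then obtain y where y: "y \<in> G z" "N \<mu> y = N \<mu> (u i)" using G_solve[OF NG] by auto
    have "N \<mu> (u i - y) = 0" using N_diff[OF Du G_D[OF y(1)], of \<mu>] y(2) by simp
    moreover have "\<not> is_eigenvalue D T \<mu>" using S[OF \<mu>(1)] False by auto
    ultimately have "u i - y = 0" unfolding is_eigenvalue_iff using D_diff[OF Du G_D[OF y(1)]] by auto
    then show ?thesis using y(1) by simp
  qed
qed

end

section \<open>Convergence of resolvents\<close>

definition sconv :: "(nat \<Rightarrow> 'n::finite fseq) \<Rightarrow> 'n fseq \<Rightarrow> bool" where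
  "sconv Us U \<longleftrightarrow> (\<forall>s. sqs (Us s)) \<and> sqs U \<and> (\<lambda>s. l2n (Us s - U)) \<longlonglongrightarrow> 0"

lemma sconv_sqs: "sconv Us U \<Longrightarrow> sqs (Us s)" "sconv Us U \<Longrightarrow> sqs U"
  by (simp_all add: sconv_def)

lemma sconv_pointwise: "sconv Us U \<Longrightarrow> (\<lambda>s. Us s k) \<longlonglongrightarrow> U k"
  unfolding sconv_def by (rule l2n_tendsto_imp_pointwise) (simp_all add: sqs_diff)

lemma sconv_norm: "sconv Us U \<Longrightarrow> (\<lambda>s. l2n (Us s)) \<longlonglongrightarrow> l2n U"
  unfolding sconv_def by (rule l2n_tendsto_norm) simp_all

lemma sconv_ip: "sconv Us U \<Longrightarrow> sconv Vs V \<Longrightarrow> (\<lambda>s. ip (Us s) (Vs s)) \<longlonglongrightarrow> ip U V"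
  unfolding sconv_def by (rule ip_tendsto) simp_all

lemma sconv_subseq: "sconv Us U \<Longrightarrow> strict_mono \<phi> \<Longrightarrow> sconv (\<lambda>s. Us (\<phi> s)) U"
  unfolding sconv_def using LIMSEQ_subseq_LIMSEQ[of "\<lambda>s. l2n (Us s - U)" 0 \<phi>] by (simp add: o_def)

lemma sconv_const: "sqs U \<Longrightarrow> sconv (\<lambda>s. U) U"
  by (simp add: sconv_def l2n_zero)

lemma sconv_add:
  assumes "sconv Us U" "sconv Vs V"
  shows "sconv (\<lambda>s. Us s + Vs s) (U + V)"
  unfolding sconv_def
proof (intro conjI allI)
  have le: "norm (l2n (Us s + Vs s - (U + V))) \<le> l2n (Us s - U) + l2n (Vs s - V)" for s
    using l2n_add[OF sqs_diff[OF sconv_sqs[OF assms(1)]] sqs_diff[OF sconv_sqs[OF assms(2)]], of s s]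
    by (simp add: algebra_simps)
  have "(\<lambda>s. l2n (Us s - U) + l2n (Vs s - V)) \<longlonglongrightarrow> 0"
    using assms tendsto_add[of "\<lambda>s. l2n (Us s - U)" 0 sequentially "\<lambda>s. l2n (Vs s - V)" 0] by (simp add: sconv_def)
  then show "(\<lambda>s. l2n (Us s + Vs s - (U + V))) \<longlonglongrightarrow> 0"
    by (rule Lim_null_comparison[OF always_eventually[OF allI[OF le]]])
qed (intro sqs_add sconv_sqs[OF assms(1)] sconv_sqs[OF assms(2)])+

lemma sconv_scl:
  assumes "sconv Us U" "a \<longlonglongrightarrow> a'"
  shows "sconv (\<lambda>s. scl (a s) (Us s)) (scl a' U)"
  unfolding sconv_def
proof (intro conjI allI)
  have le: "norm (l2n (scl (a s) (Us s) - scl a' U)) \<le> norm (a s) * l2n (Us s - U) + norm (a s - a') * l2n U" for s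
  proof -
    have "scl (a s) (Us s) - scl a' U = scl (a s) (Us s - U) + scl (a s - a') U"
      by (simp add: fs.scale_right_diff_distrib fs.scale_left_diff_distrib)
    moreover have "l2n (scl (a s) (Us s - U) + scl (a s - a') U) \<le> l2n (scl (a s) (Us s - U)) + l2n (scl (a s - a') U)"
      by (intro l2n_add sqs_scl sqs_diff sconv_sqs[OF assms(1)])
    ultimately show ?thesis by (simp add: l2n_scl)
  qed
  have l: "(\<lambda>s. l2n (Us s - U)) \<longlonglongrightarrow> 0" using assms(1) by (simp add: sconv_def)
  have "(\<lambda>s. norm (a s) * l2n (Us s - U) + norm (a s - a') * l2n U) \<longlonglongrightarrow> norm a' * 0 + norm (a' - a') * l2n U"
    by (intro tendsto_intros assms(2) l)
  then have "(\<lambda>s. norm (a s) * l2n (Us s - U) + norm (a s - a') * l2n U) \<longlonglongrightarrow> 0" by simp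
  then show "(\<lambda>s. l2n (scl (a s) (Us s) - scl a' U)) \<longlonglongrightarrow> 0"
    by (rule Lim_null_comparison[OF always_eventually[OF allI[OF le]]])
qed (intro sqs_scl sconv_sqs[OF assms(1)])+

lemma sconv_diff: "sconv Us U \<Longrightarrow> sconv Vs V \<Longrightarrow> sconv (\<lambda>s. Us s - Vs s) (U - V)"
  using sconv_add[of Us U "\<lambda>s. scl (-1) (Vs s)" "scl (-1) V"] sconv_scl[of Vs V "\<lambda>s. -1" "-1"] by simp

lemma sconv_sum: "(\<And>i. i \<in> I \<Longrightarrow> sconv (f i) (f' i)) \<Longrightarrow> sconv (\<lambda>s. \<Sum>i\<in>I. f i s) (\<Sum>i\<in>I. f' i)"
  by (induction I rule: infinite_finite_induct) (simp_all add: sconv_const sqs_zero sconv_add)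

context hill begin

sublocale L: fseq_linear_l2 sqs L
  by unfold_locales simp

sublocale LJ: fseq_linear_l2 "in_H J" "LJ J" for J
  using LJ_linear by (intro fseq_linear_l2.intro fseq_linear_l2_axioms.intro) (simp_all add: in_H_sqs)

lemma compactness_shift:
  assumes r: "filterlim r at_top sequentially" and U: "\<And>s. in_H (r s) (U s)" "\<And>s. l2n (U s) \<le> B"
    and F: "\<And>s. l2n (shift_op (LJ (r s)) (z s) (U s)) \<le> B" and z: "z \<longlonglongrightarrow> z'"
  shows "\<exists>\<phi> U'. strict_mono \<phi> \<and> sconv (\<lambda>s. U (\<phi> s)) U' \<and> sqs (shift_op L z' U')
    \<and> (\<forall>k. (\<lambda>s. shift_op (LJ (r (\<phi> s))) (z (\<phi> s)) (U (\<phi> s)) k) \<longlonglongrightarrow> shift_op L z' U' k)"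
proof -
  from collective_compactness[OF r U, of z "\<lambda>s. shift_op (LJ (r s)) (z s) (U s)" z'] F z
  obtain \<phi> U' F' where *: "strict_mono \<phi>" "\<forall>k. (\<lambda>s. shift_op (LJ (r (\<phi> s))) (z (\<phi> s)) (U (\<phi> s)) k) \<longlonglongrightarrow> F' k"
    "sqs F'" "sqs U'" "(\<lambda>s. l2n (U (\<phi> s) - U')) \<longlonglongrightarrow> 0" "L U' - scl z' U' = F'"
    by (auto simp: shift_op_eq)
  have "sconv (\<lambda>s. U (\<phi> s)) U'" using * in_H_sqs[OF U(1)] by (simp add: sconv_def)
  moreover have "shift_op L z' U' = F'" using * by (simp add: shift_op_eq)
  ultimately show ?thesis using * by (intro exI[of _ \<phi>] exI[of _ U']) simp
qed

text \<open>Uniform invertibility by contradiction: normalised near-kernel vectors at points of the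
  compact set \<open>Z\<close> would converge in norm to an eigenvector of \<open>L\<close>.\<close>

lemma uniform_lower_bound:
  assumes Z: "compact Z" "\<And>z. z \<in> Z \<Longrightarrow> \<not> is_eigenvalue sqs L z"
  shows "\<exists>c>0. \<exists>J1. \<forall>J\<ge>J1. \<forall>z\<in>Z. \<forall>U. in_H J U \<longrightarrow> c * l2n U \<le> l2n (shift_op (LJ J) z U)"
proof (rule ccontr)
  assume neg: "\<not> ?thesis"
  have "\<forall>s. \<exists>J z U. s \<le> J \<and> z \<in> Z \<and> in_H J U \<and> l2n (shift_op (LJ J) z U) < 1 / real (Suc s) * l2n U"
  proof
    fix s
    show "\<exists>J z U. s \<le> J \<and> z \<in> Z \<and> in_H J U \<and> l2n (shift_op (LJ J) z U) < 1 / real (Suc s) * l2n U"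
    proof (rule ccontr)
      assume no: "\<not> ?thesis"
      have "1 / real (Suc s) * l2n U \<le> l2n (shift_op (LJ J) z U)" if "s \<le> J" "z \<in> Z" "in_H J U" for J z U
      proof (rule ccontr)
        assume "\<not> ?thesis"
        then have lt: "l2n (shift_op (LJ J) z U) < 1 / real (Suc s) * l2n U" by (simp only: not_le)
        show False by (rule notE[OF no], intro exI conjI) (rule that lt)+
      qed
      then have "\<exists>c>0. \<exists>J1. \<forall>J\<ge>J1. \<forall>z\<in>Z. \<forall>U. in_H J U \<longrightarrow> c * l2n U \<le> l2n (shift_op (LJ J) z U)"
        by (intro exI[of _ "1 / real (Suc s)"] exI[of _ s] conjI allI ballI impI) simp_all
      with neg show False ..
    qed
  qed
  then obtain r z U where U0: "\<forall>s. s \<le> r s \<and> z s \<in> Z \<and> in_H (r s) (U s)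
    \<and> l2n (shift_op (LJ (r s)) (z s) (U s)) < 1 / real (Suc s) * l2n (U s)" unfolding choice_iff by (elim exE)
  have U: "s \<le> r s" "z s \<in> Z" "in_H (r s) (U s)"
    "l2n (shift_op (LJ (r s)) (z s) (U s)) < 1 / real (Suc s) * l2n (U s)" for s
    using spec[OF U0, of s] by simp_all
  have pos: "0 < l2n (U s)" for s
  proof (rule ccontr)
    assume "\<not> 0 < l2n (U s)"
    then have "l2n (U s) = 0" using l2n_nonneg[of "U s"] by linarith
    then show False using U(4)[of s] l2n_nonneg[of "shift_op (LJ (r s)) (z s) (U s)"] by simp
  qed
  define V where "V = (\<lambda>s. scl (of_real (1 / l2n (U s))) (U s))"
  have V: "in_H (r s) (V s)" for s unfolding V_def by (rule in_H_scl[OF U(3)])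
  have V1: "l2n (V s) = 1" for s unfolding V_def l2n_scl using pos[of s] by (simp add: norm_divide)
  have FV: "l2n (shift_op (LJ (r s)) (z s) (V s)) \<le> 1 / real (Suc s)" for s
    unfolding V_def LJ.N_scl[OF U(3)] l2n_scl using pos[of s] U(4)[of s] by (simp add: norm_divide field_simps)
  have FV1: "l2n (shift_op (LJ (r s)) (z s) (V s)) \<le> 1" for s
    by (rule order_trans[OF FV]) simp
  obtain z' \<psi> where \<psi>: "z' \<in> Z" "strict_mono \<psi>" "(z \<circ> \<psi>) \<longlonglongrightarrow> z'"
    by (rule seq_compactE[OF compact_imp_seq_compact[OF Z(1)], of z]) (use U(2) in simp_all)
  have rr: "filterlim r at_top sequentially" by (rule filterlim_at_top_mono[OF filterlim_ident]) (simp add: U(1))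
  have r: "filterlim (\<lambda>s. r (\<psi> s)) at_top sequentially" by (rule filterlim_compose[OF rr filterlim_subseq[OF \<psi>(2)]])
  have "\<exists>\<phi> U'. strict_mono \<phi> \<and> sconv (\<lambda>s. V (\<psi> (\<phi> s))) U' \<and> sqs (shift_op L z' U')
    \<and> (\<forall>k. (\<lambda>s. shift_op (LJ (r (\<psi> (\<phi> s)))) (z (\<psi> (\<phi> s))) (V (\<psi> (\<phi> s))) k) \<longlonglongrightarrow> shift_op L z' U' k)"
  proof (rule compactness_shift[OF r, of "\<lambda>s. V (\<psi> s)" 1 "\<lambda>s. z (\<psi> s)"])
    show "l2n (V (\<psi> s)) \<le> 1" for s by (simp only: V1)
    show "(\<lambda>s. z (\<psi> s)) \<longlonglongrightarrow> z'" using \<psi>(3) by (simp only: o_def)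
  qed (rule V FV1)+
  then obtain \<phi> U' where \<phi>: "strict_mono \<phi>" "sconv (\<lambda>s. V (\<psi> (\<phi> s))) U'"
    "\<And>k. (\<lambda>s. shift_op (LJ (r (\<psi> (\<phi> s)))) (z (\<psi> (\<phi> s))) (V (\<psi> (\<phi> s))) k) \<longlonglongrightarrow> shift_op L z' U' k" by auto
  \<comment> \<open>Convergence is in norm, so no mass escapes and the limit is nonzero.\<close>
  have "l2n U' = 1" using LIMSEQ_unique[OF sconv_norm[OF \<phi>(2)], of 1] by (simp add: V1)
  then have "U' \<noteq> 0" by (auto simp: l2n_zero)
  moreover have "shift_op L z' U' k = 0" for k
  proof (rule LIMSEQ_unique[OF \<phi>(3)])
    have sub: "strict_mono (\<psi> \<circ> \<phi>)" by (rule strict_mono_o[OF \<psi>(2) \<phi>(1)])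
    have bound: "norm (shift_op (LJ (r s)) (z s) (V s) k) \<le> 1 / real (Suc s)" for s
    proof -
      have "in_H (r s) (shift_op (LJ (r s)) (z s) (V s))"
        unfolding shift_op_eq by (intro in_H_diff LJ_in_H in_H_scl V)
      then show ?thesis by (rule order_trans[OF norm_le_l2n[OF in_H_sqs] FV])
    qed
    have "(\<lambda>s. shift_op (LJ (r s)) (z s) (V s) k) \<longlonglongrightarrow> 0"
      by (rule Lim_null_comparison[OF always_eventually[OF allI[OF bound]] LIMSEQ_Suc[OF lim_1_over_n]])
    from LIMSEQ_subseq_LIMSEQ[OF this sub]
    show "(\<lambda>s. shift_op (LJ (r (\<psi> (\<phi> s)))) (z (\<psi> (\<phi> s))) (V (\<psi> (\<phi> s))) k) \<longlonglongrightarrow> 0" by (simp add: o_def)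
  qed
  then have "shift_op L z' U' = 0" by (auto simp: fun_eq_iff fseq_apply)
  ultimately have "is_eigenvalue sqs L z'" unfolding L.is_eigenvalue_iff using sconv_sqs(2)[OF \<phi>(2)] by auto
  then show False using Z(2)[OF \<psi>(1)] by simp
qed

text \<open>Every subsequence has a further one converging to some solution of the limiting
  equation, and that solution is unique because \<open>z'\<close> is no eigenvalue. The parameter
  may vary with \<open>s\<close>, which later yields uniformity on circles.\<close>

lemma resolvent_convergence:
  assumes r: "filterlim r at_top sequentially" and y: "\<And>s. in_H (r s) (y s)"
    and eq: "\<And>s. shift_op (LJ (r s)) (z s) (y s) = trunc (r s) F"
    and c: "0 < c" and lb: "\<And>s. c * l2n (y s) \<le> l2n (shift_op (LJ (r s)) (z s) (y s))"
    and z: "z \<longlonglongrightarrow> z'" "\<not> is_eigenvalue sqs L z'"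
    and F: "sqs F" and y': "sqs y'" "shift_op L z' y' = F"
  shows "sconv y y'"
proof -
  have sy: "sqs (y s)" for s by (rule in_H_sqs[OF y])
  have yb: "l2n (y s) \<le> l2n F / c" for s
    using lb[of s] l2n_trunc_le[OF F, of "r s"] c unfolding eq by (simp add: field_simps)
  define B where "B = max (l2n F / c) (l2n F)"
  have "(\<lambda>s. l2n (y s - y')) \<longlonglongrightarrow> 0"
  proof (rule ccontr)
    assume "\<not> (\<lambda>s. l2n (y s - y')) \<longlonglongrightarrow> 0"
    then obtain e where e: "0 < e" "\<And>n0. \<exists>n\<ge>n0. e \<le> l2n (y n - y')"
      unfolding LIMSEQ_iff by (auto simp: not_less)
    obtain \<psi> :: "nat \<Rightarrow> nat" where \<psi>: "strict_mono \<psi>" "\<forall>n. e \<le> l2n (y (\<psi> n) - y')"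
      using frequently_subseq[OF e(2)] by (elim exE conjE)
    have r\<psi>: "filterlim (\<lambda>s. r (\<psi> s)) at_top sequentially" by (rule filterlim_compose[OF r filterlim_subseq[OF \<psi>(1)]])
    have z\<psi>: "(\<lambda>s. z (\<psi> s)) \<longlonglongrightarrow> z'" using LIMSEQ_subseq_LIMSEQ[OF z(1) \<psi>(1)] by (simp add: o_def)
    have "\<exists>\<phi> U'. strict_mono \<phi> \<and> sconv (\<lambda>s. y (\<psi> (\<phi> s))) U' \<and> sqs (shift_op L z' U')
      \<and> (\<forall>k. (\<lambda>s. shift_op (LJ (r (\<psi> (\<phi> s)))) (z (\<psi> (\<phi> s))) (y (\<psi> (\<phi> s))) k) \<longlonglongrightarrow> shift_op L z' U' k)"
    proof (rule compactness_shift[OF r\<psi>, of "\<lambda>s. y (\<psi> s)" B "\<lambda>s. z (\<psi> s)"])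
      show "in_H (r (\<psi> s)) (y (\<psi> s))" for s by (rule y)
      show "l2n (y (\<psi> s)) \<le> B" for s unfolding B_def using yb[of "\<psi> s"] by simp
      show "l2n (shift_op (LJ (r (\<psi> s))) (z (\<psi> s)) (y (\<psi> s))) \<le> B" for s
        unfolding eq B_def using l2n_trunc_le[OF F, of "r (\<psi> s)"] by simp
    qed (rule z\<psi>)
    then obtain \<phi> U' where \<phi>: "strict_mono \<phi>" "sconv (\<lambda>s. y (\<psi> (\<phi> s))) U'"
      "\<And>k. (\<lambda>s. trunc (r (\<psi> (\<phi> s))) F k) \<longlonglongrightarrow> shift_op L z' U' k" unfolding eq by auto
    have sU: "sqs U'" by (rule sconv_sqs(2)[OF \<phi>(2)])
    have r\<phi>: "filterlim (\<lambda>s. r (\<psi> (\<phi> s))) at_top sequentially"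
      by (rule filterlim_compose[OF r\<psi> filterlim_subseq[OF \<phi>(1)]])
    have "shift_op L z' U' = F" by (rule ext, rule LIMSEQ_unique[OF \<phi>(3) trunc_tendsto[OF r\<phi>]])
    then have "shift_op L z' (U' - y') = 0" using y'(2) by (simp add: L.N_diff[OF sU y'(1)])
    then have "U' - y' = 0" using z(2) L.D_diff[OF sU y'(1)] unfolding L.is_eigenvalue_iff by auto
    then have "(\<lambda>s. l2n (y (\<psi> (\<phi> s)) - y')) \<longlonglongrightarrow> 0" using \<phi>(2) by (simp add: sconv_def)
    from order_tendstoD(2)[OF this e(1)] obtain s where "l2n (y (\<psi> (\<phi> s)) - y') < e"
      using eventually_happens'[OF sequentially_bot] by auto
    then show False using spec[OF \<psi>(2), of "\<phi> s"] by simp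
  qed
  then show ?thesis by (simp add: sconv_def sy y'(1))
qed

lemma LJ_not_eigenvalue:
  assumes c: "0 < c" and lb: "\<And>U. in_H J U \<Longrightarrow> c * l2n U \<le> l2n (shift_op (LJ J) z U)"
  shows "\<not> is_eigenvalue (in_H J) (LJ J) z"
proof
  assume "is_eigenvalue (in_H J) (LJ J) z"
  then obtain U where U: "in_H J U" "U \<noteq> 0" "shift_op (LJ J) z U = 0" unfolding LJ.is_eigenvalue_iff by auto
  have "c * l2n U \<le> 0" using lb[OF U(1)] unfolding U(3) l2n_zero .
  then have "l2n U = 0" using c l2n_nonneg[of U] by (simp add: mult_le_0_iff)
  then show False using U(2) l2n_eq_0[OF in_H_sqs[OF U(1)]] by simp
qed

lemma LJ_solvable:
  assumes c: "0 < c" and lb: "\<And>U. in_H J U \<Longrightarrow> c * l2n U \<le> l2n (shift_op (LJ J) z U)" and W: "in_H J W"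
  shows "\<exists>U. in_H J U \<and> shift_op (LJ J) z U = W"
proof -
  obtain F :: "'n fseq set" where F: "finite F" "{U. in_H J U} \<subseteq> fs.span F" using in_H_finite_dim by auto
  show ?thesis by (rule LJ.surj_of_not_eigenvalue[OF LJ_in_H F LJ_not_eigenvalue[OF c lb] W])
qed

text \<open>The Riesz argument: preimages \<open>y i\<close> of the flag vectors under
  \<open>L - z0\<close> have a component along \<open>u i\<close> that is bounded below, so they
  stay apart. Yet they are approximated by solutions of truncated problems, which have a convergent
  subsequence.\<close>

lemma no_infinite_flag:
  assumes z0: "\<not> is_eigenvalue sqs L z0" and S: "\<And>\<mu>. \<mu> \<in> S \<Longrightarrow> norm \<mu> \<le> R" "z0 \<notin> S"
    and u: "\<And>d. L.flag S d u"
  shows False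
proof -
  obtain c J1 where c: "0 < c" and lb: "\<And>J U. J1 \<le> J \<Longrightarrow> in_H J U \<Longrightarrow> c * l2n U \<le> l2n (shift_op (LJ J) z0 U)"
    using uniform_lower_bound[of "{z0}"] z0 by auto
  have on: "orthonormal d u" for d using u by (simp add: L.flag_def)
  have su: "sqs (u i)" and ipu: "ip (u i) (u l) = (if i = l then 1 else 0)" for i l
    using on[of "Suc (max i l)"] orthonormal_ip[OF on[of "Suc (max i l)"], of i l] by (auto simp: orthonormal_def)
  have nu: "l2n (u i) = 1" for i by (rule orthonormal_l2n[OF on lessI])
  have "\<forall>i. \<exists>\<mu> v. \<mu> \<in> S \<and> v \<in> fs.span (u ` {..<i}) \<and> shift_op L z0 (scl (1 / (\<mu> - z0)) (u i) + v) = u i"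
    using L.flag_preimage[OF u S(2) lessI] by blast
  then obtain \<mu> v where v0: "\<forall>i. \<mu> i \<in> S \<and> v i \<in> fs.span (u ` {..<i})
    \<and> shift_op L z0 (scl (1 / (\<mu> i - z0)) (u i) + v i) = u i" unfolding choice_iff by (elim exE)
  define y where "y = (\<lambda>i. scl (1 / (\<mu> i - z0)) (u i) + v i)"
  have v: "\<mu> i \<in> S" "v i \<in> fs.span (u ` {..<i})" "shift_op L z0 (y i) = u i" for i
    using spec[OF v0, of i] by (simp_all add: y_def)
  have sv: "sqs (v i)" for i by (rule orthonormal_expand(2)[OF on v(2)])
  have sy: "sqs (y i)" for i unfolding y_def by (intro sqs_add sqs_scl su sv)
  have ipv: "ip (u i) (v l) = 0" if "l \<le> i" for i l
  proof -
    have "ip (u i) (v l) = (\<Sum>k<l. ip (u i) (scl (ip (u k) (v l)) (u k)))"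
      by (subst orthonormal_expand(1)[OF on v(2)], rule ip_sum_right) (intro su sqs_scl)+
    also have "\<dots> = 0" using that by (intro sum.neutral) (auto simp: ip_scl_right ipu)
    finally show ?thesis .
  qed
  have ipy: "ip (u i) (y l) = (if i = l then 1 / (\<mu> i - z0) else 0)" if "l \<le> i" for i l
    unfolding y_def ip_add_right[OF su sqs_scl[OF su] sv] ip_scl_right ipu ipv[OF that] by simp
  \<comment> \<open>A lower bound for \<open>1 / norm (\<mu> i - z0)\<close>; the summand
    \<open>1\<close> only keeps the denominator positive.\<close>
  define \<delta> where "\<delta> = 1 / (R + norm z0 + 1)"
  have R: "0 \<le> R" using S(1)[OF v(1)[of 0]] norm_ge_zero[of "\<mu> 0"] by linarith
  have \<delta>: "0 < \<delta>" unfolding \<delta>_def using R by (simp add: add_nonneg_pos)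
  have sep: "\<delta> \<le> l2n (y i - y l)" if "l < i" for i l
  proof -
    have "ip (u i) (y i - y l) = 1 / (\<mu> i - z0)"
      using that by (simp add: ip_diff_right[OF su sy sy] ipy)
    then have "norm (1 / (\<mu> i - z0)) \<le> l2n (y i - y l)"
      using ip_bound[OF su[of i] sqs_diff[OF sy[of i] sy[of l]]] nu[of i] by simp
    moreover have "\<delta> \<le> norm (1 / (\<mu> i - z0))"
    proof -
      have "norm (\<mu> i - z0) \<le> R + norm z0 + 1"
        using norm_triangle_ineq4[of "\<mu> i" z0] S(1)[OF v(1)[of i]] by linarith
      moreover have "0 < norm (\<mu> i - z0)" using v(1)[of i] S(2) by auto
      ultimately show ?thesis unfolding \<delta>_def norm_divide by (simp add: frac_le)
    qed
    ultimately show ?thesis by linarith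
  qed
  \<comment> \<open>Compactness is known for truncations, so each \<open>y i\<close> is replaced by
    a truncated solution at a level \<open>J \<ge> i\<close> with error below
    \<open>1 / real (Suc i)\<close>.\<close>
  have "\<exists>J w. i \<le> J \<and> J1 \<le> J \<and> in_H J w \<and> shift_op (LJ J) z0 w = trunc J (u i) \<and> l2n (w - y i) < 1 / real (Suc i)" for i
  proof -
    have "\<forall>s. \<exists>w. in_H (s + J1) w \<and> shift_op (LJ (s + J1)) z0 w = trunc (s + J1) (u i)"
      by (intro allI LJ_solvable[OF c lb trunc_in_H]) simp_all
    from choice[OF this] obtain w where w0: "\<forall>s. in_H (s + J1) (w s) \<and> shift_op (LJ (s + J1)) z0 (w s) = trunc (s + J1) (u i)"
      by (elim exE)
    have w: "in_H (s + J1) (w s)" "shift_op (LJ (s + J1)) z0 (w s) = trunc (s + J1) (u i)" for s using spec[OF w0, of s] by simp_all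
    have rl: "filterlim (\<lambda>s. s + J1) at_top sequentially" by (rule filterlim_add_const_nat_at_top)
    have "sconv w (y i)"
    proof (rule resolvent_convergence[where r = "\<lambda>s. s + J1" and z = "\<lambda>s. z0" and z' = z0 and F = "u i" and c = c])
      show "c * l2n (w s) \<le> l2n (shift_op (LJ (s + J1)) z0 (w s))" for s by (rule lb[OF _ w(1)]) simp
    qed (simp_all add: rl w c z0 su sy v(3))
    then have "(\<lambda>s. l2n (w s - y i)) \<longlonglongrightarrow> 0" by (simp add: sconv_def)
    from order_tendstoD(2)[OF this, of "1 / real (Suc i)"] have "\<forall>\<^sub>F s in sequentially. i \<le> s \<and> l2n (w s - y i) < 1 / real (Suc i)"
      by (intro eventually_conj eventually_ge_at_top) simp
    then obtain s where "i \<le> s" "l2n (w s - y i) < 1 / real (Suc i)" using eventually_happens'[OF sequentially_bot] by auto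
    then show ?thesis using w[of s] by (intro exI[of _ "s + J1"] exI[of _ "w s"]) simp
  qed
  then have "\<forall>i. \<exists>J w. i \<le> J \<and> J1 \<le> J \<and> in_H J w \<and> shift_op (LJ J) z0 w = trunc J (u i) \<and> l2n (w - y i) < 1 / real (Suc i)" by (rule allI)
  then obtain r w where w0: "\<forall>i. i \<le> r i \<and> J1 \<le> r i \<and> in_H (r i) (w i)
    \<and> shift_op (LJ (r i)) z0 (w i) = trunc (r i) (u i) \<and> l2n (w i - y i) < 1 / real (Suc i)" unfolding choice_iff by (elim exE)
  have w: "i \<le> r i" "J1 \<le> r i" "in_H (r i) (w i)" "shift_op (LJ (r i)) z0 (w i) = trunc (r i) (u i)" "l2n (w i - y i) < 1 / real (Suc i)" for i
    using spec[OF w0, of i] by simp_all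
  have tb: "l2n (trunc (r i) (u i)) \<le> 1" for i using l2n_trunc_le[OF su[of i], of "r i"] by (simp add: nu)
  have rl: "filterlim r at_top sequentially" by (rule filterlim_at_top_mono[OF filterlim_ident]) (simp add: w(1))
  have "\<exists>\<phi> U'. strict_mono \<phi> \<and> sconv (\<lambda>s. w (\<phi> s)) U' \<and> sqs (shift_op L z0 U')
    \<and> (\<forall>k. (\<lambda>s. shift_op (LJ (r (\<phi> s))) z0 (w (\<phi> s)) k) \<longlonglongrightarrow> shift_op L z0 U' k)"
  proof (rule compactness_shift[OF rl, of w "max 1 (1 / c)" "\<lambda>s. z0"])
    show "l2n (w i) \<le> max 1 (1 / c)" for i
    proof -
      have "c * l2n (w i) \<le> 1" using lb[OF w(2) w(3), of i] tb[of i] unfolding w(4) by linarith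
      then have "l2n (w i) \<le> 1 / c" using c by (simp add: field_simps)
      then show ?thesis by simp
    qed
    show "l2n (shift_op (LJ (r i)) z0 (w i)) \<le> max 1 (1 / c)" for i unfolding w(4) using tb[of i] by simp
  qed (simp_all add: w(3))
  then obtain \<phi> U' where \<phi>: "strict_mono \<phi>" "sconv (\<lambda>s. w (\<phi> s)) U'" by auto
  have a: "(\<lambda>s. l2n (w (\<phi> s) - U')) \<longlonglongrightarrow> 0" using \<phi>(2) by (simp add: sconv_def)
  have wy: "(\<lambda>i. l2n (w i - y i)) \<longlonglongrightarrow> 0"
    by (rule Lim_null_comparison[OF _ LIMSEQ_Suc[OF lim_1_over_n]]) (simp add: less_imp_le[OF w(5), simplified])
  have b: "(\<lambda>s. l2n (w (\<phi> s) - y (\<phi> s))) \<longlonglongrightarrow> 0" using LIMSEQ_subseq_LIMSEQ[OF wy \<phi>(1)] by (simp add: o_def)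
  have "(\<lambda>s. l2n (w (\<phi> s) - U') + l2n (w (\<phi> s) - y (\<phi> s))) \<longlonglongrightarrow> 0" using tendsto_add[OF a b] by simp
  from order_tendstoD(2)[OF this, of "\<delta> / 2"] \<delta> obtain n where n: "\<And>s. n \<le> s \<Longrightarrow> l2n (w (\<phi> s) - U') + l2n (w (\<phi> s) - y (\<phi> s)) < \<delta> / 2"
    unfolding eventually_sequentially by auto
  have close: "l2n (y (\<phi> s) - U') < \<delta> / 2" if "n \<le> s" for s
    using n[OF that] l2n_diff_triangle[OF sy[of "\<phi> s"] in_H_sqs[OF w(3)] sconv_sqs(2)[OF \<phi>(2)], of "\<phi> s"]
    by (simp add: l2n_commute[of "y (\<phi> s)" "w (\<phi> s)"])
  have "l2n (y (\<phi> (Suc n)) - y (\<phi> n)) < \<delta>"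
    using close[of n] close[of "Suc n"] l2n_diff_triangle[OF sy[of "\<phi> (Suc n)"] sconv_sqs(2)[OF \<phi>(2)] sy[of "\<phi> n"]]
    by (simp add: l2n_commute[of U'])
  then show False using sep[of "\<phi> n" "\<phi> (Suc n)"] \<phi>(1) by (simp add: strict_mono_def)
qed

section \<open>Limits of flags and spectral projections\<close>

text \<open>Compactness cannot be applied to the flag vectors themselves: the off-diagonal entries
  of the triangular form are not bounded a priori. It is applied to their preimages under
  \<open>LJ - z0\<close>, of norm at most \<open>1 / c\<close>; the flag vector is recovered from
  its preimage and the earlier vectors, so it converges too.\<close>

lemma limit_flag:
  assumes z0: "\<not> is_eigenvalue sqs L z0" and S: "compact S" "z0 \<notin> S"
    and r: "filterlim r at_top sequentially"
    and c: "0 < c" and lb: "\<And>s U. in_H (r s) U \<Longrightarrow> c * l2n U \<le> l2n (shift_op (LJ (r s)) z0 U)"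
    and u: "\<And>s. LJ.flag (r s) S d (u s)"
  shows "\<exists>u'. L.flag S d u'"
proof -
  have "i \<le> d \<Longrightarrow> \<exists>\<phi> u'. strict_mono \<phi> \<and> L.flag S i u' \<and> (\<forall>l<i. sconv (\<lambda>s. u (\<phi> s) l) (u' l))" for i
  proof (induction i)
    case 0
    show ?case by (intro exI[of _ id] exI[of _ "u 0"]) (simp add: L.flag_def orthonormal_def strict_mono_def)
  next
    case (Suc i)
    then obtain \<phi> u' where \<phi>: "strict_mono \<phi>" and fl: "L.flag S i u'"
      and cv: "\<forall>l<i. sconv (\<lambda>s. u (\<phi> s) l) (u' l)" by auto
    have i: "i < d" using Suc.prems by simp
    have on: "orthonormal d (u s)" for s using u[of s] by (simp add: LJ.flag_def)
    have su: "sqs (u s l)" if "l < d" for s l using on[of s] that by (simp add: orthonormal_def)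
    have uH: "in_H (r s) (u s i)" for s using u[of s] i by (simp add: LJ.flag_def)
    have nu: "l2n (u s i) = 1" for s by (rule orthonormal_l2n[OF on i])
    have "\<forall>s. \<exists>\<mu> v. \<mu> \<in> S \<and> v \<in> fs.span (u s ` {..<i}) \<and> shift_op (LJ (r s)) z0 (scl (1 / (\<mu> - z0)) (u s i) + v) = u s i"
      using LJ.flag_preimage[OF u S(2) i] by blast
    then obtain \<mu> v where v0: "\<forall>s. \<mu> s \<in> S \<and> v s \<in> fs.span (u s ` {..<i})
      \<and> shift_op (LJ (r s)) z0 (scl (1 / (\<mu> s - z0)) (u s i) + v s) = u s i" unfolding choice_iff by (elim exE)
    define y where "y = (\<lambda>s. scl (1 / (\<mu> s - z0)) (u s i) + v s)"
    have v: "\<mu> s \<in> S" "v s \<in> fs.span (u s ` {..<i})" "shift_op (LJ (r s)) z0 (y s) = u s i" for s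
      using spec[OF v0, of s] by (simp_all add: y_def)
    have vH: "in_H (r s) (v s)" for s
      by (rule LJ.flag_D_span[OF LJ.flag_mono[OF u less_imp_le[OF i]] v(2)])
    have sv: "sqs (v s)" for s by (rule in_H_sqs[OF vH])
    have yH: "in_H (r s) (y s)" for s unfolding y_def by (intro in_H_add in_H_scl uH vH)
    have yb: "l2n (y s) \<le> 1 / c" for s
      using lb[OF yH[of s]] c unfolding v(3) nu by (simp add: field_simps)
    obtain \<mu>' \<psi>1 where \<psi>1: "\<mu>' \<in> S" "strict_mono \<psi>1" "((\<lambda>s. \<mu> (\<phi> s)) \<circ> \<psi>1) \<longlonglongrightarrow> \<mu>'"
      by (rule seq_compactE[OF compact_imp_seq_compact[OF S(1)], of "\<lambda>s. \<mu> (\<phi> s)"]) (use v(1) in simp_all)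
    define th1 where "th1 = \<phi> \<circ> \<psi>1"
    have th1: "strict_mono th1" unfolding th1_def by (rule strict_mono_o[OF \<phi> \<psi>1(2)])
    have r1: "filterlim (\<lambda>s. r (th1 s)) at_top sequentially" by (rule filterlim_compose[OF r filterlim_subseq[OF th1]])
    have "\<exists>\<phi> U'. strict_mono \<phi> \<and> sconv (\<lambda>s. y (th1 (\<phi> s))) U' \<and> sqs (shift_op L z0 U')
      \<and> (\<forall>k. (\<lambda>s. shift_op (LJ (r (th1 (\<phi> s)))) z0 (y (th1 (\<phi> s))) k) \<longlonglongrightarrow> shift_op L z0 U' k)"
    proof (rule compactness_shift[OF r1, of "\<lambda>s. y (th1 s)" "max 1 (1 / c)" "\<lambda>s. z0"])
      show "l2n (y (th1 s)) \<le> max 1 (1 / c)" for s using yb[of "th1 s"] by simp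
      show "l2n (shift_op (LJ (r (th1 s))) z0 (y (th1 s))) \<le> max 1 (1 / c)" for s unfolding v(3) nu by simp
    qed (rule yH tendsto_const)+
    then obtain \<psi>2 y' where \<psi>2: "strict_mono \<psi>2" "sconv (\<lambda>s. y (th1 (\<psi>2 s))) y'"
      "\<And>k. (\<lambda>s. u (th1 (\<psi>2 s)) i k) \<longlonglongrightarrow> shift_op L z0 y' k" unfolding v(3) by auto
    define th where "th = (\<lambda>s. \<phi> (\<psi>1 (\<psi>2 s)))"
    have \<psi>12: "strict_mono (\<lambda>s. \<psi>1 (\<psi>2 s))" using strict_mono_o[OF \<psi>1(2) \<psi>2(1)] by (simp add: o_def)
    have th: "strict_mono th" using strict_mono_o[OF \<phi> \<psi>12] by (simp add: th_def o_def)
    have th_eq: "th1 (\<psi>2 s) = th s" for s by (simp add: th_def th1_def)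
    have yc: "sconv (\<lambda>s. y (th s)) y'" using \<psi>2(2) by (simp only: th_eq)
    have uc: "sconv (\<lambda>s. u (th s) l) (u' l)" if "l < i" for l
      using sconv_subseq[OF cv[rule_format, OF that] \<psi>12] by (simp only: th_def)
    have mc: "(\<lambda>s. \<mu> (th s)) \<longlonglongrightarrow> \<mu>'"
      using LIMSEQ_subseq_LIMSEQ[OF \<psi>1(3) \<psi>2(1)] by (simp add: o_def th_def)
    have oni: "orthonormal i (u s)" for s by (rule orthonormal_mono[OF on less_imp_le[OF i]])
    \<comment> \<open>As \<open>u s i\<close> is orthogonal to the earlier vectors,
      \<open>v s\<close> is the orthogonal projection of \<open>y s\<close> onto their span; this
      form passes to the limit.\<close>
    have vexp: "v s = (\<Sum>l<i. scl (ip (u s l) (y s)) (u s l))" for s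
    proof -
      have "ip (u s l) (y s) = ip (u s l) (v s)" if "l < i" for l
      proof -
        have l: "l < d" using that i by simp
        show ?thesis unfolding y_def ip_add_right[OF su[OF l] sqs_scl[OF su[OF i]] sv] ip_scl_right
          using orthonormal_ip[OF on l i, of s] that by simp
      qed
      then have "(\<Sum>l<i. scl (ip (u s l) (y s)) (u s l)) = (\<Sum>l<i. scl (ip (u s l) (v s)) (u s l))"
        by (intro sum.cong) simp_all
      then show ?thesis using orthonormal_expand(1)[OF oni v(2)] by simp
    qed
    define v' where "v' = (\<Sum>l<i. scl (ip (u' l) y') (u' l))"
    have "sconv (\<lambda>s. \<Sum>l<i. scl (ip (u (th s) l) (y (th s))) (u (th s) l)) v'"
      unfolding v'_def by (intro sconv_sum sconv_scl uc sconv_ip yc) simp_all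
    then have vc: "sconv (\<lambda>s. v (th s)) v'" by (simp only: vexp[symmetric])
    define x where "x = scl (\<mu>' - z0) (y' - v')"
    have ueq: "u s i = scl (\<mu> s - z0) (y s - v s)" for s
    proof -
      have "\<mu> s - z0 \<noteq> 0" using v(1)[of s] S(2) by auto
      then show ?thesis by (simp add: y_def)
    qed
    have "sconv (\<lambda>s. scl (\<mu> (th s) - z0) (y (th s) - v (th s))) x"
      unfolding x_def by (intro sconv_scl sconv_diff yc vc tendsto_diff mc tendsto_const)
    then have xc: "sconv (\<lambda>s. u (th s) i) x" by (simp only: ueq[symmetric])
    have sx: "sqs x" by (rule sconv_sqs(2)[OF xc])
    have y'x: "shift_op L z0 y' = x"
      by (rule ext, rule LIMSEQ_unique[OF \<psi>2(3)]) (simp only: th_eq, rule sconv_pointwise[OF xc])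
    have v'V: "v' \<in> fs.span (u' ` {..<i})" unfolding v'_def by (intro fs.span_sum fs.span_scale fs.span_base) auto
    have sv': "sqs v'" by (rule sconv_sqs(2)[OF vc])
    have sy': "sqs y'" by (rule sconv_sqs(2)[OF yc])
    have "shift_op L z0 x = scl (\<mu>' - z0) (x - shift_op L z0 v')"
      unfolding x_def L.N_scl[OF sqs_diff[OF sy' sv']] L.N_diff[OF sy' sv'] y'x[unfolded x_def] ..
    \<comment> \<open>The two multiples of \<open>x\<close> cancel, leaving an image of
      \<open>v'\<close>, which stays in the invariant span of the limit flag.\<close>
    then have "shift_op L \<mu>' x = scl (- (\<mu>' - z0)) (shift_op L z0 v')"
      using L.N_change[of \<mu>' x z0] by (simp add: fs.scale_right_diff_distrib fs.scale_left_diff_distrib)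
    then have Nx: "shift_op L \<mu>' x \<in> fs.span (u' ` {..<i})"
      using fs.span_scale[OF L.flag_invariant[OF fl v'V]] by simp
    have "ip x x = 1"
      using LIMSEQ_unique[OF sconv_ip[OF xc xc], of 1] orthonormal_ip[OF on i i] by simp
    moreover have "ip (u' l) x = 0" if "l < i" for l
    proof -
      have "l < d" using that i by simp
      then show ?thesis using LIMSEQ_unique[OF sconv_ip[OF uc[OF that] xc], of 0] orthonormal_ip[OF on \<open>l < d\<close> i] that by simp
    qed
    moreover have onu': "orthonormal i u'" using fl by (simp add: L.flag_def)
    ultimately have on': "orthonormal (Suc i) (u'(i := x))"
      using sx by (auto simp: orthonormal_def less_Suc_eq)
    have im: "(u'(i := x)) ` {..<l} = u' ` {..<l}" if "l \<le> i" for l using that by (intro image_cong) auto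
    have "sqs ((u'(i := x)) l) \<and> (\<exists>\<mu>\<in>S. shift_op L \<mu> ((u'(i := x)) l) \<in> fs.span ((u'(i := x)) ` {..<l}))" if "l < Suc i" for l
    proof (cases "l = i")
      case True
      then show ?thesis using Nx \<psi>1(1) im[of i] sx by auto
    next
      case False
      then have "l < i" using that by simp
      then show ?thesis using fl im[of l] by (simp add: L.flag_def)
    qed
    then have "L.flag S (Suc i) (u'(i := x))" using on' by (simp add: L.flag_def)
    moreover have "sconv (\<lambda>s. u (th s) l) ((u'(i := x)) l)" if "l < Suc i" for l
      using that uc xc by (cases "l = i") simp_all
    ultimately show ?case using th by (intro exI conjI allI impI)
  qed
  from this[of d] show ?thesis by auto
qed

end

section \<open>Contour integrals of resolvents\<close>

lemma has_contour_integral_inverse_power: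
  assumes e: "0 < e" and \<nu>: "cmod (\<nu> - c) \<noteq> e"
  shows "((\<lambda>z. 1 / (z - \<nu>) ^ Suc k) has_contour_integral
    (if k = 0 \<and> cmod (\<nu> - c) < e then 2 * of_real pi * \<i> else 0)) (circlepath c e)"
proof (cases "cmod (\<nu> - c) < e")
  case True
  have "((\<lambda>u. 1 / (u - \<nu>) ^ Suc k) has_contour_integral (2 * of_real pi * \<i>) / fact k * (deriv ^^ k) (\<lambda>z. 1) \<nu>) (circlepath c e)"
    using Cauchy_has_contour_integral_higher_derivative_circlepath[of c e "\<lambda>z. 1" \<nu> k] True
    by (simp add: dist_norm norm_minus_commute)
  then show ?thesis using True by (cases k) (simp_all add: higher_deriv_const)
next
  case False
  then have lt: "e < cmod (\<nu> - c)" using \<nu> by simp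
  have "((\<lambda>z. 1 / (z - \<nu>) ^ Suc k) has_contour_integral 0) (circlepath c e)"
  \<comment> \<open>The disc about \<open>c\<close> that reaches up to the pole contains the circle
    and misses the pole.\<close>
  proof (rule Cauchy_theorem_disc_simple[of _ c "cmod (\<nu> - c)"])
    show "(\<lambda>z. 1 / (z - \<nu>) ^ Suc k) holomorphic_on ball c (cmod (\<nu> - c))"
      by (intro holomorphic_intros) (auto simp: dist_norm norm_minus_commute)
    show "path_image (circlepath c e) \<subseteq> ball c (cmod (\<nu> - c))"
      using lt e by (auto simp: dist_norm norm_minus_commute sphere_def)
  qed auto
  then show ?thesis using False by simp
qed

context fseq_linear_on begin

lemma res_contour_integral:
  assumes w: "w \<in> G \<nu>" "(N \<nu> ^^ m) w = 0" and e: "0 < e" "cmod (\<nu> - c) \<noteq> e"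
  shows "((\<lambda>z. res \<nu> m z w k $ a) has_contour_integral
    2 * of_real pi * \<i> * (if cmod (\<nu> - c) < e then w else 0) k $ a) (circlepath c e)"
proof (cases "m = 0")
  case True
  then have "w = 0" using w(2) by simp
  then show ?thesis using True by (simp add: res_def fseq_apply has_contour_integral_0)
next
  case False
  have "((\<lambda>z. \<Sum>i<m. (N \<nu> ^^ i) w k $ a * (1 / (z - \<nu>) ^ Suc i)) has_contour_integral
    (\<Sum>i<m. (N \<nu> ^^ i) w k $ a * (if i = 0 \<and> cmod (\<nu> - c) < e then 2 * of_real pi * \<i> else 0))) (circlepath c e)"
    by (intro has_contour_integral_sum has_contour_integral_lmul has_contour_integral_inverse_power e finite_lessThan)
  also have "(\<Sum>i<m. (N \<nu> ^^ i) w k $ a * (if i = 0 \<and> cmod (\<nu> - c) < e then 2 * of_real pi * \<i> else 0))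
    = (\<Sum>i<m. if i = 0 then w k $ a * (if cmod (\<nu> - c) < e then 2 * of_real pi * \<i> else 0) else 0)"
    by (intro sum.cong) simp_all
  also have "\<dots> = w k $ a * (if cmod (\<nu> - c) < e then 2 * of_real pi * \<i> else 0)"
    using False by simp
  also have "\<dots> = 2 * of_real pi * \<i> * (if cmod (\<nu> - c) < e then w else 0) k $ a" by (simp add: fseq_apply)
  also have "(\<lambda>z. \<Sum>i<m. (N \<nu> ^^ i) w k $ a * (1 / (z - \<nu>) ^ Suc i)) = (\<lambda>z. res \<nu> m z w k $ a)"
    by (simp add: res_def fseq_apply fun_eq_iff sum_component)
  finally show ?thesis .
qed

text \<open>In finite dimensions the resolvent is a sum of principal parts, so its contour integral
  is (up to the factor \<open>2 * pi * \<i>\<close>) the spectral projection \<open>q\<close>.\<close>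

lemma contour_projection:
  assumes e: "0 < e" and free: "\<And>z. cmod (z - c) = e \<Longrightarrow> \<not> is_eigenvalue D T z"
    and u: "u \<in> fs.span (\<Union>\<mu>. G \<mu>)"
  shows "\<exists>q h. q \<in> fs.span (\<Union>\<mu>\<in>{\<mu>. cmod (\<mu> - c) < e}. G \<mu>)
    \<and> (\<forall>z. cmod (z - c) = e \<longrightarrow> D (h z) \<and> N z (h z) = - u)
    \<and> (\<forall>k a. ((\<lambda>z. h z k $ a) has_contour_integral 2 * of_real pi * \<i> * q k $ a) (circlepath c e))"
  using u
proof (induction u rule: fs.span_induct_alt)
  case base
  show ?case
  proof (intro exI conjI allI impI)
    show "0 \<in> fs.span (\<Union>\<mu>\<in>{\<mu>. cmod (\<mu> - c) < e}. G \<mu>)" by (rule fs.span_zero)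
    show "D ((\<lambda>z. 0) z)" for z :: complex by (rule D_zero)
    show "N z ((\<lambda>z. 0) z) = - 0" for z :: complex unfolding neg_0_equal_iff_equal by (simp only: N_zero minus_zero)
    show "((\<lambda>z. (\<lambda>z::complex. 0 :: 'n fseq) z k $ a) has_contour_integral 2 * of_real pi * \<i> * (0 :: 'n fseq) k $ a) (circlepath c e)" for k a
      by (simp add: fseq_apply has_contour_integral_0)
  qed
next
  case (step b w y)
  then obtain \<nu> where w: "w \<in> G \<nu>" by auto
  from step(2) obtain q h where qh: "q \<in> fs.span (\<Union>\<mu>\<in>{\<mu>. cmod (\<mu> - c) < e}. G \<mu>)"
    "\<forall>z. cmod (z - c) = e \<longrightarrow> D (h z) \<and> N z (h z) = - y"
    "\<forall>k a. ((\<lambda>z. h z k $ a) has_contour_integral 2 * of_real pi * \<i> * q k $ a) (circlepath c e)"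
    by (elim exE conjE)
  show ?case
  \<comment> \<open>A zero vector belongs to \<open>G \<nu>\<close> even for \<open>\<nu>\<close> on
    the circle; a nonzero one makes \<open>\<nu>\<close> an eigenvalue, hence off the
    circle.\<close>
  proof (cases "w = 0")
    case True
    then show ?thesis using qh by (intro exI[of _ q] exI[of _ h]) simp
  next
    case False
    then have ne: "cmod (\<nu> - c) \<noteq> e" using G_nonzero_eigenvalue[OF w] free by auto
    obtain m where m: "(N \<nu> ^^ m) w = 0" using w by (auto simp: G_iff)
    define q' where "q' = (if cmod (\<nu> - c) < e then w else 0)"
    have q': "q' \<in> fs.span (\<Union>\<mu>\<in>{\<mu>. cmod (\<mu> - c) < e}. G \<mu>)"
      using w by (auto simp: q'_def fs.span_zero intro: fs.span_base)
    have h': "D (res \<nu> m z w) \<and> N z (res \<nu> m z w) = - w" if "cmod (z - c) = e" for z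
      using N_res_eq[OF w _ m, of z] G_D[OF res_in_G[OF w]] that ne by auto
    have int: "((\<lambda>z. res \<nu> m z w k $ a) has_contour_integral 2 * of_real pi * \<i> * q' k $ a) (circlepath c e)" for k a
      unfolding q'_def by (rule res_contour_integral[OF w m e ne])
    let ?h = "\<lambda>z. scl b (res \<nu> m z w) + h z"
    have "scl b q' + q \<in> fs.span (\<Union>\<mu>\<in>{\<mu>. cmod (\<mu> - c) < e}. G \<mu>)" by (intro fs.span_add fs.span_scale q' qh(1))
    moreover have "D (?h z) \<and> N z (?h z) = - (scl b w + y)" if "cmod (z - c) = e" for z
    proof -
      have 1: "D (res \<nu> m z w)" "N z (res \<nu> m z w) = - w" using h'[OF that] by simp_all
      have 2: "D (h z)" "N z (h z) = - y" using qh(2) that by simp_all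
      show ?thesis using D_add[OF D_scl[OF 1(1)] 2(1)]
        by (simp add: N_add[OF D_scl[OF 1(1)] 2(1)] N_scl[OF 1(1)] 1(2) 2(2))
    qed
    moreover have "((\<lambda>z. ?h z k $ a) has_contour_integral 2 * of_real pi * \<i> * (scl b q' + q) k $ a) (circlepath c e)" for k a
    proof -
      have "((\<lambda>z. b * res \<nu> m z w k $ a + h z k $ a) has_contour_integral
        b * (2 * of_real pi * \<i> * q' k $ a) + 2 * of_real pi * \<i> * q k $ a) (circlepath c e)"
        by (intro has_contour_integral_add has_contour_integral_lmul int) (rule qh(3)[rule_format])
      then show ?thesis by (simp add: fseq_apply algebra_simps)
    qed
    ultimately show ?thesis by (intro exI[of _ "scl b q' + q"] exI[of _ ?h]) simp
  qed
qed

end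

section \<open>Convergence of the spectrum\<close>

context hill begin

text \<open>On the circle the integrand \<open>h s\<close> converges to the explicit Neumann sum
  \<open>g\<close>, whose integral gives \<open>u\<close>. Uniformity in \<open>z\<close> is
  obtained by contradiction: bad points on the circle subconverge, and resolvent convergence
  tolerates a moving parameter.\<close>

lemma projection_convergence:
  assumes e: "0 < e" and free: "\<And>z. cmod (z - ls) = e \<Longrightarrow> \<not> is_eigenvalue sqs L z"
    and u: "u \<in> L.G ls" and r: "filterlim r at_top sequentially" and c: "0 < c"
    and lb: "\<And>s z U. cmod (z - ls) = e \<Longrightarrow> in_H (r s) U \<Longrightarrow> c * l2n U \<le> l2n (shift_op (LJ (r s)) z U)"
    and int: "\<And>s k a. ((\<lambda>z. h s z k $ a) has_contour_integral 2 * of_real pi * \<i> * q s k $ a) (circlepath ls e)"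
    and h: "\<And>s z. cmod (z - ls) = e \<Longrightarrow> in_H (r s) (h s z)"
      "\<And>s z. cmod (z - ls) = e \<Longrightarrow> shift_op (LJ (r s)) z (h s z) = - trunc (r s) u"
  shows "(\<lambda>s. q s k $ a) \<longlonglongrightarrow> u k $ a"
proof -
  obtain m where m: "(shift_op L ls ^^ m) u = 0" using u by (auto simp: L.G_iff)
  have su: "sqs u" by (rule L.G_D[OF u])
  define g where "g = (\<lambda>z. L.res ls m z u)"
  have g: "sqs (g z)" "shift_op L z (g z) = - u" if "cmod (z - ls) = e" for z
    using that e L.N_res_eq[OF u _ m, of z] L.G_D[OF L.res_in_G[OF u]] by (auto simp: g_def)
  have gint: "((\<lambda>z. g z k $ a) has_contour_integral 2 * of_real pi * \<i> * u k $ a) (circlepath ls e)"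
    using L.res_contour_integral[OF u m e, of ls k a] e by (simp add: g_def)
  have gcont: "continuous_on (sphere ls e) (\<lambda>z. g z k $ a)"
  proof -
    have "(\<lambda>z. g z k $ a) = (\<lambda>z. \<Sum>i<m. (1 / (z - ls) ^ Suc i) * (shift_op L ls ^^ i) u k $ a)"
      by (simp add: g_def L.res_def fseq_apply fun_eq_iff sum_component)
    moreover have "continuous_on (sphere ls e) (\<lambda>z. \<Sum>i<m. (1 / (z - ls) ^ Suc i) * (shift_op L ls ^^ i) u k $ a)"
      using e by (intro continuous_intros) auto
    ultimately show ?thesis by (simp only:)
  qed
  have unif: "\<exists>n. \<forall>s\<ge>n. \<forall>z. cmod (z - ls) = e \<longrightarrow> norm (h s z k $ a - g z k $ a) < \<eta>" if \<eta>: "0 < \<eta>" for \<eta>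
  proof (rule ccontr)
    assume "\<not> ?thesis"
    then have "\<exists>s\<ge>n. \<exists>z. cmod (z - ls) = e \<and> \<eta> \<le> norm (h s z k $ a - g z k $ a)" for n
      by (simp add: not_less) 
    from frequently_subseq[OF this] obtain \<psi> :: "nat \<Rightarrow> nat" where \<psi>: "strict_mono \<psi>"
      "\<forall>s. \<exists>z. cmod (z - ls) = e \<and> \<eta> \<le> norm (h (\<psi> s) z k $ a - g z k $ a)" by (elim exE conjE)
    from choice[OF \<psi>(2)] obtain z where z0: "\<forall>s. cmod (z s - ls) = e \<and> \<eta> \<le> norm (h (\<psi> s) (z s) k $ a - g (z s) k $ a)" by (elim exE)
    have z: "cmod (z s - ls) = e" "\<eta> \<le> norm (h (\<psi> s) (z s) k $ a - g (z s) k $ a)" for s using spec[OF z0, of s] by simp_all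
    have zs: "z s \<in> sphere ls e" for s using z(1)[of s] by (simp add: dist_norm norm_minus_commute)
    obtain z' \<theta> where \<theta>: "z' \<in> sphere ls e" "strict_mono \<theta>" "(z \<circ> \<theta>) \<longlonglongrightarrow> z'"
      by (rule seq_compactE[OF compact_imp_seq_compact[OF compact_sphere], of z ls e]) (use zs in simp_all)
    have z': "cmod (z' - ls) = e" using \<theta>(1) by (simp add: dist_norm norm_minus_commute)
    have sub: "strict_mono (\<lambda>s. \<psi> (\<theta> s))" using strict_mono_o[OF \<psi>(1) \<theta>(2)] by (simp add: o_def)
    have r\<theta>: "filterlim (\<lambda>s. r (\<psi> (\<theta> s))) at_top sequentially" by (rule filterlim_compose[OF r filterlim_subseq[OF sub]])
    have zlim: "(\<lambda>s. z (\<theta> s)) \<longlonglongrightarrow> z'" using \<theta>(3) by (simp add: o_def)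
    have "sconv (\<lambda>s. h (\<psi> (\<theta> s)) (z (\<theta> s))) (g z')"
    proof (rule resolvent_convergence[OF r\<theta> _ _ c _ zlim free[OF z'], of "\<lambda>s. h (\<psi> (\<theta> s)) (z (\<theta> s))" "- u"])
      show "shift_op (LJ (r (\<psi> (\<theta> s)))) (z (\<theta> s)) (h (\<psi> (\<theta> s)) (z (\<theta> s))) = trunc (r (\<psi> (\<theta> s))) (- u)" for s
        unfolding h(2)[OF z(1)] using trunc_scl[of _ "-1" u] by simp
      show "sqs (- u)" using sqs_scl[OF su, of "-1"] by simp
      show "in_H (r (\<psi> (\<theta> s))) (h (\<psi> (\<theta> s)) (z (\<theta> s)))" for s by (rule h(1)[OF z(1)])
      show "c * l2n (h (\<psi> (\<theta> s)) (z (\<theta> s))) \<le> l2n (shift_op (LJ (r (\<psi> (\<theta> s)))) (z (\<theta> s)) (h (\<psi> (\<theta> s)) (z (\<theta> s))))" for s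
        by (rule lb[OF z(1) h(1)[OF z(1)]])
    qed (rule g[OF z'])+
    then have "(\<lambda>s. h (\<psi> (\<theta> s)) (z (\<theta> s)) k $ a) \<longlonglongrightarrow> g z' k $ a"
      by (intro tendsto_vec_nth) (rule sconv_pointwise)
    moreover have "(\<lambda>s. g (z (\<theta> s)) k $ a) \<longlonglongrightarrow> g z' k $ a"
      by (rule continuous_on_tendsto_compose[OF gcont zlim \<theta>(1)]) (use zs in simp)
    ultimately have "(\<lambda>s. norm (h (\<psi> (\<theta> s)) (z (\<theta> s)) k $ a - g (z (\<theta> s)) k $ a)) \<longlonglongrightarrow> norm (g z' k $ a - g z' k $ a)"
      by (intro tendsto_norm tendsto_diff)
    then have "(\<lambda>s. norm (h (\<psi> (\<theta> s)) (z (\<theta> s)) k $ a - g (z (\<theta> s)) k $ a)) \<longlonglongrightarrow> 0" by simp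
    from order_tendstoD(2)[OF this \<eta>] obtain s where "norm (h (\<psi> (\<theta> s)) (z (\<theta> s)) k $ a - g (z (\<theta> s)) k $ a) < \<eta>"
      using eventually_happens'[OF sequentially_bot] by auto
    then show False using z(2)[of "\<theta> s"] by simp
  qed
  show ?thesis
  proof (rule LIMSEQ_I)
    fix \<epsilon> :: real assume \<epsilon>: "0 < \<epsilon>"
    \<comment> \<open>The circle has length \<open>2 * pi * e\<close>; after division by
      \<open>2 * pi\<close> the error is \<open>\<eta> * e\<close>, half of
      \<open>\<epsilon>\<close>.\<close>
    define \<eta> where "\<eta> = \<epsilon> / (2 * e)"
    have \<eta>: "0 < \<eta>" using \<epsilon> e by (simp add: \<eta>_def)
    from unif[OF \<eta>] obtain n where n: "\<forall>s\<ge>n. \<forall>z. cmod (z - ls) = e \<longrightarrow> norm (h s z k $ a - g z k $ a) < \<eta>" by (elim exE)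
    have "norm (q s k $ a - u k $ a) < \<epsilon>" if "n \<le> s" for s
    proof -
      have "norm (2 * of_real pi * \<i> * q s k $ a - 2 * of_real pi * \<i> * u k $ a) \<le> \<eta> * (2 * pi * e)"
        by (rule has_contour_integral_bound_circlepath[OF has_contour_integral_diff[OF int gint]])
          (use n that \<eta> e in \<open>simp_all add: less_imp_le\<close>)
      moreover have "2 * of_real pi * \<i> * q s k $ a - 2 * of_real pi * \<i> * u k $ a = (2 * of_real pi * \<i>) * (q s k $ a - u k $ a)"
        by (simp add: algebra_simps)
      ultimately have "norm (2 * complex_of_real pi * \<i>) * norm (q s k $ a - u k $ a) \<le> \<eta> * (2 * pi * e)"
        by (simp only: norm_mult)
      moreover have "norm (2 * complex_of_real pi * \<i>) = 2 * pi" by (simp add: norm_mult)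
      ultimately have "2 * pi * norm (q s k $ a - u k $ a) \<le> 2 * pi * (\<eta> * e)" by (simp only: mult_ac)
      then have "norm (q s k $ a - u k $ a) \<le> \<eta> * e" by simp
      then show ?thesis using \<epsilon> e by (simp add: \<eta>_def)
    qed
    then show "\<exists>n. \<forall>s\<ge>n. norm (q s k $ a - u k $ a) < \<epsilon>" by blast
  qed
qed

lemma LJ_G_span: "finite F \<Longrightarrow> {U. in_H J U} \<subseteq> fs.span F \<Longrightarrow> LJ.G J \<mu> \<subseteq> fs.span F"
  using LJ.G_D by auto

lemma finite_eigenvalues_LJ: "finite {\<mu>. is_eigenvalue (in_H J) (LJ J) \<mu>}"
proof -
  obtain F :: "'n fseq set" where F: "finite F" "{U. in_H J U} \<subseteq> fs.span F" using in_H_finite_dim by auto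
  have "finite {\<mu> \<in> UNIV. is_eigenvalue (in_H J) (LJ J) \<mu>}"
    by (rule LJ.finite_eigenvalues[OF F(1)]) (rule LJ_G_span[OF F])
  then show ?thesis by simp
qed

abbreviation ball_mult :: "nat \<Rightarrow> complex \<Rightarrow> real \<Rightarrow> enat" where
  "ball_mult J ls e \<equiv> (\<Sum>\<mu>\<in>{\<mu>. is_eigenvalue (in_H J) (LJ J) \<mu> \<and> cmod (\<mu> - ls) < e}. alg_mult (in_H J) (LJ J) \<mu>)"

lemma finite_ball_eigenvalues: "finite {\<mu>. is_eigenvalue (in_H J) (LJ J) \<mu> \<and> cmod (\<mu> - ls) < e}"
  by (rule finite_subset[OF _ finite_eigenvalues_LJ[of J]]) auto

lemma ball_mult_card:
  "\<exists>B. finite B \<and> ball_mult J ls e = enat (card B) \<and> (\<Union>\<mu>\<in>{\<mu>. cmod (\<mu> - ls) < e}. LJ.G J \<mu>) \<subseteq> fs.span B"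
proof -
  let ?\<Lambda> = "{\<mu>. is_eigenvalue (in_H J) (LJ J) \<mu> \<and> cmod (\<mu> - ls) < e}"
  obtain F :: "'n fseq set" where F: "finite F" "{U. in_H J U} \<subseteq> fs.span F" using in_H_finite_dim by auto
  from LJ.sum_alg_mult_eq_card[OF F(1) finite_ball_eigenvalues[of J ls e] LJ_G_span[OF F]]
  obtain B where B: "finite B" "(\<Union>\<mu>\<in>?\<Lambda>. LJ.G J \<mu>) \<subseteq> fs.span B" "ball_mult J ls e = enat (card B)" by (elim exE conjE)
  have "w \<in> fs.span B" if "w \<in> LJ.G J \<mu>" "cmod (\<mu> - ls) < e" for w \<mu>
  proof (cases "w = 0")
    case False
    then have "\<mu> \<in> ?\<Lambda>" using LJ.G_nonzero_eigenvalue[OF that(1)] that(2) by simp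
    then show ?thesis using B(2) that(1) by auto
  qed (simp add: fs.span_zero)
  then show ?thesis using B by (intro exI[of _ B]) auto
qed

text \<open>If infinitely many truncations had too few dimensions in the disc, the spectral
  projections of the vectors of \<open>B\<close> would be dependent there. Since these projections
  tend to the vectors themselves, a limit of the relations would be a relation inside
  \<open>B\<close>.\<close>

lemma multiplicity_lower:
  assumes e: "0 < e" and free: "\<And>z. cmod (z - ls) = e \<Longrightarrow> \<not> is_eigenvalue sqs L z"
    and B: "finite B" "fs.independent B" "B \<subseteq> L.G ls"
  shows "\<exists>J0. \<forall>J\<ge>J0. enat (card B) \<le> ball_mult J ls e"
proof (rule ccontr)
  assume neg: "\<not> ?thesis"
  have "\<exists>c>0. \<exists>J1. \<forall>J\<ge>J1. \<forall>z\<in>sphere ls e. \<forall>U. in_H J U \<longrightarrow> c * l2n U \<le> l2n (shift_op (LJ J) z U)"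
    by (rule uniform_lower_bound[OF compact_sphere]) (rule free, simp add: dist_norm norm_minus_commute)
  then obtain c J1 where c: "0 < c"
    and lb0: "\<forall>J\<ge>J1. \<forall>z\<in>sphere ls e. \<forall>U. in_H J U \<longrightarrow> c * l2n U \<le> l2n (shift_op (LJ J) z U)" by (elim exE conjE)
  have lb: "c * l2n U \<le> l2n (shift_op (LJ J) z U)" if "J1 \<le> J" "cmod (z - ls) = e" "in_H J U" for J z U
  proof -
    have "z \<in> sphere ls e" using that(2) by (simp add: dist_norm norm_minus_commute)
    then show ?thesis using lb0 that by simp
  qed
  have "\<exists>J\<ge>n. J1 \<le> J \<and> ball_mult J ls e < enat (card B)" for n
  proof -
    have "\<not> (\<forall>J\<ge>max n J1. enat (card B) \<le> ball_mult J ls e)" using neg by (simp only: not_ex simp_thms)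
    then show ?thesis by (auto simp: not_le)
  qed
  from frequently_subseq[OF this] obtain r :: "nat \<Rightarrow> nat" where r: "strict_mono r"
    "\<forall>n. J1 \<le> r n \<and> ball_mult (r n) ls e < enat (card B)" by (elim exE conjE)
  have rJ: "J1 \<le> r n" "ball_mult (r n) ls e < enat (card B)" for n using spec[OF r(2), of n] by simp_all
  have rlim: "filterlim r at_top sequentially" by (rule filterlim_subseq[OF r(1)])
  have nev: "\<not> is_eigenvalue (in_H (r s)) (LJ (r s)) z" if "cmod (z - ls) = e" for s z
    by (rule LJ_not_eigenvalue[OF c lb[OF rJ(1) that]])
  define Q where "Q = (\<lambda>s b q h. q \<in> fs.span (\<Union>\<mu>\<in>{\<mu>. cmod (\<mu> - ls) < e}. LJ.G (r s) \<mu>)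
    \<and> (\<forall>z. cmod (z - ls) = e \<longrightarrow> in_H (r s) (h z) \<and> shift_op (LJ (r s)) z (h z) = - trunc (r s) b)
    \<and> (\<forall>k a. ((\<lambda>z. h z k $ a) has_contour_integral 2 * of_real pi * \<i> * q k $ a) (circlepath ls e)))"
  have "\<forall>s. \<forall>b. \<exists>q h. Q s b q h"
  proof (intro allI)
    fix s and b :: "'n fseq"
    obtain F :: "'n fseq set" where F: "finite F" "{U. in_H (r s) U} \<subseteq> fs.span F" using in_H_finite_dim by auto
    show "\<exists>q h. Q s b q h" unfolding Q_def
      by (rule LJ.contour_projection[OF e nev LJ.D_subset_span_G[OF LJ_in_H F trunc_in_H]])
  qed
  then obtain q0 h where qh0: "\<forall>s. \<forall>b. Q s b (q0 s b) (h s b)" unfolding choice_iff by (elim exE)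
  have qh: "q0 s b \<in> fs.span (\<Union>\<mu>\<in>{\<mu>. cmod (\<mu> - ls) < e}. LJ.G (r s) \<mu>)"
    "cmod (z - ls) = e \<Longrightarrow> in_H (r s) (h s b z)" "cmod (z - ls) = e \<Longrightarrow> shift_op (LJ (r s)) z (h s b z) = - trunc (r s) b"
    "((\<lambda>z. h s b z k $ a) has_contour_integral 2 * of_real pi * \<i> * q0 s b k $ a) (circlepath ls e)" for s b z k a
    using spec[OF spec[OF qh0, of s], of b] unfolding Q_def by simp_all
  have qlim: "(\<lambda>s. q0 s b k $ a) \<longlonglongrightarrow> b k $ a" if b: "b \<in> B" for b k a
  proof (rule projection_convergence[OF e free _ rlim c lb[OF rJ(1)] qh(4) qh(2,3)])
    show "b \<in> L.G ls" using b B(3) by auto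
  qed
  have "\<forall>s. \<exists>c. (\<Sum>b\<in>B. cmod (c b)) = 1 \<and> (\<Sum>b\<in>B. scl (c b) (q0 s b)) = 0"
  proof
    fix s
    obtain B' where B': "finite B'" "ball_mult (r s) ls e = enat (card B')"
      "(\<Union>\<mu>\<in>{\<mu>. cmod (\<mu> - ls) < e}. LJ.G (r s) \<mu>) \<subseteq> fs.span B'" using ball_mult_card[of "r s" ls e] by (elim exE conjE)
    have "card B' < card B" using rJ(2)[of s] B'(2) by simp
    moreover have "q0 s b \<in> fs.span B'" for b
      using qh(1)[of s b] fs.span_minimal[OF B'(3) fs.subspace_span] by auto
    ultimately obtain d where d: "\<exists>b\<in>B. d b \<noteq> 0" "(\<Sum>b\<in>B. scl (d b) (q0 s b)) = 0"
      using family_dependent[OF B'(1) B(1), of "q0 s"] by auto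
    \<comment> \<open>Normalising the coefficients to total modulus one makes them subconverge and
      prevents the limiting relation from being trivial.\<close>
    define t where "t = (\<Sum>b\<in>B. cmod (d b))"
    from d(1) obtain b0 where b0: "b0 \<in> B" "d b0 \<noteq> 0" by auto
    have "cmod (d b0) \<le> t" unfolding t_def by (rule member_le_sum[OF b0(1)]) (simp_all add: B(1))
    moreover have "0 < cmod (d b0)" using b0(2) by simp
    ultimately have t: "0 < t" by linarith
    have "(\<Sum>b\<in>B. cmod (d b / of_real t)) = 1"
      using t by (simp add: norm_divide sum_divide_distrib[symmetric] t_def[symmetric])
    moreover have "(\<Sum>b\<in>B. scl (d b / of_real t) (q0 s b)) = scl (1 / of_real t) (\<Sum>b\<in>B. scl (d b) (q0 s b))"
      by (simp add: fs.scale_sum_right)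
    ultimately show "\<exists>c. (\<Sum>b\<in>B. cmod (c b)) = 1 \<and> (\<Sum>b\<in>B. scl (c b) (q0 s b)) = 0"
      unfolding d(2) by (intro exI[of _ "\<lambda>b. d b / of_real t"]) simp
  qed
  from choice[OF this] obtain d where d0: "\<forall>s. (\<Sum>b\<in>B. cmod (d s b)) = 1 \<and> (\<Sum>b\<in>B. scl (d s b) (q0 s b)) = 0" by (elim exE)
  have d: "(\<Sum>b\<in>B. cmod (d s b)) = 1" "(\<Sum>b\<in>B. scl (d s b) (q0 s b)) = 0" for s using spec[OF d0, of s] by simp_all
  have dB: "norm (d s b) \<le> 1" if "b \<in> B" for s b
    unfolding d(1)[of s, symmetric] by (rule member_le_sum[OF that]) (simp_all add: B(1))
  obtain \<phi> where \<phi>: "strict_mono \<phi>" "\<And>b. b \<in> B \<Longrightarrow> \<exists>l. (\<lambda>s. d (\<phi> s) b) \<longlonglongrightarrow> l"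
    using function_convergent_subsequence[OF countable_finite[OF B(1)], of d 1] dB by auto
  from \<phi>(2) have "\<forall>b\<in>B. \<exists>l. (\<lambda>s. d (\<phi> s) b) \<longlonglongrightarrow> l" by (intro ballI)
  from bchoice[OF this] obtain d' where d': "\<forall>b\<in>B. (\<lambda>s. d (\<phi> s) b) \<longlonglongrightarrow> d' b" by (elim exE)
  have "(\<lambda>s. \<Sum>b\<in>B. cmod (d (\<phi> s) b)) \<longlonglongrightarrow> (\<Sum>b\<in>B. cmod (d' b))"
    by (intro tendsto_sum tendsto_norm d'[rule_format])
  then have one: "(\<Sum>b\<in>B. cmod (d' b)) = 1" using LIMSEQ_unique[OF _ tendsto_const] by (simp only: d(1)) 
  have "(\<Sum>b\<in>B. scl (d' b) b) k $ a = 0" for k a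
  proof -
    have "(\<lambda>s. \<Sum>b\<in>B. d (\<phi> s) b * q0 (\<phi> s) b k $ a) \<longlonglongrightarrow> (\<Sum>b\<in>B. d' b * b k $ a)"
    proof (intro tendsto_sum tendsto_mult d'[rule_format])
      fix b assume "b \<in> B"
      from LIMSEQ_subseq_LIMSEQ[OF qlim[OF this] \<phi>(1)] show "(\<lambda>s. q0 (\<phi> s) b k $ a) \<longlonglongrightarrow> b k $ a" by (simp add: o_def)
    qed
    moreover have "(\<Sum>b\<in>B. d (\<phi> s) b * q0 (\<phi> s) b k $ a) = 0" for s
    proof -
      have "(\<Sum>b\<in>B. scl (d (\<phi> s) b) (q0 (\<phi> s) b)) k $ a = 0" by (simp add: d(2) fseq_apply)
      then show ?thesis by (simp add: fseq_apply sum_component)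
    qed
    ultimately have "(\<Sum>b\<in>B. d' b * b k $ a) = 0" using LIMSEQ_unique[OF _ tendsto_const] by simp
    then show ?thesis by (simp add: fseq_apply sum_component)
  qed
  then have "(\<Sum>b\<in>B. scl (d' b) b) = 0" by (simp add: fun_eq_iff vec_eq_iff zero_fun_apply)
  then have "\<forall>b\<in>B. d' b = 0" using B(2) fs.dependent_finite[OF B(1)] by auto
  then show False using one by simp
qed

text \<open>An excess of multiplicity gives flags with \<open>Suc (card B)\<close> vectors for
  infinitely many truncations; the limit flag would be that many orthonormal vectors inside
  \<open>L.G ls\<close>.\<close>

lemma multiplicity_upper:
  assumes z0: "\<not> is_eigenvalue sqs L z0" "z0 \<notin> cball ls e"
    and only: "\<And>\<mu>. \<mu> \<in> cball ls e \<Longrightarrow> is_eigenvalue sqs L \<mu> \<Longrightarrow> \<mu> = ls"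
    and B: "finite B" "L.G ls \<subseteq> fs.span B"
  shows "\<exists>J0. \<forall>J\<ge>J0. ball_mult J ls e \<le> enat (card B)"
proof (rule ccontr)
  assume neg: "\<not> ?thesis"
  have "\<exists>c>0. \<exists>J1. \<forall>J\<ge>J1. \<forall>z\<in>{z0}. \<forall>U. in_H J U \<longrightarrow> c * l2n U \<le> l2n (shift_op (LJ J) z U)"
    by (rule uniform_lower_bound) (use z0(1) in simp_all)
  then obtain c J1 where c: "0 < c"
    and lb: "\<forall>J\<ge>J1. \<forall>z\<in>{z0}. \<forall>U. in_H J U \<longrightarrow> c * l2n U \<le> l2n (shift_op (LJ J) z U)" by (elim exE conjE)
  have "\<exists>J\<ge>n. J1 \<le> J \<and> enat (card B) < ball_mult J ls e" for n
  proof -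
    have "\<not> (\<forall>J\<ge>max n J1. ball_mult J ls e \<le> enat (card B))" using neg by (simp only: not_ex simp_thms)
    then show ?thesis by (auto simp: not_le)
  qed
  from frequently_subseq[OF this] obtain r :: "nat \<Rightarrow> nat" where r: "strict_mono r"
    "\<forall>n. J1 \<le> r n \<and> enat (card B) < ball_mult (r n) ls e" by (elim exE conjE)
  have "\<forall>s. \<exists>u. LJ.flag (r s) (cball ls e) (Suc (card B)) u"
  proof
    fix s
    obtain F :: "'n fseq set" where F: "finite F" "{U. in_H (r s) U} \<subseteq> fs.span F" using in_H_finite_dim by auto
    show "\<exists>u. LJ.flag (r s) (cball ls e) (Suc (card B)) u"
    proof (rule LJ.flag_of_alg_mult[OF F(1) finite_ball_eigenvalues LJ_G_span[OF F]])
      \<comment> \<open>The labels are placed in the closed disc because limits of labels are taken;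
        \<open>only\<close> excludes further eigenvalues on its boundary as well.\<close>
      show "{\<mu>. is_eigenvalue (in_H (r s)) (LJ (r s)) \<mu> \<and> cmod (\<mu> - ls) < e} \<subseteq> cball ls e"
        by (auto simp: dist_norm norm_minus_commute)
      have "enat (card B) < ball_mult (r s) ls e" using r(2) by simp
      then show "enat (Suc (card B)) \<le> ball_mult (r s) ls e" using ileI1 by (simp add: eSuc_enat[symmetric])
    qed
  qed
  from choice[OF this] obtain u where u: "\<forall>s. LJ.flag (r s) (cball ls e) (Suc (card B)) (u s)" by (elim exE)
  have "\<exists>u'. L.flag (cball ls e) (Suc (card B)) u'"
  proof (rule limit_flag[OF z0(1) compact_cball z0(2) filterlim_subseq[OF r(1)] c])
    show "c * l2n U \<le> l2n (shift_op (LJ (r s)) z0 U)" if "in_H (r s) U" for s U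
      using lb that spec[OF r(2), of s] by simp
    show "LJ.flag (r s) (cball ls e) (Suc (card B)) (u s)" for s by (rule spec[OF u])
  qed
  then obtain u' where u': "L.flag (cball ls e) (Suc (card B)) u'" by (elim exE)
  have "u' i \<in> fs.span B" if "i < Suc (card B)" for i
    using L.flag_in_G[OF u' only that] B(2) by auto
  moreover have "orthonormal (Suc (card B)) u'" using u' by (simp add: L.flag_def)
  ultimately have "Suc (card B) \<le> card B" using B(1) by (intro orthonormal_independent)
  then show False by simp
qed

text \<open>Removing open discs about all eigenvalues leaves a compact set of regular points, on
  which \<open>uniform_lower_bound\<close> excludes eigenvalues of the truncations.\<close>

lemma eigenvalues_approximated:
  assumes e: "0 < e"
  shows "\<exists>J0. \<forall>J\<ge>J0. \<forall>\<mu>. is_eigenvalue (in_H J) (LJ J) \<mu> \<and> cmod \<mu> < R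
    \<longrightarrow> (\<exists>l. is_eigenvalue sqs L l \<and> cmod (\<mu> - l) < e)"
proof -
  define Z where "Z = cball 0 R - (\<Union>l\<in>{l. is_eigenvalue sqs L l}. ball l e)"
  have "compact Z" unfolding Z_def by (intro compact_diff compact_cball open_UN ballI open_ball)
  moreover have "\<And>z. z \<in> Z \<Longrightarrow> \<not> is_eigenvalue sqs L z" using e by (auto simp: Z_def)
  ultimately have "\<exists>c>0. \<exists>J1. \<forall>J\<ge>J1. \<forall>z\<in>Z. \<forall>U. in_H J U \<longrightarrow> c * l2n U \<le> l2n (shift_op (LJ J) z U)"
    by (rule uniform_lower_bound)
  then obtain c J1 where c: "0 < c" and lb: "\<forall>J\<ge>J1. \<forall>z\<in>Z. \<forall>U. in_H J U \<longrightarrow> c * l2n U \<le> l2n (shift_op (LJ J) z U)"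
    by (elim exE conjE)
  have "\<exists>l. is_eigenvalue sqs L l \<and> cmod (\<mu> - l) < e"
    if J: "J1 \<le> J" and \<mu>: "is_eigenvalue (in_H J) (LJ J) \<mu>" "cmod \<mu> < R" for J \<mu>
  proof (rule ccontr)
    assume no: "\<not> ?thesis"
    have Z: "\<mu> \<in> Z" using no \<mu>(2) by (auto simp: Z_def dist_norm norm_minus_commute)
    have "c * l2n U \<le> l2n (shift_op (LJ J) \<mu> U)" if "in_H J U" for U by (rule lb[rule_format, OF J Z that])
    from LJ_not_eigenvalue[OF c this] \<mu>(1) show False by simp
  qed
  then show ?thesis by (intro exI[of _ J1]) simp
qed

text \<open>One finite set spans all generalized eigenspaces in the disc at once, so it yields both
  finite multiplicities and finitely many eigenvalues. The point \<open>z0\<close> is removed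
  because back substitution along flags divides by \<open>\<mu> - z0\<close>.\<close>

lemma G_finite_dim:
  assumes z0: "\<not> is_eigenvalue sqs L z0"
  shows "\<exists>F. finite F \<and> (\<forall>\<mu>\<in>cball 0 R - {z0}. L.G \<mu> \<subseteq> fs.span F)"
proof (rule ccontr)
  assume "\<not> ?thesis"
  from L.infinite_flag[OF this] obtain u where u: "\<forall>d. L.flag (cball 0 R - {z0}) d u" by (elim exE)
  show False by (rule no_infinite_flag[OF z0 _ _ spec[OF u], of R]) simp_all
qed

lemma hill_convergence:
  assumes R: "0 < R" and noR: "\<And>l. cmod l = R \<Longrightarrow> \<not> is_eigenvalue sqs L l"
  shows "\<exists>e0>0. \<forall>e. 0 < e \<and> e < e0 \<longrightarrow> (\<exists>J0. \<forall>J\<ge>J0.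
    (\<forall>\<mu>. is_eigenvalue (in_H J) (LJ J) \<mu> \<and> cmod \<mu> < R \<longrightarrow> (\<exists>l. is_eigenvalue sqs L l \<and> cmod (\<mu> - l) < e)) \<and>
    (\<forall>ls. is_eigenvalue sqs L ls \<and> cmod ls < R \<longrightarrow> ball_mult J ls e = alg_mult sqs L ls))"
proof -
  \<comment> \<open>A point of the circle, regular by \<open>noR\<close>.\<close>
  define z0 where "z0 = complex_of_real R"
  have z0: "\<not> is_eigenvalue sqs L z0" using R by (intro noR) (simp add: z0_def)
  define S where "S = cball 0 (R + 1) - {z0}"
  obtain F where F: "finite F" "\<And>\<mu>. \<mu> \<in> S \<Longrightarrow> L.G \<mu> \<subseteq> fs.span F"
    using G_finite_dim[OF z0, of "R + 1"] unfolding S_def by auto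
  define E where "E = {\<mu>\<in>S. is_eigenvalue sqs L \<mu>}"
  have finE: "finite E" unfolding E_def by (rule L.finite_eigenvalues[OF F])
  \<comment> \<open>The distances to the circle keep \<open>z0\<close> outside each disc, the mutual
    distances isolate each eigenvalue in its closed disc, and \<open>1\<close> makes
    \<open>D\<close> nonempty so that its minimum exists.\<close>
  define D where "D = {1} \<union> (\<lambda>l. R - cmod l) ` {l\<in>E. cmod l < R} \<union> (\<lambda>(l, l'). cmod (l - l')) ` {(l, l'). l \<in> E \<and> l' \<in> E \<and> l \<noteq> l'}"
  have finD: "finite D"
  proof -
    have "finite {(l, l'). l \<in> E \<and> l' \<in> E \<and> l \<noteq> l'}" by (rule finite_subset[of _ "E \<times> E"]) (auto simp: finE)
    then show ?thesis unfolding D_def using finE by simp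
  qed
  define e0 where "e0 = Min D"
  have posD: "0 < x" if "x \<in> D" for x using that unfolding D_def by auto
  have e0: "0 < e0" unfolding e0_def using finD posD by (subst Min_gr_iff) (auto simp: D_def)
  have le: "e0 \<le> x" if "x \<in> D" for x unfolding e0_def using finD that by simp
  show ?thesis
  proof (intro exI[of _ e0] conjI e0 allI impI)
    fix e assume "0 < e \<and> e < e0"
    then have e: "0 < e" "e < e0" by simp_all
    have each: "\<exists>J0. \<forall>J\<ge>J0. ball_mult J ls e = alg_mult sqs L ls" if ls: "ls \<in> E" "cmod ls < R" for ls
    proof -
      have "R - cmod ls \<in> D" "1 \<in> D" using ls unfolding D_def by auto
      then have eR: "e < R - cmod ls" "e < 1" using le e by force+
      have only: "\<mu> = ls" if \<mu>: "\<mu> \<in> cball ls e" "is_eigenvalue sqs L \<mu>" for \<mu>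
      proof (rule ccontr)
        assume ne: "\<mu> \<noteq> ls"
        have d: "cmod (\<mu> - ls) \<le> e" using \<mu>(1) by (simp add: dist_norm norm_minus_commute)
        then have "cmod \<mu> \<le> R + 1" using norm_triangle_sub[of \<mu> ls] eR ls(2) by linarith
        moreover have "\<mu> \<noteq> z0" using \<mu>(2) z0 by auto
        ultimately have "\<mu> \<in> E" using \<mu>(2) by (simp add: E_def S_def)
        then have "cmod (\<mu> - ls) \<in> D" unfolding D_def using ls(1) ne by (intro UnI2 image_eqI[of _ _ "(\<mu>, ls)"]) simp_all
        then show False using le[of "cmod (\<mu> - ls)"] d e by linarith
      qed
      have z0c: "z0 \<notin> cball ls e"
      proof
        assume "z0 \<in> cball ls e"
        then have "cmod (z0 - ls) \<le> e" by (simp add: dist_norm norm_minus_commute)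
        then show False using norm_triangle_sub[of z0 ls] eR R by (simp add: z0_def)
      qed
      have free: "\<not> is_eigenvalue sqs L z" if "cmod (z - ls) = e" for z
      proof
        assume "is_eigenvalue sqs L z"
        then have "z = ls" by (intro only) (use that in \<open>simp_all add: dist_norm norm_minus_commute\<close>)
        then show False using that e by simp
      qed
      have "ls \<in> S" using ls by (simp add: E_def)
      from L.alg_mult_eq_card[OF F(1) F(2)[OF this]] obtain B where B: "B \<subseteq> L.G ls" "finite B" "fs.independent B"
        "L.G ls \<subseteq> fs.span B" "alg_mult sqs L ls = enat (card B)" by (elim exE conjE)
      have "\<exists>J0. \<forall>J\<ge>J0. enat (card B) \<le> ball_mult J ls e"
        by (rule multiplicity_lower[OF e(1) _ B(2,3,1)]) (rule free)
      then obtain Ja where Ja: "\<forall>J\<ge>Ja. enat (card B) \<le> ball_mult J ls e" by (elim exE)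
      have "\<exists>J0. \<forall>J\<ge>J0. ball_mult J ls e \<le> enat (card B)"
        by (rule multiplicity_upper[OF z0 z0c _ B(2,4)]) (rule only)
      then obtain Jb where Jb: "\<forall>J\<ge>Jb. ball_mult J ls e \<le> enat (card B)" by (elim exE)
      show ?thesis unfolding B(5)
        by (intro exI[of _ "max Ja Jb"] allI impI antisym Ja[rule_format] Jb[rule_format]) simp_all
    qed
    have "\<forall>\<^sub>F J in sequentially. \<forall>ls\<in>{ls\<in>E. cmod ls < R}. ball_mult J ls e = alg_mult sqs L ls"
    proof (rule eventually_ball_finite)
      show "finite {ls\<in>E. cmod ls < R}" using finE by simp
      show "\<forall>ls\<in>{ls\<in>E. cmod ls < R}. \<forall>\<^sub>F J in sequentially. ball_mult J ls e = alg_mult sqs L ls"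
        using each by (auto simp: eventually_sequentially)
    qed
    then obtain Ja where Ja: "\<forall>J\<ge>Ja. \<forall>ls\<in>{ls\<in>E. cmod ls < R}. ball_mult J ls e = alg_mult sqs L ls"
      unfolding eventually_sequentially by (elim exE)
    obtain Jb where Jb: "\<forall>J\<ge>Jb. \<forall>\<mu>. is_eigenvalue (in_H J) (LJ J) \<mu> \<and> cmod \<mu> < R
      \<longrightarrow> (\<exists>l. is_eigenvalue sqs L l \<and> cmod (\<mu> - l) < e)"
      using eigenvalues_approximated[OF e(1), of R] by (elim exE)
    have inE: "ls \<in> E" if "is_eigenvalue sqs L ls" "cmod ls < R" for ls
      using that z0 by (auto simp: E_def S_def)
    show "\<exists>J0. \<forall>J\<ge>J0.
      (\<forall>\<mu>. is_eigenvalue (in_H J) (LJ J) \<mu> \<and> cmod \<mu> < R \<longrightarrow> (\<exists>l. is_eigenvalue sqs L l \<and> cmod (\<mu> - l) < e)) \<and>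
      (\<forall>ls. is_eigenvalue sqs L ls \<and> cmod ls < R \<longrightarrow> ball_mult J ls e = alg_mult sqs L ls)"
    proof (intro exI[of _ "max Ja Jb"] allI impI conjI)
      fix J ls assume "max Ja Jb \<le> J" "is_eigenvalue sqs L ls \<and> cmod ls < R"
      then show "ball_mult J ls e = alg_mult sqs L ls" using Ja inE by simp
    next
      fix J \<mu> assume J: "max Ja Jb \<le> J" and \<mu>: "is_eigenvalue (in_H J) (LJ J) \<mu> \<and> cmod \<mu> < R"
      have "Jb \<le> J" using J by simp
      from Jb[rule_format, OF this \<mu>] show "\<exists>l. is_eigenvalue sqs L l \<and> cmod (\<mu> - l) < e" .
    qed
  qed
qed

end

theorem theorem4p3:
  fixes X C :: real and A0 A1 A2 :: "real \<Rightarrow> complex^'n::finite^'n"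
  assumes "X > 0" and "C > 0"
    and "L2_per X A0" and "L2_per X A1" and "L2_per X A2"
    and herm: "\<forall>x i j. A2 x $ i $ j = cnj (A2 x $ j $ i)"
    and coerc: "\<forall>x (v :: complex^'n). Re (\<Sum>i\<in>UNIV. \<Sum>j\<in>UNIV. cnj (v $ i) * A2 x $ i $ j * v $ j) \<ge> C * (norm v)^2"
  shows "\<forall>R > 0. (\<forall>l. cmod l = R \<longrightarrow> \<not> is_eigenvalue l2seq (hill_op X A0 A1 A2) l) \<longrightarrow>
    (\<exists>e0 > 0. \<forall>e. 0 < e \<and> e < e0 \<longrightarrow> (\<exists>J0::nat. \<forall>J \<ge> J0.
       (\<forall>\<mu>. is_eigenvalue (in_H J) (hill_trunc X A0 A1 A2 J) \<mu> \<and> cmod \<mu> < R \<longrightarrow>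
            (\<exists>l. is_eigenvalue l2seq (hill_op X A0 A1 A2) l \<and> cmod (\<mu> - l) < e)) \<and>
       (\<forall>ls. is_eigenvalue l2seq (hill_op X A0 A1 A2) ls \<and> cmod ls < R \<longrightarrow>
            (\<Sum>\<mu>\<in>{\<mu>. is_eigenvalue (in_H J) (hill_trunc X A0 A1 A2 J) \<mu> \<and> cmod (\<mu> - ls) < e}.
                alg_mult (in_H J) (hill_trunc X A0 A1 A2 J) \<mu>)
            = alg_mult l2seq (hill_op X A0 A1 A2) ls)))"
proof -
  interpret hill X C A0 A1 A2
    by unfold_locales (use assms in blast)+
  show ?thesis unfolding l2seq_eq_sqs using hill_convergence by blast
qed

end
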